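(* Let $q>2$ be a prime power and let $M$ be a simple $GF(q)$-representable matroid. The following are equivalent. (i) $M$ is $GF(q)$-chordal. (ii) $M$ has no induced minor isomorphic to a member of $\{U_{2,k}:2<k\leq q\}\cup\{U_{3,q+2}\}$. (iii) $M$ has no induced restriction isomorphic to a member of $\{U_{n,n+1}:n\geq 2\}\cup\{U_{2+t,k+t}:4\leq k\leq q\text{ and }0\leq t\leq q-3\}\cup\{U_{3,q+2}\}$.
   Context: All matroids are finite and simple; every contraction is immediately followed by simplification. An induced restriction of $M$ is $M|F$ for a flat $F$ of $M$; an induced minor is any matroid obtained by a sequence of contractions (followed by simplification) and restrictions to flats. Generalized parallel connection: if $E(M_1)\cap E(M_2)=T$, $M_1|T=M_2|T=N$ and $T$ is a modular flat of $M_1$, then $P_N(M_1,M_2)$ is the matroid on $E(M_1)\cup E(M_2)$ whose flats are the sets $F$ with $F\cap E(M_i)$ a flat of $M_i$ for $i=1,2$. A matroid is $GF(q)$-chordal if it can be obtained, starting from projective geometries over $GF(q)$, by repeatedly taking generalized parallel connections $P_N(M_1,M_2)$ of previously obtained matroids across a common restriction $N$ that is a projective geometry over $GF(q)$. *)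

theory Defs
  imports
    "HOL-Library.Cardinality"
    "HOL-Library.Function_Algebras"
    "HOL-Number_Theory.Prime_Powers"
begin

section \<open>Matroids\<close>

record 'a matroid_data =
  ground :: "'a set"
  indep :: "'a set \<Rightarrow> bool"

locale matroid =
  fixes M :: "'a matroid_data"
  assumes finite_ground: "finite (ground M)"
    and indep_subset_ground: "indep M X \<Longrightarrow> X \<subseteq> ground M"
    and indep_empty: "indep M {}"
    and indep_mono: "indep M Y \<Longrightarrow> X \<subseteq> Y \<Longrightarrow> indep M X"
    and indep_augment:
      "indep M X \<Longrightarrow> indep M Y \<Longrightarrow> card X < card Y \<Longrightarrow> \<exists>y\<in>Y - X. indep M (insert y X)"

definition rank_of :: "'a matroid_data \<Rightarrow> 'a set \<Rightarrow> nat" where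
  "rank_of M X = Max (card ` {I. I \<subseteq> X \<and> indep M I})"

definition closure_of :: "'a matroid_data \<Rightarrow> 'a set \<Rightarrow> 'a set" where
  "closure_of M X = {e \<in> ground M. rank_of M (insert e X) = rank_of M X}"

definition flat :: "'a matroid_data \<Rightarrow> 'a set \<Rightarrow> bool" where
  "flat M F \<longleftrightarrow> F \<subseteq> ground M \<and> closure_of M F = F"

definition modular_flat :: "'a matroid_data \<Rightarrow> 'a set \<Rightarrow> bool" where
  "modular_flat M T \<longleftrightarrow> flat M T \<and>
     (\<forall>F. flat M F \<longrightarrow> rank_of M T + rank_of M F = rank_of M (T \<union> F) + rank_of M (T \<inter> F))"

definition simple_matroid :: "'a matroid_data \<Rightarrow> bool" where
  "simple_matroid M \<longleftrightarrow> matroid M \<and> (\<forall>x\<in>ground M. \<forall>y\<in>ground M. indep M {x, y})"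

definition restriction :: "'a matroid_data \<Rightarrow> 'a set \<Rightarrow> 'a matroid_data" where
  "restriction M X = \<lparr>ground = X, indep = (\<lambda>I. I \<subseteq> X \<and> indep M I)\<rparr>"

text \<open>\<open>I\<close> is independent in the contraction of \<open>C\<close> iff its union with a basis of \<open>C\<close> is
  independent; which basis is used does not matter.\<close>

definition contraction :: "'a matroid_data \<Rightarrow> 'a set \<Rightarrow> 'a matroid_data" where
  "contraction M C =
     \<lparr>ground = ground M - C,
      indep = (\<lambda>I. I \<subseteq> ground M - C \<and>
        (\<exists>B\<subseteq>C. indep M B \<and> card B = rank_of M C \<and> indep M (I \<union> B)))\<rparr>"

definition matroid_iso :: "'a matroid_data \<Rightarrow> 'b matroid_data \<Rightarrow> bool" where
  "matroid_iso M N \<longleftrightarrow>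
     (\<exists>f. bij_betw f (ground M) (ground N) \<and> (\<forall>X\<subseteq>ground M. indep M X \<longleftrightarrow> indep N (f ` X)))"

definition uniform_matroid :: "nat \<Rightarrow> nat \<Rightarrow> nat matroid_data" where
  "uniform_matroid r n =
     \<lparr>ground = {..<n}, indep = (\<lambda>X. X \<subseteq> {..<n} \<and> card X \<le> r)\<rparr>"

definition nonloops :: "'a matroid_data \<Rightarrow> 'a set" where
  "nonloops M = {x \<in> ground M. indep M {x}}"

definition parallel :: "'a matroid_data \<Rightarrow> 'a \<Rightarrow> 'a \<Rightarrow> bool" where
  "parallel M x y \<longleftrightarrow> x \<in> nonloops M \<and> y \<in> nonloops M \<and> (x = y \<or> \<not> indep M {x, y})"

text \<open>A simplification deletes the loops and keeps one element of each parallel class. It is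
  unique only up to isomorphism, so it is a relation.\<close>

definition is_simplification_of :: "'a matroid_data \<Rightarrow> 'a matroid_data \<Rightarrow> bool" where
  "is_simplification_of N M \<longleftrightarrow>
     (\<exists>X\<subseteq>nonloops M. (\<forall>e\<in>nonloops M. \<exists>!x. x \<in> X \<and> parallel M e x) \<and> N = restriction M X)"


section \<open>Induced restrictions and induced minors\<close>

definition induced_restriction :: "'a matroid_data \<Rightarrow> 'a matroid_data \<Rightarrow> bool" where
  "induced_restriction M N \<longleftrightarrow> (\<exists>F. flat M F \<and> N = restriction M F)"

inductive induced_minor :: "'a matroid_data \<Rightarrow> 'a matroid_data \<Rightarrow> bool" for M where
  refl: "induced_minor M M"
| contract: "induced_minor M N \<Longrightarrow> C \<subseteq> ground N \<Longrightarrow>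
    is_simplification_of N' (contraction N C) \<Longrightarrow> induced_minor M N'"
| restrict: "induced_minor M N \<Longrightarrow> flat N F \<Longrightarrow> induced_minor M (restriction N F)"


section \<open>Representability and projective geometries\<close>

text \<open>The space of column vectors of length \<open>n\<close> is the set of sequences vanishing from index
  \<open>n\<close> on, a subspace of the vector space of all sequences.\<close>

definition seq_scale :: "'f::field \<Rightarrow> (nat \<Rightarrow> 'f) \<Rightarrow> (nat \<Rightarrow> 'f)" where
  "seq_scale c v = (\<lambda>i. c * v i)"

global_interpretation seq: vector_space seq_scale
  by unfold_locales (simp_all add: seq_scale_def fun_eq_iff algebra_simps)

definition vectors :: "nat \<Rightarrow> (nat \<Rightarrow> 'f::field) set" where
  "vectors n = {v. \<forall>i\<ge>n. v i = 0}"

definition representable :: "'f::field itself \<Rightarrow> 'a matroid_data \<Rightarrow> bool" where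
  "representable K M \<longleftrightarrow> matroid M \<and>
     (\<exists>n. \<exists>\<phi> :: 'a \<Rightarrow> nat \<Rightarrow> 'f. \<phi> ` ground M \<subseteq> vectors n \<and>
       (\<forall>X\<subseteq>ground M. indep M X \<longleftrightarrow> inj_on \<phi> X \<and> seq.independent (\<phi> ` X)))"

definition vector_matroid :: "nat \<Rightarrow> (nat \<Rightarrow> 'f::field) matroid_data" where
  "vector_matroid n =
     \<lparr>ground = vectors n, indep = (\<lambda>X. X \<subseteq> vectors n \<and> seq.independent X)\<rparr>"

text \<open>The projective geometry of rank \<open>n\<close> is the simple matroid associated with the full vector
  space of dimension \<open>n\<close>. The empty matroid (\<open>n = 0\<close>) and the one-point matroid (\<open>n = 1\<close>) are
  included.\<close>

definition projective_geometry :: "'f::{field,finite} itself \<Rightarrow> 'a matroid_data \<Rightarrow> bool" where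
  "projective_geometry K M \<longleftrightarrow> matroid M \<and>
     (\<exists>n. \<exists>P :: (nat \<Rightarrow> 'f) matroid_data.
        is_simplification_of P (vector_matroid n) \<and> matroid_iso M P)"


section \<open>Generalized parallel connections and chordality\<close>

text \<open>\<open>M = P\<^sub>N(M\<^sub>1, M\<^sub>2)\<close>, including the conditions under which it is defined; the set along which
  \<open>M\<^sub>1\<close> and \<open>M\<^sub>2\<close> are glued is necessarily \<open>ground N\<close>.\<close>

definition generalized_parallel_connection ::
  "'a matroid_data \<Rightarrow> 'a matroid_data \<Rightarrow> 'a matroid_data \<Rightarrow> 'a matroid_data \<Rightarrow> bool" where
  "generalized_parallel_connection N M1 M2 M \<longleftrightarrow>
     matroid M1 \<and> matroid M2 \<and> matroid M \<and>
     ground N = ground M1 \<inter> ground M2 \<and>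
     restriction M1 (ground N) = N \<and> restriction M2 (ground N) = N \<and>
     modular_flat M1 (ground N) \<and>
     ground M = ground M1 \<union> ground M2 \<and>
     (\<forall>F. flat M F \<longleftrightarrow> F \<subseteq> ground M1 \<union> ground M2 \<and>
        flat M1 (F \<inter> ground M1) \<and> flat M2 (F \<inter> ground M2))"

inductive chordal :: "'f::{field,finite} itself \<Rightarrow> 'a matroid_data \<Rightarrow> bool" for K where
  projective: "projective_geometry K M \<Longrightarrow> chordal K M"
| glue: "chordal K M1 \<Longrightarrow> chordal K M2 \<Longrightarrow> projective_geometry K N \<Longrightarrow>
    generalized_parallel_connection N M1 M2 M \<Longrightarrow> chordal K M"

end

(*
  Represent M by vectors and let S be the set of all scalar multiples of these vectors. Call two
  points adjacent if the projective line through them lies in S. Everything hinges on the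
  condition "has_chords" that every circuit contains two adjacent points, even after omitting one
  element. It follows from (iii), since a minimal chordless circuit spans a uniform flat, and since
  uniform matroids over GF(q) satisfy the classical arc bounds. It is inherited by contractions, so
  that an induced cycle of length at least 4 in the adjacency graph can be contracted to one of
  length 4, which is impossible for q > 2. As in Dirac's theorem on chordal graphs, there is then a
  subspace contained in S that separates the graph, and has_chords turns this into a generalized
  parallel connection. Conversely, glued projective geometries have chords and are closed under
  induced minors, and a line with at most q points or a plane arc has no chords.
*)
theory Submission
  imports Defs
begin

section \<open>Chords of circuits\<close>

text \<open>Matroid operations become linear: contraction is an endomorphism with prescribed kernel,
  restriction to a flat is intersection with a subspace, gluing is a condition on spans. The chord
  must avoid a prescribed element so that three collinear points already force a full line and so
  that the property survives contraction of a point \<open>p\<close>: a circuit lifts up to a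
  multiple of \<open>p\<close>, and a chord at \<open>p\<close> is absorbed by moving its other end
  along it. The parameter ranges come from the arc bounds: an arc of rank \<open>r\<close> with
  \<open>n \<ge> r + 2\<close> points satisfies \<open>n \<le> q + r - 1\<close> and
  \<open>r \<le> q - 1\<close>, which for \<open>t = r - 2\<close> and \<open>k = n - t\<close>
  reads \<open>4 \<le> k \<le> q + 1\<close> and \<open>t \<le> q - 3\<close>. The extreme
  \<open>k = q + 1\<close> is a full line for \<open>r = 2\<close>, is the separate member
  \<open>U_{3,q+2}\<close> for \<open>r = 3\<close>, and cannot occur for \<open>r \<ge> 4\<close>.
  The assumption \<open>q > 2\<close> supplies a scalar other than 0 and 1, needed to fill planes,
  and it lists \<open>U_{2,3}\<close> in (ii), to which every \<open>U_{n,n+1}\<close>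
  contracts.\<close>

locale finite_field_space = vector_space scale
  for scale :: "'f::{field,finite} \<Rightarrow> 'b::ab_group_add \<Rightarrow> 'b" (infixr \<open>*s\<close> 75)
begin

sublocale endo: vector_space_pair scale scale
  by unfold_locales

text \<open>Projective point sets are handled as unions of one-dimensional subspaces; the
  coefficients of a circuit can then be absorbed into its members.\<close>

definition conic :: "'b set \<Rightarrow> bool" where
  "conic S \<longleftrightarrow> 0 \<in> S \<and> (\<forall>c. \<forall>x\<in>S. c *s x \<in> S)"

text \<open>For independent \<open>x\<close> and \<open>y\<close>, adjacency means that the whole projective line \<open>xy\<close> lies in \<open>S\<close>.\<close>

definition adj :: "'b set \<Rightarrow> 'b \<Rightarrow> 'b \<Rightarrow> bool" where
  "adj S x y \<longleftrightarrow> (\<forall>a b. a *s x + b *s y \<in> S)"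

definition chorded :: "'b set \<Rightarrow> 'b set \<Rightarrow> bool" where
  "chorded S I \<longleftrightarrow> (\<exists>x\<in>I. \<exists>y\<in>I. x \<noteq> y \<and> adj S x y)"

text \<open>Up to scaling, the circuits of \<open>S\<close> through a point \<open>e\<close> are the independent sets summing to \<open>e\<close>;
  so \<open>has_chords S\<close> says that every circuit has a chord avoiding any prescribed element.\<close>

definition has_chords :: "'b set \<Rightarrow> bool" where
  "has_chords S \<longleftrightarrow>
     (\<forall>I\<subseteq>S. finite I \<longrightarrow> independent I \<longrightarrow> 2 \<le> card I \<longrightarrow> \<Sum>I \<in> S \<longrightarrow> chorded S I)"

text \<open>The linear counterpart of \<open>chordal\<close>: the condition in \<open>union\<close> makes \<open>S \<inter> T\<close> a subspace.\<close>

inductive decomposable :: "'b set \<Rightarrow> bool" where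
  full: "subspace S \<Longrightarrow> decomposable S"
| union: "decomposable S \<Longrightarrow> decomposable T \<Longrightarrow> span S \<inter> span T \<subseteq> S \<inter> T \<Longrightarrow> decomposable (S \<union> T)"

section \<open>Calculus of conic sets and adjacency\<close>

lemma has_chordsD:
  "has_chords S \<Longrightarrow> I \<subseteq> S \<Longrightarrow> finite I \<Longrightarrow> independent I \<Longrightarrow> 2 \<le> card I \<Longrightarrow> \<Sum>I \<in> S \<Longrightarrow> chorded S I"
  by (auto simp: has_chords_def)

lemma conic_zero: "conic S \<Longrightarrow> 0 \<in> S"
  and conic_scale: "conic S \<Longrightarrow> x \<in> S \<Longrightarrow> c *s x \<in> S"
  by (auto simp: conic_def)

lemma conic_minus: "conic S \<Longrightarrow> x \<in> S \<Longrightarrow> - x \<in> S"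
  using conic_scale[of S x "-1"] by simp

lemma conic_scale_iff: "conic S \<Longrightarrow> c \<noteq> 0 \<Longrightarrow> c *s x \<in> S \<longleftrightarrow> x \<in> S"
  using conic_scale[of S x c] conic_scale[of S "c *s x" "inverse c"] by auto

lemma subspace_conic: "subspace S \<Longrightarrow> conic S"
  by (simp add: conic_def subspace_0 subspace_scale)

lemma adjD: "adj S x y \<Longrightarrow> a *s x + b *s y \<in> S"
  by (simp add: adj_def)

lemma adj_left: "adj S x y \<Longrightarrow> x \<in> S" and adj_right: "adj S x y \<Longrightarrow> y \<in> S"
  using adjD[of S x y 1 0] adjD[of S x y 0 1] by auto

lemma adj_add: "adj S x y \<Longrightarrow> x + y \<in> S"
  using adjD[of S x y 1 1] by auto

lemma adj_sym: "adj S x y \<Longrightarrow> adj S y x"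
  unfolding adj_def by (metis add.commute)

lemma adj_comb: "adj S x y \<Longrightarrow> adj S (a *s x + b *s y) (c *s x + d *s y)"
  unfolding adj_def
proof (intro allI)
  fix e f assume "\<forall>a b. a *s x + b *s y \<in> S"
  then have "(e * a + f * c) *s x + (e * b + f * d) *s y \<in> S" by blast
  then show "e *s (a *s x + b *s y) + f *s (c *s x + d *s y) \<in> S"
    by (simp add: algebra_simps)
qed

lemma adj_scale: "adj S x y \<Longrightarrow> adj S (a *s x) (b *s y)"
  using adj_comb[of S x y a 0 0 b] by simp

lemma adj_scale_iff: "a \<noteq> 0 \<Longrightarrow> b \<noteq> 0 \<Longrightarrow> adj S (a *s x) (b *s y) \<longleftrightarrow> adj S x y"
  using adj_scale[of S x y a b] adj_scale[of S "a *s x" "b *s y" "inverse a" "inverse b"] by auto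

lemma adj_mono: "adj S x y \<Longrightarrow> S \<subseteq> T \<Longrightarrow> adj T x y"
  by (auto simp: adj_def)

lemma chorded_mono: "chorded S I \<Longrightarrow> S \<subseteq> T \<Longrightarrow> I \<subseteq> J \<Longrightarrow> chorded T J"
  unfolding chorded_def by (meson adj_mono subsetD)

lemma adj_subspace: "subspace K \<Longrightarrow> K \<subseteq> S \<Longrightarrow> x \<in> K \<Longrightarrow> y \<in> K \<Longrightarrow> adj S x y"
  unfolding adj_def by (meson subsetD subspace_add subspace_scale)

text \<open>Parallel vectors count as adjacent, and so does 0 with any member of \<open>S\<close>.
  Non-adjacency therefore already carries the independence needed in later case splits.\<close>

lemma adj_multiple: "conic S \<Longrightarrow> x \<in> S \<Longrightarrow> adj S x (c *s x)"
  unfolding adj_def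
proof (intro allI)
  fix a b assume "conic S" "x \<in> S"
  then have "(a + b * c) *s x \<in> S" by (rule conic_scale)
  then show "a *s x + b *s c *s x \<in> S" by (simp add: algebra_simps)
qed

lemma adj_image:
  assumes "Vector_Spaces.linear scale scale f" "adj S x y"
  shows "adj (f ` S) (f x) (f y)"
  unfolding adj_def
proof (intro allI)
  fix a b
  have "f (a *s x + b *s y) \<in> f ` S" using adjD[OF assms(2)] by blast
  then show "a *s f x + b *s f y \<in> f ` S"
    using assms(1) by (simp add: endo.linear_add endo.linear_scale)
qed

lemma chorded_image:
  assumes "Vector_Spaces.linear scale scale f" "inj_on f J" "chorded S J"
  shows "chorded (f ` S) (f ` J)"
  using assms adj_image[OF assms(1)] unfolding chorded_def inj_on_def by blast

lemma chorded_doubleton: "chorded S {x, y} \<Longrightarrow> adj S x y"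
  unfolding chorded_def using adj_sym by auto

lemma independent_pair_iff:
  "x \<noteq> y \<Longrightarrow> independent {x, y} \<longleftrightarrow> x \<noteq> 0 \<and> y \<notin> span {x}"
  by (metis dependent_single dependent_zero independent_insert insertCI insert_commute singletonD)

lemma scaled_independent:
  assumes "finite J" "independent J" "\<And>j. j \<in> J \<Longrightarrow> c j \<noteq> 0"
  shows "inj_on (\<lambda>j. c j *s j) J" and "independent ((\<lambda>j. c j *s j) ` J)"
proof -
  show inj: "inj_on (\<lambda>j. c j *s j) J"
  proof (rule inj_onI, rule ccontr)
    fix i j assume ij: "i \<in> J" "j \<in> J" "c i *s i = c j *s j" "i \<noteq> j"
    have "i = (c j / c i) *s j"
      using ij(3) assms(3)[OF ij(1)] by (metis divide_inverse_commute scale_left_imp_eq scale_scale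
          right_inverse scale_one)
    then have "i \<in> span (J - {i})"
      using ij by (metis Diff_iff singletonD span_base span_scale)
    then show False using assms(2) ij(1) unfolding dependent_def by blast
  qed
  show "independent ((\<lambda>j. c j *s j) ` J)"
  proof (rule independent_if_scalars_zero)
    show "finite ((\<lambda>j. c j *s j) ` J)" using assms(1) by simp
  next
    fix u x assume s: "(\<Sum>x\<in>(\<lambda>j. c j *s j) ` J. u x *s x) = 0" and x: "x \<in> (\<lambda>j. c j *s j) ` J"
    then obtain j where j: "j \<in> J" "x = c j *s j" by blast
    have "(\<Sum>j\<in>J. (u (c j *s j) * c j) *s j) = 0"
      using s by (simp add: sum.reindex[OF inj])
    from independentD[OF assms(2,1) subset_refl this j(1)]
    show "u x = 0" using assms(3)[OF j(1)] j(2) by simp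
  qed
qed

text \<open>Rescaling the members of \<open>J\<close> turns all coefficients into 1 and does not
  affect adjacency. The assumption on chords concerns sets of the size of \<open>J\<close> only,
  which makes the lemma applicable inside an induction on the size of a circuit.\<close>

lemma chorded_relation:
  assumes S: "conic S" and J: "J \<subseteq> S" "finite J" "independent J" and c: "\<And>j. j \<in> J \<Longrightarrow> c j \<noteq> 0"
    and sum: "(\<Sum>j\<in>J. c j *s j) \<in> S"
    and chords: "\<And>I. I \<subseteq> S \<Longrightarrow> finite I \<Longrightarrow> independent I \<Longrightarrow> card I = card J \<Longrightarrow> \<Sum>I \<in> S \<Longrightarrow> chorded S I"
  shows "chorded S J"
proof -
  let ?I = "(\<lambda>j. c j *s j) ` J"
  note sc = scaled_independent[OF J(2,3) c]
  have "chorded S ?I"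
  proof (rule chords)
    show "?I \<subseteq> S" using J S conic_scale by blast
    show "card ?I = card J" using sc(1) by (rule card_image)
    show "\<Sum>?I \<in> S" using sum by (simp add: sum.reindex[OF sc(1)])
  qed (use J sc in auto)
  then obtain i j where "i \<in> J" "j \<in> J" "i \<noteq> j" "adj S (c i *s i) (c j *s j)"
    unfolding chorded_def by blast
  then show ?thesis using adj_scale_iff c unfolding chorded_def by blast
qed

text \<open>With one of three collinear points omitted, the only possible chord joins the other two,
  so a third point on a line forces the full line.\<close>

lemma adj_collinear:
  assumes "conic S"
    and chords: "\<And>I. I \<subseteq> S \<Longrightarrow> finite I \<Longrightarrow> independent I \<Longrightarrow> card I = 2 \<Longrightarrow> \<Sum>I \<in> S \<Longrightarrow> chorded S I"
    and "x \<in> S" "y \<in> S" "a \<noteq> 0" "b \<noteq> 0" "a *s x + b *s y \<in> S"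
  shows "adj S x y"
proof (cases "x = 0 \<or> y \<in> span {x}")
  case True
  then show ?thesis
  proof
    assume "x = 0"
    then show ?thesis using adj_sym[OF adj_multiple[OF assms(1,4), of 0]] by simp
  next
    assume "y \<in> span {x}"
    then obtain k where "y = k *s x" by (auto simp: span_singleton)
    then show ?thesis using adj_multiple[OF assms(1,3)] by simp
  qed
next
  case False
  then have ne: "x \<noteq> y" by (auto simp: span_base)
  have "independent {x, y}" using False ne by (simp add: independent_pair_iff)
  have "chorded S {x, y}"
    by (rule chorded_relation[where c="\<lambda>j. if j = x then a else b"])
      (use assms ne \<open>independent {x, y}\<close> in auto)
  then show ?thesis by (rule chorded_doubleton)
qed

lemma has_chords_adj:
  assumes "conic S" "has_chords S" "x \<in> S" "y \<in> S" "a \<noteq> 0" "b \<noteq> 0" "a *s x + b *s y \<in> S"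
  shows "adj S x y"
  by (rule adj_collinear[OF assms(1) _ assms(3-)]) (auto intro: has_chordsD[OF assms(2)])

section \<open>Decomposable sets: chords, subspace sections and linear images\<close>

lemma decomposable_conic: "decomposable S \<Longrightarrow> conic S"
  by (induction rule: decomposable.induct) (auto simp: subspace_conic, auto simp: conic_def)

text \<open>The members of \<open>I\<close> outside \<open>S\<close> sum to a vector of both spans,
  hence of \<open>S \<inter> T\<close>. They form a circuit within \<open>T\<close>, and there are
  at least two of them because a single one would itself lie in \<open>S\<close>.\<close>

lemma union_has_chords_aux:
  assumes ST: "span S \<inter> span T \<subseteq> S \<inter> T" and hS: "has_chords S" and hT: "has_chords T"
    and I: "I \<subseteq> S \<union> T" "finite I" "independent I" "2 \<le> card I" "\<Sum>I \<in> S"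
  shows "chorded (S \<union> T) I"
proof -
  show ?thesis
  proof (cases "I \<subseteq> S")
    case True
    then show ?thesis using has_chordsD[OF hS] I chorded_mono[of S I "S \<union> T" I] by simp
  next
    case False
    let ?J = "I - S"
    have fin: "finite ?J" using I(2) by simp
    have "\<Sum>I = \<Sum>(I \<inter> S) + \<Sum>?J" using I(2) by (metis sum.Int_Diff)
    then have "\<Sum>?J = \<Sum>I - \<Sum>(I \<inter> S)" by simp
    also have "\<dots> \<in> span S"
      by (rule span_diff[OF span_base[OF I(5)] span_sum]) (auto intro: span_base)
    finally have "\<Sum>?J \<in> span S" .
    moreover have "\<Sum>?J \<in> span T" by (intro span_sum) (use I(1) in \<open>auto intro: span_base\<close>)
    ultimately have sumJ: "\<Sum>?J \<in> S" "\<Sum>?J \<in> T" using ST by blast+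
    have "?J \<noteq> {}" using False by blast
    then have "card ?J \<noteq> 0" by (simp only: card_0_eq[OF fin] not_False_eq_True)
    moreover have "card ?J \<noteq> 1"
    proof
      assume "card ?J = 1"
      then obtain x where x: "?J = {x}" by (rule card_1_singletonE)
      then have "x \<in> S" using sumJ(1) by simp
      then show False using x by blast
    qed
    ultimately have "2 \<le> card ?J" by linarith
    moreover have "independent ?J" using I(3) independent_mono by blast
    moreover have "?J \<subseteq> T" using I(1) by blast
    ultimately have "chorded T ?J" using has_chordsD[OF hT] fin sumJ by blast
    then show ?thesis using chorded_mono[of T ?J "S \<union> T" I] by auto
  qed
qed

lemma decomposable_has_chords: "decomposable S \<Longrightarrow> has_chords S"
proof (induction rule: decomposable.induct)
  case (full S)
  have "chorded S I" if "I \<subseteq> S" "2 \<le> card I" for I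
  proof -
    obtain x y where "x \<in> I" "y \<in> I" "x \<noteq> y"
      using obtain_subset_with_card_n[OF \<open>2 \<le> card I\<close>] card_2_iff by (metis insert_subset)
    then show ?thesis using full that adj_subspace unfolding chorded_def by blast
  qed
  then show ?case by (simp add: has_chords_def)
next
  case (union S T)
  show ?case unfolding has_chords_def
  proof (intro allI impI)
    fix I assume I: "I \<subseteq> S \<union> T" "finite I" "independent I" "2 \<le> card I" "\<Sum>I \<in> S \<union> T"
    then show "chorded (S \<union> T) I"
      using union_has_chords_aux[of S T I] union_has_chords_aux[of T S I] union
      by (auto simp: Un_commute Int_commute)
  qed
qed

lemma decomposable_Int_subspace: "decomposable S \<Longrightarrow> subspace W \<Longrightarrow> decomposable (S \<inter> W)"
proof (induction rule: decomposable.induct)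
  case (full S)
  then show ?case by (simp add: decomposable.full subspace_inter)
next
  case (union S T)
  have W: "span (A \<inter> W) \<subseteq> span A \<inter> W" for A
    using union.prems by (metis Int_lower1 Int_lower2 le_inf_iff span_minimal span_mono)
  have "span (S \<inter> W) \<inter> span (T \<inter> W) \<subseteq> (S \<inter> W) \<inter> (T \<inter> W)"
    using W[of S] W[of T] union.hyps by blast
  then show ?case using decomposable.union union by (simp add: Int_Un_distrib2)
qed

text \<open>The assumption on the kernel says that only points of \<open>S\<close> are contracted.
  Both parts of a gluing inherit it because the kernel splits along them, and the same splitting
  corrects two preimages of a common vector to a single one.\<close>

lemma decomposable_linear_image:
  assumes "Vector_Spaces.linear scale scale f"
  shows "decomposable S \<Longrightarrow> {v. f v = 0} \<inter> span S \<subseteq> span ({v. f v = 0} \<inter> S) \<Longrightarrow> decomposable (f ` S)"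
proof (induction rule: decomposable.induct)
  case (full S)
  then show ?case by (simp add: decomposable.full endo.linear_subspace_image[OF assms])
next
  case (union S T)
  let ?K = "{v. f v = 0}"
  have K: "subspace ?K" using endo.linear_subspace_kernel[OF assms] .
  have spanK: "span (?K \<inter> A) \<subseteq> ?K" "span (?K \<inter> A) \<subseteq> span A" for A
    by (rule span_minimal[OF Int_lower1 K], rule span_mono[OF Int_lower2])
  have split: "\<exists>a\<in>span (?K \<inter> S). \<exists>b\<in>span (?K \<inter> T). v = a + b" if "f v = 0" "v \<in> span (S \<union> T)" for v
  proof -
    have "v \<in> span ((?K \<inter> S) \<union> (?K \<inter> T))" using union.prems that by (auto simp: Int_Un_distrib)
    then show ?thesis unfolding span_Un by blast
  qed
  have kS: "?K \<inter> span S \<subseteq> span (?K \<inter> S)"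
  proof
    fix v assume v: "v \<in> ?K \<inter> span S"
    then obtain a b where ab: "a \<in> span (?K \<inter> S)" "b \<in> span (?K \<inter> T)" "v = a + b"
      using split[of v] span_mono[of S "S \<union> T"] by blast
    have "b = v - a" using ab by simp
    then have "b \<in> span S" using v ab(1) spanK(2)[of S] by (auto intro: span_diff)
    \<comment> \<open>\<open>b\<close> lies in both spans and hence in the common subspace, so it is
      a kernel vector belonging to \<open>S\<close> itself.\<close>
    then have "b \<in> ?K \<inter> S" using ab(2) spanK[of T] union.hyps by blast
    then show "v \<in> span (?K \<inter> S)" using ab span_add span_base by metis
  qed
  have kT: "?K \<inter> span T \<subseteq> span (?K \<inter> T)"
  proof
    fix v assume v: "v \<in> ?K \<inter> span T"
    then obtain a b where ab: "a \<in> span (?K \<inter> S)" "b \<in> span (?K \<inter> T)" "v = a + b"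
      using split[of v] span_mono[of T "S \<union> T"] by blast
    have "a = v - b" using ab by simp
    then have "a \<in> span T" using v ab(2) spanK(2)[of T] by (auto intro: span_diff)
    then have "a \<in> ?K \<inter> T" using ab(1) spanK[of S] union.hyps by blast
    then show "v \<in> span (?K \<inter> T)" using ab span_add span_base by metis
  qed
  have "span (f ` S) \<inter> span (f ` T) \<subseteq> f ` S \<inter> f ` T"
  proof
    fix w assume "w \<in> span (f ` S) \<inter> span (f ` T)"
    then obtain u v where uv: "u \<in> span S" "w = f u" "v \<in> span T" "w = f v"
      by (auto simp: endo.linear_span_image[OF assms])
    have "f (u - v) = 0" using uv by (simp add: endo.linear_diff[OF assms])
    moreover have "u - v \<in> span (S \<union> T)"
      using uv span_mono[of S "S \<union> T"] span_mono[of T "S \<union> T"] by (auto intro!: span_diff)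
    ultimately obtain a b where ab: "a \<in> span (?K \<inter> S)" "b \<in> span (?K \<inter> T)" "u - v = a + b"
      using split by blast
    \<comment> \<open>The corrected preimage: \<open>u - a\<close> stays in the span of
      \<open>S\<close>, and \<open>v + b\<close> in that of \<open>T\<close>.\<close>
    have eq: "u - a = v + b" using ab(3) by (simp add: algebra_simps)
    have "u - a \<in> span S" using uv ab(1) spanK(2)[of S] by (auto intro: span_diff)
    moreover have "u - a \<in> span T" using eq uv ab(2) spanK(2)[of T] by (auto intro: span_add)
    ultimately have "u - a \<in> S \<inter> T" using union.hyps by blast
    moreover have "f (u - a) = w"
      using uv ab(1) spanK(1)[of S] by (auto simp: endo.linear_diff[OF assms])
    ultimately show "w \<in> f ` S \<inter> f ` T" by blast
  qed
  then show ?case using decomposable.union union.IH kS kT by (simp add: image_Un)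
qed

section \<open>Chords under contraction of a point\<close>

lemma independent_inj_image_imp:
  assumes f: "Vector_Spaces.linear scale scale f" and "finite J" "inj_on f J" "independent (f ` J)"
  shows "independent J"
proof (rule independent_if_scalars_zero[OF assms(2)])
  fix u x assume s: "(\<Sum>x\<in>J. u x *s x) = 0" and x: "x \<in> J"
  have "f (\<Sum>x\<in>J. u x *s x) = (\<Sum>x\<in>J. u x *s f x)"
    by (simp add: endo.linear_sum[OF f] endo.linear_scale[OF f])
  also have "\<dots> = (\<Sum>y\<in>f ` J. u (the_inv_into J f y) *s y)"
    by (simp add: sum.reindex[OF assms(3)] the_inv_into_f_f[OF assms(3)])
  finally have "(\<Sum>y\<in>f ` J. u (the_inv_into J f y) *s y) = 0"
    using s endo.linear_0[OF f] by simp
  from independentD[OF assms(4) finite_imageI[OF assms(2)] subset_refl this, of "f x"]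
  show "u x = 0" using x the_inv_into_f_f[OF assms(3)] by simp
qed

text \<open>A circuit of the contraction lifts to \<open>J\<close> with sum \<open>z - q\<close>,
  where \<open>q\<close> is a multiple of \<open>p\<close>. If \<open>q\<close> is nonzero, adding
  it to \<open>J\<close> gives a circuit of \<open>S\<close>, and a chord of this circuit either
  lies in \<open>J\<close> or joins \<open>q\<close> to some \<open>x\<close>.\<close>

lemma has_chords_contract:
  assumes f: "Vector_Spaces.linear scale scale f" and S: "conic S" "has_chords S" and p: "p \<in> S"
    and ker: "\<And>v. f v = 0 \<longleftrightarrow> v \<in> span {p}"
  shows "has_chords (f ` S)"
  unfolding has_chords_def
proof (intro allI impI)
  fix I assume I: "I \<subseteq> f ` S" "finite I" "independent I" "2 \<le> card I" "\<Sum>I \<in> f ` S"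
  obtain z where z: "z \<in> S" "\<Sum>I = f z" using I(5) by blast
  obtain J where J: "J \<subseteq> S" "inj_on f J" "I = f ` J" using I(1) by (metis subset_image_inj)
  have finJ: "finite J" using I(2) J finite_image_iff by blast
  have indJ: "independent J" using independent_inj_image_imp[OF f finJ J(2)] I(3) J(3) by simp
  have cardJ: "2 \<le> card J" using I(4) J by (simp add: card_image)
  define q where "q = z - \<Sum>J"
  have "f (\<Sum>J) = \<Sum>I" using J by (simp add: endo.linear_sum[OF f] sum.reindex)
  then have fq: "f q = 0" using z by (simp add: q_def endo.linear_diff[OF f])
  then have "q \<in> span {p}" using ker by blast
  then have qS: "q \<in> S" using p S by (auto simp: span_singleton conic_scale)
  show "chorded (f ` S) I"
  proof (cases "q = 0")
    case True
    then have "\<Sum>J \<in> S" using z by (simp add: q_def)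
    then have "chorded S J" using has_chordsD[OF S(2)] J finJ indJ cardJ by blast
    then show ?thesis using chorded_image[OF f J(2)] J(3) by blast
  next
    case False
    have "inj_on f (span J)"
      using endo.linear_inj_on_span_iff_independent_image[OF f] I(3) J by blast
    then have q: "q \<notin> span J"
      using fq False endo.linear_0[OF f] span_zero by (metis inj_onD)
    then have "q \<notin> J" using span_base by blast
    then have sum: "\<Sum>(insert q J) = z" using finJ by (simp add: q_def)
    have "chorded S (insert q J)"
      by (rule has_chordsD[OF S(2)])
        (use J finJ indJ cardJ q qS sum z \<open>q \<notin> J\<close> in \<open>auto simp: independent_insert\<close>)
    then consider "chorded S J" | x where "x \<in> J" "adj S x q"
      unfolding chorded_def using adj_sym by blast
    then show ?thesis
    proof cases
      case 1
      then show ?thesis using chorded_image[OF f J(2)] J(3) by blast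
    next
      case (2 x)
      \<comment> \<open>Replacing \<open>x\<close> by \<open>x + q\<close> keeps its image and stays
        in \<open>S\<close>, and the sum becomes exactly \<open>z\<close>.\<close>
      let ?x = "x + q" and ?J = "insert (x + q) (J - {x})"
      have fx: "f ?x = f x" using fq by (simp add: endo.linear_add[OF f])
      have nx: "?x \<notin> J - {x}" using fx J(2) 2(1) by (metis DiffD1 DiffD2 inj_onD singletonI)
      have fJ: "f ` ?J = I" using fx J(3) 2(1) by (simp add: insert_absorb flip: image_insert)
          (metis image_insert insert_Diff)
      have injJ: "inj_on f ?J"
      proof -
        have "f x \<notin> f ` (J - {x})" using J(2) 2(1) by (auto dest: inj_onD)
        then show ?thesis using J(2) fx by (auto intro: inj_on_diff)
      qed
      have "\<Sum>?J = ?x + \<Sum>(J - {x})" using nx finJ by simp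
      also have "\<dots> = z" using 2(1) finJ by (simp add: sum_diff1 q_def)
      finally have "\<Sum>?J \<in> S" using z by simp
      moreover have "?J \<subseteq> S" using J(1) adj_add[OF 2(2)] by blast
      moreover have "independent ?J"
        using independent_inj_image_imp[OF f _ injJ] finJ fJ I(3) by simp
      moreover have "card ?J = card I" using card_image[OF injJ] fJ by simp
      ultimately have "chorded S ?J" using has_chordsD[OF S(2)] finJ I(4) by simp
      then show ?thesis using chorded_image[OF f injJ] fJ by metis
    qed
  qed
qed

lemma conic_image: "Vector_Spaces.linear scale scale f \<Longrightarrow> conic S \<Longrightarrow> conic (f ` S)"
  unfolding conic_def by (force simp: endo.linear_0 endo.linear_scale[symmetric])

text \<open>Kill a basis of \<open>U\<close> and fix the other vectors of an extended basis.
  Contractions thus stay in the same vector space, which permits induction over repeated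
  contractions.\<close>

lemma ex_linear_kernel:
  assumes "subspace U"
  obtains f where "Vector_Spaces.linear scale scale f" "\<And>v. f v = 0 \<longleftrightarrow> v \<in> U"
proof -
  obtain B where B: "B \<subseteq> U" "independent B" "U \<subseteq> span B"
    using maximal_independent_subset by blast
  then have U: "span B = U" using assms by (simp add: span_subspace)
  let ?C = "extend_basis B"
  define f where "f = endo.construct ?C (\<lambda>b. if b \<in> B then 0 else b)"
  have C: "independent ?C" "span ?C = UNIV" "B \<subseteq> ?C"
    using independent_extend_basis span_extend_basis extend_basis_superset B(2) by blast+
  have f: "Vector_Spaces.linear scale scale f"
    unfolding f_def using C(1) by (rule endo.linear_construct)
  have fb: "f b = (if b \<in> B then 0 else b)" if "b \<in> ?C" for b
    unfolding f_def using endo.construct_basis[OF C(1) that] .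
  have zero: "f v = 0" if "v \<in> U" for v
  proof (rule endo.linear_eq_0_on_span[OF f])
    show "v \<in> span B" using that U by simp
    show "f b = 0" if "b \<in> B" for b using that fb C(3) by auto
  qed
  have "v - f v \<in> U" for v
  proof -
    have "v \<in> span ?C" using C by simp
    then show ?thesis
    proof (induction rule: span_induct_alt)
      case base
      then show ?case using assms endo.linear_0[OF f] by (simp add: subspace_0)
    next
      case (step c x y)
      have "x - f x \<in> U" using fb[OF step(1)] B(1) assms by (auto simp: subspace_0)
      then have "c *s (x - f x) + (y - f y) \<in> U" using step assms by (simp add: subspace_add subspace_scale)
      then show ?case by (simp add: endo.linear_add[OF f] endo.linear_scale[OF f] algebra_simps)
    qed
  qed
  then have "v \<in> U" if "f v = 0" for v using that by (metis diff_zero)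
  then show thesis using that f zero by blast
qed

lemma ex_third_scalar:
  assumes "2 < CARD('f)"
  obtains r :: 'f where "r \<noteq> 0" "r \<noteq> 1"
proof -
  have "card {0, 1::'f} < CARD('f)" using assms by simp
  then have "\<not> UNIV \<subseteq> {0, 1::'f}" by (metis card_mono finite.emptyI finite.insertI leD)
  then show thesis using that by auto
qed

text \<open>Here \<open>q > 2\<close> is used: a point of the plane on neither of the two full lines through \<open>y\<close> lies on a
  line meeting the three full lines in three distinct points.\<close>

lemma adj_plane:
  assumes q: "2 < CARD('f)" and S: "conic S" "has_chords S"
    and yu: "adj S y u" and yv: "adj S y v" and uv: "adj S u v"
  shows "adj S y (a *s u + b *s v)"
proof -
  obtain r :: 'f where r: "r \<noteq> 0" "1 - r \<noteq> 0" using ex_third_scalar[OF q] by (metis right_minus_eq)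
  have *: "p *s y + (a *s u + b *s v) \<in> S" for p a b
  proof -
    \<comment> \<open>\<open>?P\<close> and \<open>?Q\<close> lie on the full lines
      \<open>yu\<close> and \<open>yv\<close> and add up to the wanted vector. The scalars
      \<open>1 - r\<close> and \<open>- r\<close> cancel \<open>y\<close>, which gives a third point
      of their line, on \<open>uv\<close>.\<close>
    let ?P = "(r * p) *s y + a *s u" and ?Q = "((1 - r) * p) *s y + b *s v"
    have "(1 - r) *s ?P + (- r) *s ?Q = ((1 - r) * a) *s u + (- r * b) *s v"
      by (simp add: algebra_simps)
    also have "\<dots> \<in> S" using uv by (rule adjD)
    finally have "adj S ?P ?Q"
      by (intro has_chords_adj[OF S, of _ _ "1 - r" "- r"]) (use yu yv r adjD in auto)
    then have "?P + ?Q \<in> S" by (rule adj_add)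
    then show ?thesis by (simp add: algebra_simps)
  qed
  show ?thesis unfolding adj_def
  proof (intro allI)
    fix p c
    show "p *s y + c *s (a *s u + b *s v) \<in> S"
      using *[of p "c * a" "c * b"] by (simp add: algebra_simps)
  qed
qed

section \<open>Induced cycles of full lines\<close>

lemma has_chords_Int_subspace:
  assumes "has_chords S" "subspace W"
  shows "has_chords (S \<inter> W)"
  unfolding has_chords_def
proof (intro allI impI)
  fix I assume I: "I \<subseteq> S \<inter> W" "finite I" "independent I" "2 \<le> card I" "\<Sum>I \<in> S \<inter> W"
  then obtain x y where xy: "x \<in> I" "y \<in> I" "x \<noteq> y" "adj S x y"
    using has_chordsD[OF assms(1), of I] unfolding chorded_def by auto
  have "adj W x y" using adj_subspace[OF assms(2) subset_refl] xy I(1) by blast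
  then have "adj (S \<inter> W) x y" using xy(4) by (simp add: adj_def)
  then show "chorded (S \<inter> W) I" using xy unfolding chorded_def by blast
qed

lemma has_chords_triple:
  assumes S: "has_chords S" and xyz: "x \<in> S" "y \<in> S" "z \<in> S" "x + y + z \<in> S"
    and ind: "x \<noteq> 0" "y \<notin> span {x}" "z \<notin> span {x, y}"
  shows "adj S x y \<or> adj S x z \<or> adj S y z"
proof -
  have ne: "y \<noteq> x" "z \<noteq> x" "z \<noteq> y" using ind(2,3) span_base by auto
  have "independent {y, x}" using ind ne by (simp add: independent_insert)
  then have "independent {x, y}" by (subst insert_commute)
  then have "independent {z, x, y}" using ind(3) by (rule independent_insertI[rotated])
  then have "chorded S {x, y, z}"
    by (intro has_chordsD[OF S]) (use xyz ne in \<open>auto simp: insert_commute add.assoc\<close>)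
  then show ?thesis unfolding chorded_def using adj_sym by auto
qed

lemma adj_plane_eq:
  assumes "2 < CARD('f)" "conic S" "has_chords S" "adj S y u" "adj S y v" "adj S u v"
    and "w = a *s u + b *s v"
  shows "adj S y w"
  using adj_plane[OF assms(1-6)] assms(7) by simp

text \<open>If \<open>d\<close> were a combination of \<open>a\<close>, \<open>b\<close>,
  \<open>c\<close>, the lines \<open>da\<close> and \<open>bc\<close> would meet in a point
  \<open>w\<close>. Then \<open>a\<close>, \<open>b\<close>, \<open>w\<close> are pairwise adjacent,
  so \<open>a\<close> is adjacent to every point of the line \<open>bw\<close>, including
  \<open>c\<close> unless \<open>d\<close> lies on the line \<open>ab\<close>.\<close>

lemma four_cycle_span:
  assumes q: "2 < CARD('f)" and S: "conic S" "has_chords S"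
    and cyc: "adj S a b" "adj S b c" "adj S c d" "adj S d a" "\<not> adj S a c" "\<not> adj S b d"
  shows "d \<notin> span {a, b, c}"
proof
  assume "d \<in> span {a, b, c}"
  then obtain x y z where d: "d = x *s a + y *s b + z *s c"
    by (auto simp: span_breakdown_eq algebra_simps)
  define w where "w = y *s b + z *s c"
  have w: "w = 1 *s d + (- x) *s a" by (simp add: w_def d)
  show False
  proof (cases "z = 0")
    case True
    have "adj S (0 *s a + 1 *s b) (x *s a + y *s b)" using adj_comb[OF cyc(1)] .
    then show False using cyc(6) True d by simp
  next
    case False
    have "adj S (0 *s d + 1 *s a) w" unfolding w by (rule adj_comb[OF cyc(4)])
    then have aw: "adj S a w" by simp
    have "adj S (1 *s b + 0 *s c) w" unfolding w_def by (rule adj_comb[OF cyc(2)])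
    then have bw: "adj S b w" by simp
    have "c = (- (y / z)) *s b + (1 / z) *s w"
      using False by (simp add: w_def algebra_simps)
    then show False using adj_plane_eq[OF q S cyc(1) aw bw] cyc(5) by blast
  qed
qed

text \<open>One point on each side of the cycle is chosen so that the four form a circuit. Its chord
  avoiding the point on \<open>ab\<close> must join \<open>P2\<close> and \<open>P4\<close>, since
  \<open>P3 P2\<close> would make \<open>b\<close> and \<open>d\<close> adjacent, and
  \<open>P3 P4\<close> would do so for \<open>a\<close> and \<open>c\<close>. Letting
  \<open>P2\<close> vary over the line \<open>bc\<close> shows that \<open>P4\<close> is adjacent to
  \<open>b\<close>.\<close>

lemma no_induced_four_cycle:
  assumes q: "2 < CARD('f)" and S: "conic S" "has_chords S"
    and cyc: "adj S a b" "adj S b c" "adj S c d" "adj S d a" "\<not> adj S a c" "\<not> adj S b d"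
  shows False
proof -
  have sym: "adj S x y \<longleftrightarrow> adj S y x" for x y using adj_sym by blast
  have nd: "d \<notin> span {a, b, c}" using four_cycle_span[OF q S cyc] .
  have na: "a \<notin> span {b, c, d}"
    by (rule four_cycle_span[OF q S]) (use cyc sym in auto)
  have nb: "b \<notin> span {c, d, a}"
    by (rule four_cycle_span[OF q S]) (use cyc sym in auto)
  define P4 where "P4 = - (d + a)"
  have P4: "P4 = (- 1) *s d + (- 1) *s a" by (simp add: P4_def algebra_simps)
  have da4: "adj S d P4" "adj S a P4"
    using adj_comb[OF cyc(4), of 1 0 "-1" "-1"] adj_comb[OF cyc(4), of 0 1 "-1" "-1"]
    by (simp_all add: P4)
  have 24: "adj S P4 (b + r *s c)" if r: "r \<noteq> 0" for r
  proof -
    \<comment> \<open>The points cancel along the cycle: \<open>P3 + P2 + P4 = b - a\<close>, a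
      vector on the line \<open>ab\<close>.\<close>
    define P2 P3 where "P2 = b + r *s c" and "P3 = d - r *s c"
    have P2: "P2 = 1 *s b + r *s c" and P3: "P3 = (- r) *s c + 1 *s d"
      by (simp_all add: P2_def P3_def)
    have bc2: "adj S b P2" "adj S c P2"
      using adj_comb[OF cyc(2), of 1 0 1 r] adj_comb[OF cyc(2), of 0 1 1 r] by (simp_all add: P2)
    have cd3: "adj S c P3" "adj S d P3"
      using adj_comb[OF cyc(3), of 1 0 "-r" 1] adj_comb[OF cyc(3), of 0 1 "-r" 1] by (simp_all add: P3)
    have "adj S P3 P2 \<or> adj S P3 P4 \<or> adj S P2 P4"
    proof (rule has_chords_triple[OF S(2)])
      show "P3 \<in> S" "P2 \<in> S" "P4 \<in> S" using cd3 bc2 da4 adj_right by blast+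
      have "P3 + P2 + P4 = 1 *s b + (-1) *s a" by (simp add: P2_def P3_def P4_def)
      then show "P3 + P2 + P4 \<in> S" using adjD[OF cyc(1), of "-1" 1] by (simp add: add.commute)
      show "P3 \<noteq> 0"
      proof
        assume "P3 = 0"
        then have "d = r *s c" by (simp add: P3_def)
        also have "\<dots> \<in> span {a, b, c}" by (intro span_scale span_base) simp
        finally show False using nd by blast
      qed
      show "P2 \<notin> span {P3}"
      proof
        assume "P2 \<in> span {P3}"
        then obtain k where "P2 = k *s P3" by (auto simp: span_singleton)
        then have "b = k *s (d - r *s c) - r *s c" by (simp add: P2_def P3_def algebra_simps)
        also have "\<dots> \<in> span {c, d, a}" by (intro span_scale span_diff span_base) auto
        finally show False using nb by blast
      qed
      show "P4 \<notin> span {P3, P2}"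
      proof
        assume "P4 \<in> span {P3, P2}"
        then obtain k l where "P4 = k *s P3 + l *s P2" by (auto simp: span_breakdown_eq algebra_simps)
        then have "a = - (k *s (d - r *s c) + l *s (b + r *s c)) - d"
          by (simp add: P2_def P3_def P4_def algebra_simps)
        also have "\<dots> \<in> span {b, c, d}"
          by (intro span_scale span_diff span_add span_neg span_base) auto
        finally show False using na by blast
      qed
    qed
    moreover have False if "adj S P3 P2"
    proof -
      have "adj S P3 b"
        by (rule adj_plane_eq[OF q S that adj_sym[OF cd3(1)] adj_sym[OF bc2(2)], where a=1 and b="-r"])
          (simp add: P2_def)
      then have "adj S b d"
        by (rule adj_plane_eq[OF q S adj_sym cyc(2) adj_sym[OF cd3(1)], where a=1 and b=r])
          (simp_all add: P3_def)
      then show False using cyc by blast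
    qed
    moreover have False if "adj S P3 P4"
    proof -
      have "adj S P3 a"
        by (rule adj_plane_eq[OF q S that adj_sym[OF cd3(2)] adj_sym[OF da4(1)], where a="-1" and b="-1"])
          (simp add: P4_def)
      then have "adj S a c"
        by (rule adj_plane_eq[OF q S adj_sym adj_sym[OF cyc(4)] adj_sym[OF cd3(2)], where a="- inverse r" and b="inverse r"])
          (use r in \<open>simp_all add: P3_def algebra_simps\<close>)
      then show False using cyc by blast
    qed
    ultimately show ?thesis using adj_sym P2_def by blast
  qed
  obtain k :: 'f where k: "k \<noteq> 0" "k \<noteq> 1" using ex_third_scalar[OF q] .
  have "adj S (1 *s b + 1 *s c) (1 *s b + k *s c)" by (rule adj_comb[OF cyc(2)])
  then have "adj S (b + 1 *s c) (b + k *s c)" by simp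
  \<comment> \<open>These coefficients express \<open>b\<close> through \<open>b + c\<close> and
    \<open>b + k *s c\<close>.\<close>
  from adj_plane[OF q S 24[OF one_neq_zero] 24[OF k(1)] this, of "- k / (1 - k)" "1 / (1 - k)"]
  have "adj S P4 ((- k / (1 - k)) *s (b + 1 *s c) + (1 / (1 - k)) *s (b + k *s c))" .
  also have "(- k / (1 - k)) *s (b + 1 *s c) + (1 / (1 - k)) *s (b + k *s c)
     = ((- k / (1 - k)) + 1 / (1 - k)) *s b + ((- k / (1 - k)) + k / (1 - k)) *s c"
    by (simp add: scale_left_distrib scale_left_diff_distrib scale_right_distrib)
  also have "- k / (1 - k) + 1 / (1 - k) = 1" using k by (simp flip: diff_divide_distrib)
  also have "- k / (1 - k) + k / (1 - k) = 0" by simp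
  also have "1 *s b + 0 *s c = b" by simp
  finally have "adj S b P4" by (rule adj_sym)
  then have "adj S b d"
    by (rule adj_plane_eq[OF q S _ adj_sym[OF cyc(1)] adj_sym[OF da4(2)], where a="-1" and b="-1"])
      (simp_all add: P4_def)
  then show False using cyc by blast
qed

text \<open>Adjacency in the contraction yields \<open>x + y + t *s p \<in> S\<close> for some
  \<open>t\<close>. In this relation between \<open>x\<close>, \<open>y\<close> and
  \<open>p\<close>, the only chord compatible with the assumptions joins \<open>x\<close> and
  \<open>y\<close>.\<close>

lemma adj_contract_lift:
  assumes f: "Vector_Spaces.linear scale scale f" and S: "conic S" "has_chords S" and p: "p \<in> S"
    and ker: "\<And>v. f v = 0 \<longleftrightarrow> v \<in> span {p}"
    and xy: "x \<in> S" "y \<in> S" "\<not> adj S p x" "\<not> adj S p y" and adj: "adj (f ` S) (f x) (f y)"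
  shows "adj S x y"
proof -
  obtain z where z: "z \<in> S" "f x + f y = f z" using adj_add[OF adj] by auto
  then have "f (z - (x + y)) = 0" by (simp add: endo.linear_diff[OF f] endo.linear_add[OF f])
  then obtain t where "z - (x + y) = t *s p" using ker by (auto simp: span_singleton)
  then have zt: "z = x + y + t *s p" by (simp add: algebra_simps)
  have x0: "x \<noteq> 0" using adj_multiple[OF S(1) p, of 0] xy by auto
  have tpS: "t *s p \<in> S" using S p by (simp add: conic_scale)
  consider "t = 0" | "t \<noteq> 0" "y \<in> span {x}" | "t \<noteq> 0" "t *s p \<in> span {x, y}"
    | "t \<noteq> 0" "y \<notin> span {x}" "t *s p \<notin> span {x, y}" by blast
  then show ?thesis
  proof cases
    case 1
    then show ?thesis using has_chords_adj[OF S xy(1,2), of 1 1] zt z by simp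
  next
    case 2
    then show ?thesis using adj_multiple[OF S(1) xy(1)] by (auto simp: span_singleton)
  next
    case 3
    then obtain a b where ab: "t *s p = a *s x + b *s y"
      by (auto simp: span_breakdown_eq algebra_simps)
    have p_eq: "p = inverse t *s (a *s x + b *s y)" using 3(1) ab[symmetric] by simp
    have "a \<noteq> 0"
    proof
      assume "a = 0"
      then have "p = (inverse t * b) *s y" using p_eq by simp
      then show False using adj_sym[OF adj_multiple[OF S(1) xy(2)]] xy(4) by metis
    qed
    moreover have "b \<noteq> 0"
    proof
      assume "b = 0"
      then have "p = (inverse t * a) *s x" using p_eq by simp
      then show False using adj_sym[OF adj_multiple[OF S(1) xy(1)]] xy(3) by metis
    qed
    ultimately show ?thesis using has_chords_adj[OF S xy(1,2)] ab tpS by simp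
  next
    case 4
    then have "adj S x y \<or> adj S x (t *s p) \<or> adj S y (t *s p)"
      using has_chords_triple[OF S(2) xy(1,2) tpS] zt z(1) x0 by simp
    then show ?thesis
      using xy(3,4) adj_scale_iff[of 1 t S] 4(1) adj_sym by (metis one_neq_zero scale_one)
  qed
qed

text \<open>Contracting a point of the line \<open>c 0, c 1\<close> shortens an induced cycle and keeps it induced.\<close>

lemma no_induced_cycle:
  assumes q: "2 < CARD('f)"
  shows "\<lbrakk>conic S; has_chords S; 2 \<le> n;
    \<And>i j. i < j \<Longrightarrow> j \<le> n \<Longrightarrow> adj S (c i) (c j) \<longleftrightarrow> j = Suc i;
    adj S y (c 0); adj S y (c n); \<And>i. 0 < i \<Longrightarrow> i < n \<Longrightarrow> \<not> adj S y (c i)\<rbrakk> \<Longrightarrow> False"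
proof (induction n arbitrary: S c y rule: less_induct)
  case (less n)
  note S = less.prems(1,2) and path = less.prems(4) and y = less.prems(5-7)
  show False
  proof (cases "n = 2")
    case True
    show False
    proof (rule no_induced_four_cycle[OF q S])
      show "adj S (c 0) (c 1)" "adj S (c 1) (c 2)" "\<not> adj S (c 0) (c 2)"
        using path[of 0 1] path[of 1 2] path[of 0 2] True by auto
      show "adj S (c 2) y" "adj S y (c 0)" "\<not> adj S (c 1) y"
        using y(1,2) y(3)[of 1] True adj_sym by auto
    qed
  next
    case False
    then have n: "3 \<le> n" using less.prems(3) by linarith
    have c01: "adj S (c 0) (c 1)" using path[of 0 1] n by simp
    have p0: "adj S (c 0) (c 0 + s *s c 1)" and p1: "adj S (c 1) (c 0 + s *s c 1)" for s
      using adj_comb[OF c01, of 1 0 1 s] adj_comb[OF c01, of 0 1 1 s] by simp_all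
    \<comment> \<open>No third point of the line \<open>c 0\<close>, \<open>c 1\<close> has a
      neighbour among the later vertices: at the first such neighbour \<open>c k\<close>, either
      \<open>c 2\<close> would be adjacent to \<open>c 0\<close>, or
      \<open>?p, c 1, ..., c k\<close> would be a shorter induced cycle.\<close>
    have pc: "\<not> adj S (c 0 + s *s c 1) (c j)" if s: "s \<noteq> 0" and j: "2 \<le> j" "j \<le> n" for s j
    proof
      let ?p = "c 0 + s *s c 1"
      let ?P = "\<lambda>j. 2 \<le> j \<and> j \<le> n \<and> adj S ?p (c j)"
      assume "adj S ?p (c j)"
      then have "?P j" using j by simp
      define k where "k = (LEAST j. ?P j)"
      have k: "2 \<le> k" "k \<le> n" "adj S ?p (c k)"
        using LeastI[of ?P, OF \<open>?P j\<close>] unfolding k_def by blast+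
      have least: "\<not> adj S ?p (c i)" if "2 \<le> i" "i < k" for i
        using not_less_Least[of i ?P] that k unfolding k_def by auto
      show False
      proof (cases "k = 2")
        case True
        have "adj S (c 2) (c 0)"
        proof (rule adj_plane_eq[OF q S])
          show "adj S (c 2) (c 1)" using path[of 1 2] n adj_sym by simp
          show "adj S (c 2) ?p" using k True adj_sym by blast
          show "adj S (c 1) ?p" by (rule p1)
          show "c 0 = (- s) *s c 1 + 1 *s ?p" by simp
        qed
        then show False using path[of 0 2] n adj_sym by auto
      next
        case False
        show False
        proof (rule less.IH[of "k - 1" S "\<lambda>i. c (Suc i)" ?p])
          show "k - 1 < n" "2 \<le> k - 1" using k False by auto
          show "adj S (c (Suc i)) (c (Suc j)) \<longleftrightarrow> j = Suc i" if "i < j" "j \<le> k - 1" for i j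
            using path[of "Suc i" "Suc j"] that k by simp
          show "adj S ?p (c (Suc 0))" using p1 adj_sym by simp
          show "adj S ?p (c (Suc (k - 1)))" using k by simp
          show "\<not> adj S ?p (c (Suc i))" if "0 < i" "i < k - 1" for i
            using least[of "Suc i"] that by simp
        qed (use S in auto)
      qed
    qed
    let ?p = "c 0 + 1 *s c 1"
    have py: "\<not> adj S ?p y"
    proof
      assume "adj S ?p y"
      then have "adj S y (c 1)"
        by (rule adj_plane_eq[OF q S y(1) adj_sym[of S ?p y] p0, where a="-1" and b=1]) simp_all
      then show False using y(3)[of 1] n by simp
    qed
    have pS: "?p \<in> S" using adj_right[OF p0] .
    have cS: "c i \<in> S" if "i \<le> n" for i
    proof (cases "i = 0")
      case True
      then show ?thesis using adj_left[OF c01] by simp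
    next
      case False
      then show ?thesis using path[of "i - 1" i] that adj_right by simp
    qed
    have yS: "y \<in> S" using adj_left[OF y(1)] .
    obtain f where f: "Vector_Spaces.linear scale scale f" and ker: "\<And>v. f v = 0 \<longleftrightarrow> v \<in> span {?p}"
      using ex_linear_kernel[OF subspace_span[of "{?p}"]] by blast
    note lift = adj_contract_lift[OF f S pS ker]
    show False
    proof (rule less.IH[of "n - 1" "f ` S" "\<lambda>i. f (c (Suc i))" "f y"])
      show "n - 1 < n" "2 \<le> n - 1" using n by auto
      show "conic (f ` S)" using conic_image[OF f S(1)] .
      show "has_chords (f ` S)" by (rule has_chords_contract[OF f S pS ker])
      have "f ?p = 0" using ker span_base by blast
      then have "f (c 0) + f (c 1) = 0" by (simp add: endo.linear_add[OF f])
      \<comment> \<open>The contraction identifies \<open>c 0\<close> and \<open>c 1\<close> up to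
        sign, so \<open>f y\<close> is joined to the image of \<open>c 1\<close> and the cycle loses
        one vertex.\<close>
      then have f1: "f (c 1) = (- 1) *s f (c 0)" by (simp add: eq_neg_iff_add_eq_0 add.commute)
      show "adj (f ` S) (f y) (f (c (Suc 0)))"
        using adj_scale[OF adj_image[OF f y(1)], of 1 "-1"] f1 by simp
      show "adj (f ` S) (f y) (f (c (Suc (n - 1))))" using adj_image[OF f y(2)] n by simp
      show "\<not> adj (f ` S) (f y) (f (c (Suc i)))" if i: "0 < i" "i < n - 1" for i
      proof
        assume "adj (f ` S) (f y) (f (c (Suc i)))"
        then have "adj S y (c (Suc i))"
          using lift[OF yS cS py pc] i by simp
        then show False using y(3)[of "Suc i"] i by simp
      qed
      show "adj (f ` S) (f (c (Suc i))) (f (c (Suc j))) \<longleftrightarrow> j = Suc i" if ij: "i < j" "j \<le> n - 1" for i j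
      proof
        assume "j = Suc i"
        then show "adj (f ` S) (f (c (Suc i))) (f (c (Suc j)))"
          using adj_image[OF f] path[of "Suc i" "Suc j"] ij n by simp
      next
        assume A: "adj (f ` S) (f (c (Suc i))) (f (c (Suc j)))"
        show "j = Suc i"
        proof (cases "i = 0")
          case False
          have "adj S (c (Suc i)) (c (Suc j))"
            using lift[OF cS cS pc pc A] ij n False by simp
          then show ?thesis using path[of "Suc i" "Suc j"] ij n by simp
        next
          case True
          \<comment> \<open>\<open>c 1\<close> is adjacent to \<open>?p\<close>, so
            \<open>lift\<close> does not apply. Instead, \<open>t *s c 0 + (1 + t) *s c 1\<close> is
            adjacent to \<open>c (Suc j)\<close>, and this vector is \<open>c 1\<close>, a multiple
            of \<open>c 0\<close>, or a multiple of a point treated in \<open>pc\<close>.\<close>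
          obtain z where z: "z \<in> S" "f (c 1) + f (c (Suc j)) = f z" using adj_add[OF A] True by auto
          then have "f (z - (c 1 + c (Suc j))) = 0"
            by (simp add: endo.linear_diff[OF f] endo.linear_add[OF f])
          then obtain t where "z - (c 1 + c (Suc j)) = t *s ?p" using ker by (auto simp: span_singleton)
          then have zt: "z = 1 *s (t *s c 0 + (1 + t) *s c 1) + 1 *s c (Suc j)" by (simp add: algebra_simps)
          have xS: "t *s c 0 + (1 + t) *s c 1 \<in> S" by (rule adjD[OF c01])
          have adjx: "adj S (t *s c 0 + (1 + t) *s c 1) (c (Suc j))"
            using has_chords_adj[OF S xS cS[of "Suc j"], of 1 1] zt z(1) ij n by simp
          consider "t = 0" | "t \<noteq> 0" "1 + t = 0" | "t \<noteq> 0" "1 + t \<noteq> 0" by blast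
          then show ?thesis
          proof cases
            case 1
            then show ?thesis using adjx path[of 1 "Suc j"] ij True n by simp
          next
            case 2
            then have "adj S (c 0) (c (Suc j))" using adjx adj_scale_iff[of t 1 S] by (metis add_0_right scale_one scale_zero_left zero_neq_one)
            then show ?thesis using path[of 0 "Suc j"] ij n by simp
          next
            case 3
            let ?s = "(1 + t) / t"
            have "t *s c 0 + (1 + t) *s c 1 = t *s (c 0 + ?s *s c 1)"
              using 3 by (simp add: scale_right_distrib)
            then have "adj S (c 0 + ?s *s c 1) (c (Suc j))"
              using adjx adj_scale_iff[of t 1 S] 3(1) by (metis one_neq_zero scale_one)
            moreover have "Suc j \<le> n" "2 \<le> Suc j" using ij n by linarith+
            moreover have "?s \<noteq> 0" using 3 by simp
            ultimately show ?thesis using pc by blast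
          qed
        qed
      qed
    qed
  qed
qed

section \<open>Separating subspaces\<close>

definition comb :: "'b set \<Rightarrow> ('b \<Rightarrow> 'f) \<Rightarrow> 'b" where
  "comb X f = (\<Sum>v\<in>X. f v *s v)"

lemma comb_add: "comb X (\<lambda>v. f v + g v) = comb X f + comb X g"
  by (simp add: comb_def scale_left_distrib sum.distrib)

lemma comb_diff: "comb X (\<lambda>v. f v - g v) = comb X f - comb X g"
  by (simp add: comb_def scale_left_diff_distrib sum_subtractf)

lemma comb_scale: "comb X (\<lambda>v. t * f v) = t *s comb X f"
  by (simp add: comb_def scale_sum_right)

lemma comb_single: "finite X \<Longrightarrow> comb X (\<lambda>v. if v = x then c else 0) = (if x \<in> X then c *s x else 0)"
proof -
  assume "finite X"
  have "comb X (\<lambda>v. if v = x then c else 0) = (\<Sum>v\<in>X. if v = x then c *s x else 0)"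
    unfolding comb_def by (rule sum.cong) auto
  then show ?thesis using \<open>finite X\<close> by simp
qed

lemma comb_support: "finite X \<Longrightarrow> Z \<subseteq> X \<Longrightarrow> (\<And>v. v \<in> X - Z \<Longrightarrow> f v = 0) \<Longrightarrow> comb X f = comb Z f"
  unfolding comb_def by (rule sum.mono_neutral_right) auto

lemma not_independent_comb:
  assumes "finite I" "dependent I"
  obtains u where "comb I u = 0" "\<exists>v\<in>I. u v \<noteq> 0" "\<And>v. v \<notin> I \<Longrightarrow> u v = 0"
proof -
  obtain u where u: "\<exists>v\<in>I. u v \<noteq> 0" "(\<Sum>v\<in>I. u v *s v) = 0"
    using assms dependent_finite by blast
  define w where "w v = (if v \<in> I then u v else 0)" for v
  have "comb I w = 0" using u(2) unfolding comb_def w_def by (simp cong: sum.cong)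
  then show thesis using that[of w] u(1) by (auto simp: w_def)
qed

text \<open>A relation of minimal support between the two sides would have a chord, and merging the two ends
  of the chord would give a smaller relation.\<close>

lemma separated_span:
  assumes S: "conic S" "has_chords S" "finite S" and Y: "subspace Y" "Y \<subseteq> S"
    and A: "A \<subseteq> S - Y" and B: "B = S - Y - A"
    and sep: "\<And>a b. a \<in> A \<Longrightarrow> b \<in> B \<Longrightarrow> \<not> adj S a b"
  shows "span (A \<union> Y) \<inter> span (B \<union> Y) \<subseteq> Y"
proof (rule ccontr)
  assume "\<not> ?thesis"
  then obtain u where u: "u \<in> span (A \<union> Y)" "u \<in> span (B \<union> Y)" "u \<notin> Y" by blast
  define T where "T = A \<union> B"
  have fin: "finite A" "finite B" "finite T" using S(3) A B T_def finite_subset by auto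
  have dis: "A \<inter> B = {}" and TS: "T \<subseteq> S" and TY: "T \<inter> Y = {}" using A B T_def by auto
  have AT: "A \<subseteq> T" "B \<subseteq> T" using T_def by auto
  have combT: "comb T f = comb A f + comb B f" for f
    unfolding comb_def T_def by (rule sum.union_disjoint[OF fin(1,2) dis])
  have closed: "z \<in> A \<union> Y" if "a \<in> A" "adj S a z" for a z
    using sep[OF that(1)] that adj_right[OF that(2)] B by blast
  have closedB: "z \<in> B \<union> Y" if "a \<in> B" "adj S a z" for a z
    using sep[of z a] that adj_sym[OF that(2)] adj_right[OF that(2)] B by blast
  define supp where "supp f = {v \<in> T. f v \<noteq> 0}" for f :: "'b \<Rightarrow> 'f"
  have fs: "finite (supp f)" for f using fin by (simp add: supp_def)
  \<comment> \<open>Relations are taken modulo \<open>Y\<close>: the total lies in \<open>Y\<close>,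
    but its part on the side \<open>A\<close> does not.\<close>
  define bad where "bad f \<longleftrightarrow> comb T f \<in> Y \<and> comb A f \<notin> Y" for f
  have spanY: "span Y = Y" using Y(1) by simp
  obtain a y where ay: "a \<in> span A" "y \<in> Y" "u = a + y"
    using u(1) unfolding span_Un spanY by blast
  obtain b y' where by': "b \<in> span B" "y' \<in> Y" "u = b + y'"
    using u(2) unfolding span_Un spanY by blast
  obtain g where g: "a = comb A g" using ay(1) span_finite[OF fin(1)] unfolding comb_def by auto
  obtain h where h: "b = comb B h" using by'(1) span_finite[OF fin(2)] unfolding comb_def by auto
  define f0 where "f0 v = (if v \<in> A then g v else - h v)" for v
  have "comb A f0 = a" unfolding g comb_def f0_def by (rule sum.cong) auto
  moreover have "comb B f0 = - b"
    unfolding h comb_def f0_def sum_negf[symmetric] using dis by (intro sum.cong) auto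
  moreover have "a - b = y' - y" using ay(3) by'(3) by (simp add: algebra_simps)
  moreover have "a \<notin> Y" using u(3) ay(2,3) Y(1) subspace_add by blast
  ultimately have "bad f0"
    unfolding bad_def combT using Y(1) ay(2) by'(2) by (simp add: subspace_diff)
  then obtain f where f: "bad f" and minimal: "\<And>g. bad g \<Longrightarrow> card (supp f) \<le> card (supp g)"
    using ex_has_least_nat[of bad f0 "\<lambda>f. card (supp f)"] by blast
  let ?I = "supp f"
  have smaller: False if "bad g" "supp g \<subset> supp f" for g
    using minimal[OF that(1)] psubset_card_mono[OF fs that(2)] by simp
  \<comment> \<open>A relation modulo \<open>Y\<close> on a proper part of the support is either bad
    itself, or a multiple of it can be subtracted from \<open>f\<close>, which removes
    \<open>j\<close> from the support and preserves badness.\<close>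
  have no_rel: False if r: "comb T r \<in> Y" "supp r \<subset> ?I" "j \<in> ?I" "r j \<noteq> 0" for r j
  proof (cases "comb A r \<in> Y")
    case False
    then show False using smaller[of r] r by (simp add: bad_def)
  next
    case True
    define k where "k = (\<lambda>v. f v - (f j / r j) * r v)"
    have k: "comb X k = comb X f - (f j / r j) *s comb X r" for X
      unfolding k_def comb_diff comb_scale ..
    have "comb A k \<notin> Y"
    proof
      assume "comb A k \<in> Y"
      then have "comb A k + (f j / r j) *s comb A r \<in> Y"
        using True Y(1) by (simp add: subspace_add subspace_scale)
      then show False using f by (simp add: k bad_def)
    qed
    moreover have "comb T k \<in> Y"
      using r(1) f Y(1) by (simp add: k bad_def subspace_diff subspace_scale)
    ultimately have "bad k" by (simp add: bad_def)
    moreover have "supp k \<subseteq> ?I" using r(2) by (auto simp: k_def supp_def)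
    moreover have "j \<notin> supp k" using r(4) by (simp add: k_def supp_def)
    ultimately show False using smaller[of k] r(3) by blast
  qed
  have IT: "?I \<subseteq> T" by (auto simp: supp_def)
  have IS: "?I \<subseteq> S" using IT TS by blast
  have combI: "comb T f = comb ?I f"
    by (rule comb_support[OF fin(3) IT]) (auto simp: supp_def)
  have combA: "comb A f = comb (?I \<inter> A) f"
    by (rule comb_support[OF fin(1)]) (auto simp: supp_def T_def)
  have "?I \<inter> A \<noteq> {}"
  proof
    assume "?I \<inter> A = {}"
    then have "comb A f = comb {} f" using combA by simp
    also have "\<dots> = 0" by (simp add: comb_def)
    finally show False using f subspace_0[OF Y(1)] by (simp add: bad_def)
  qed
  moreover have IB: "?I \<inter> B \<noteq> {}"
  proof
    assume "?I \<inter> B = {}"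
    then have "?I \<inter> A = ?I" using IT T_def by blast
    then show False using f combA combI by (simp add: bad_def)
  qed
  ultimately obtain a' b' where ab': "a' \<in> ?I \<inter> A" "b' \<in> ?I \<inter> B" by blast
  then have ne: "a' \<noteq> b'" using dis by blast
  have card2: "2 \<le> card ?I"
    using card_mono[OF fs, of "{a', b'}" f] ab' ne by simp
  have rel: "comb T u = comb I u" if "I \<subseteq> ?I" "\<And>v. v \<notin> I \<Longrightarrow> u v = 0" for u I
    by (rule comb_support[OF fin(3)]) (use that IT in auto)
  have "chorded S ?I"
  \<comment> \<open>A nonzero total is a vector of \<open>Y\<close>, and the whole support is then
    an independent set summing to a member of \<open>S\<close>, up to scaling. If the total is 0,
    the support itself is a circuit, and the term at \<open>a'\<close> takes the role of the
    sum.\<close>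
  proof (cases "comb T f = 0")
    case False
    have "independent ?I"
    proof
      assume "dependent ?I"
      then obtain u where u: "comb ?I u = 0" "\<exists>v\<in>?I. u v \<noteq> 0" "\<And>v. v \<notin> ?I \<Longrightarrow> u v = 0"
        using not_independent_comb[OF fs] by blast
      then have u0: "comb T u = 0" using rel[of ?I u] by simp
      obtain j where j: "j \<in> ?I" "u j \<noteq> 0" using u(2) by blast
      define k where "k = (\<lambda>v. f v - (f j / u j) * u v)"
      have kT: "comb T k = comb T f" unfolding k_def comb_diff comb_scale u0 by simp
      have sk: "supp k \<subset> ?I"
      proof -
        have "supp k \<subseteq> ?I" using u(3) by (auto simp: k_def supp_def)
        moreover have "j \<notin> supp k" using j by (simp add: k_def supp_def)
        ultimately show ?thesis using j by blast
      qed
      have "comb T k = comb (supp k) k"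
        by (rule comb_support[OF fin(3)]) (auto simp: supp_def)
      then have "supp k \<noteq> {}" using kT False by (auto simp: comb_def)
      then obtain i where "i \<in> supp k" by blast
      then show False using no_rel[of k i] sk kT f by (auto simp: bad_def supp_def)
    qed
    then show ?thesis
    proof (rule chorded_relation[OF S(1) IS fs])
      show "(\<Sum>j\<in>?I. f j *s j) \<in> S"
        using f Y(2) combI by (auto simp: bad_def comb_def)
      show "chorded S I" if "I \<subseteq> S" "finite I" "independent I" "card I = card ?I" "\<Sum>I \<in> S" for I
        using has_chordsD[OF S(2)] that card2 by simp
    qed (simp add: supp_def)
  next
    case True
    let ?J = "?I - {a'}"
    have fJ: "finite ?J" using fs by simp
    have sumI: "(\<Sum>j\<in>?J. f j *s j) = - (f a' *s a')"
    proof -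
      have "comb ?I f = 0" using True combI by simp
      then have "0 = (\<Sum>j\<in>?I. f j *s j)" by (simp add: comb_def)
      also have "\<dots> = f a' *s a' + (\<Sum>j\<in>?J. f j *s j)" using ab' by (intro sum.remove[OF fs]) simp
      finally show ?thesis by (simp add: eq_neg_iff_add_eq_0 add.commute)
    qed
    have "card ?J \<noteq> 1"
    proof
      assume "card ?J = 1"
      then have "?J = {b'}" using ab' ne by (metis card_1_singletonE DiffI IntD1 singletonD)
      then have "f b' *s b' = - (f a' *s a')" using sumI by simp
      then have "(- f b') *s b' = f a' *s a'" by simp
      then have "inverse (f a') *s (- f b') *s b' = inverse (f a') *s f a' *s a'" by (rule arg_cong)
      also have "\<dots> = a'" using ab' by (simp add: supp_def)
      finally have eq: "a' = (inverse (f a') * - f b') *s b'" by (simp only: scale_scale)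
      have "b' \<in> S" using ab' IS by blast
      then have "adj S b' a'" by (subst eq) (rule adj_multiple[OF S(1)])
      then show False using sep[of a' b'] adj_sym ab' by blast
    qed
    moreover have "card ?J = card ?I - 1" using ab' fs by simp
    ultimately have "2 \<le> card ?J" using card2 by linarith
    have "independent ?J"
    proof
      assume "dependent ?J"
      then obtain u where u: "comb ?J u = 0" "\<exists>v\<in>?J. u v \<noteq> 0" "\<And>v. v \<notin> ?J \<Longrightarrow> u v = 0"
        using not_independent_comb[OF fJ] by blast
      have "comb T u = 0" using rel[of ?J u] u by auto
      moreover have "supp u \<subset> ?I" using u(3) ab' by (auto simp: supp_def)
      ultimately show False using no_rel[of u] u(2) subspace_0[OF Y(1)] by auto
    qed
    have JS: "?J \<subseteq> S" using IS by blast
    from \<open>independent ?J\<close> have "chorded S ?J"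
    proof (rule chorded_relation[OF S(1) JS fJ])
      show "(\<Sum>j\<in>?J. f j *s j) \<in> S"
        unfolding sumI using ab' IS S(1) by (auto intro!: conic_minus conic_scale)
      show "chorded S I" if "I \<subseteq> S" "finite I" "independent I" "card I = card ?J" "\<Sum>I \<in> S" for I
        using has_chordsD[OF S(2)] that \<open>2 \<le> card ?J\<close> by simp
    qed (simp add: supp_def)
    then show ?thesis using chorded_mono[of S ?J S ?I] by blast
  qed
  then obtain x x' where x: "x \<in> ?I" "x' \<in> ?I" "x \<noteq> x'" "adj S x x'"
    unfolding chorded_def by blast
  define z where "z = f x *s x + f x' *s x'"
  have adjz: "adj S x z"
    using adj_comb[OF x(4), of 1 0 "f x" "f x'"] by (simp add: z_def)
  define e where "e = (if z \<in> Y then 0 else 1 :: 'f)"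
  define k where "k = (\<lambda>v. f v - ((if v = x then f x else 0) + (if v = x' then f x' else 0))
    + (if v = z then e else 0))"
  have k: "comb X k = comb X f - ((if x \<in> X then f x *s x else 0) + (if x' \<in> X then f x' *s x' else 0))
      + (if z \<in> X then e *s z else 0)" if "finite X" for X
    using that unfolding k_def by (simp only: comb_add comb_diff comb_single)
  have zT: "z \<in> T \<union> Y" using closed[of x z] closedB[of x z] adjz x(1) IT T_def by blast
  have xT: "x \<in> T" "x' \<in> T" using x IT by blast+
  have "comb T k = comb T f - z + (if z \<in> Y then 0 else z)"
    using zT TY xT by (auto simp: k[OF fin(3)] z_def[symmetric] e_def)
  then have kT: "comb T k \<in> Y" using f Y(1) by (auto simp: bad_def subspace_diff)
  have kA: "comb A k \<notin> Y"
  proof (cases "x \<in> A")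
    case True
    then have "x' \<in> A" using closed[of x x'] x(4) xT TY by blast
    then have eq: "comb A k = comb A f - z + (if z \<in> Y then 0 else z)"
      using True closed[OF True adjz] A by (auto simp: k[OF fin(1)] z_def[symmetric] e_def)
    show ?thesis
    proof (cases "z \<in> Y")
      case True
      show ?thesis
      proof
        assume "comb A k \<in> Y"
        then have "comb A k + z \<in> Y" using subspace_add[OF Y(1)] True by blast
        then show False using eq True f by (simp add: bad_def)
      qed
    next
      case False
      then show ?thesis using eq f by (simp add: bad_def)
    qed
  next
    case False
    then have xB: "x \<in> B" using xT T_def by blast
    then have "x' \<in> B" "z \<in> B \<union> Y" using closedB[of x] x(4) adjz xT TY by blast+
    then have "x' \<notin> A" "z \<notin> A" using dis A by blast+
    then show ?thesis using False f by (simp add: k[OF fin(1)] bad_def)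
  qed
  have "supp k \<subseteq> insert z (?I - {x, x'})" using x(3) by (auto simp: k_def supp_def)
  then have "card (supp k) \<le> card (insert z (?I - {x, x'}))" using fs by (intro card_mono) auto
  also have "\<dots> \<le> Suc (card (?I - {x, x'}))" by (rule card_insert_le_m1) auto
  also have "card (?I - {x, x'}) = card ?I - 2" using x fs by (simp add: card_Diff_subset)
  finally have "card (supp k) < card ?I" using card2 by linarith
  then show False using minimal[of k] kT kA by (simp add: bad_def)
qed

text \<open>Any two vectors of \<open>K\<close> are adjacent, so \<open>adj_plane\<close> closes the
  set of neighbours under addition.\<close>

lemma subspace_neighbours:
  assumes "2 < CARD('f)" "conic S" "has_chords S" "d \<in> S" "subspace K" "K \<subseteq> S"
  shows "subspace {k \<in> K. adj S d k}"
proof (rule subspaceI)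
  show "0 \<in> {k \<in> K. adj S d k}"
    using adj_multiple[OF assms(2,4), of 0] subspace_0[OF assms(5)] by simp
next
  fix x y assume xy: "x \<in> {k \<in> K. adj S d k}" "y \<in> {k \<in> K. adj S d k}"
  then have "adj S x y" using adj_subspace[OF assms(5,6)] by blast
  from adj_plane[OF assms(1-3) _ _ this, of d 1 1] xy
  show "x + y \<in> {k \<in> K. adj S d k}" using subspace_add[OF assms(5)] by simp
next
  fix c x assume "x \<in> {k \<in> K. adj S d k}"
  then show "c *s x \<in> {k \<in> K. adj S d k}"
    using adj_scale[of S d x 1 c] subspace_scale[OF assms(5)] by simp
qed

text \<open>Dirac's argument: for a maximal subspace \<open>K \<subseteq> S\<close>, a point \<open>d\<close> off \<open>K\<close> with as many neighbours
  in \<open>K\<close> as possible is separated from the rest of \<open>K\<close> by these neighbours, since a shortest path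
  would close up to an induced cycle.\<close>

lemma ex_separation:
  assumes q: "2 < CARD('f)" and S: "conic S" "has_chords S" "finite S" and ns: "\<not> subspace S"
  obtains Y A where "subspace Y" "Y \<subseteq> S" "A \<subseteq> S - Y" "A \<noteq> {}" "S - Y - A \<noteq> {}"
    "\<And>a b. a \<in> A \<Longrightarrow> b \<in> S - Y - A \<Longrightarrow> \<not> adj S a b"
proof -
  let ?P = "\<lambda>L. subspace L \<and> L \<subseteq> S"
  have "?P {0}" using conic_zero[OF S(1)] by simp
  moreover have "\<forall>L. ?P L \<longrightarrow> card L < Suc (card S)"
    using card_mono[OF S(3)] by (simp add: less_Suc_eq_le)
  ultimately have "\<exists>K. ?P K \<and> (\<forall>L. ?P L \<longrightarrow> card L \<le> card K)"
    by (rule ex_has_greatest_nat)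
  then obtain K where K: "subspace K" "K \<subseteq> S"
    and Kmax: "\<And>L. subspace L \<Longrightarrow> L \<subseteq> S \<Longrightarrow> card L \<le> card K"
    by blast
  define N where "N d = {k \<in> K. adj S d k}" for d
  have finK: "finite K" using K(2) S(3) finite_subset by blast
  have finN: "finite (N d)" for d using finK by (simp add: N_def)
  \<comment> \<open>A point adjacent to all of \<open>K\<close> could be added to \<open>K\<close>,
    contrary to maximality.\<close>
  have NK: "N d \<noteq> K" if d: "d \<in> S - K" for d
  proof
    assume N: "N d = K"
    have sub: "span (insert d K) \<subseteq> S"
    proof
      fix x assume "x \<in> span (insert d K)"
      then obtain k where "x - k *s d \<in> span K" unfolding span_breakdown_eq by blast
      then have "x - k *s d \<in> K" using span_eq_iff K(1) by blast
      then have "adj S d (x - k *s d)" using N by (auto simp: N_def)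
      from adjD[OF this, of k 1] show "x \<in> S" by simp
    qed
    have "K \<subset> span (insert d K)" using d span_superset[of "insert d K"] by blast
    then have "card K < card (span (insert d K))"
      by (rule psubset_card_mono[OF finite_subset[OF sub S(3)]])
    then show False using Kmax[OF subspace_span sub] by simp
  qed
  have "S \<noteq> K" using ns K by blast
  then obtain d0 where "d0 \<in> S - K" using K by blast
  moreover have "\<forall>d. d \<in> S - K \<longrightarrow> card (N d) < Suc (card K)"
    using card_mono[OF finK] by (simp add: less_Suc_eq_le N_def)
  ultimately have "\<exists>d. d \<in> S - K \<and> (\<forall>e. e \<in> S - K \<longrightarrow> card (N e) \<le> card (N d))"
    by (rule ex_has_greatest_nat)
  then obtain d where d: "d \<in> S - K" and dmax: "\<And>e. e \<in> S - K \<Longrightarrow> card (N e) \<le> card (N d)"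
    by blast
  define Y where "Y = N d"
  have Y: "subspace Y" "Y \<subseteq> K" unfolding Y_def N_def
    using subspace_neighbours[OF q S(1,2) _ K] d by auto
  have YK: "Y \<noteq> K" using NK[OF d] Y_def by simp
  define R where "R = {(u, v). u \<in> S - Y \<and> v \<in> S - Y \<and> adj S u v}"
  \<comment> \<open>The connected component of \<open>d\<close> after removal of
    \<open>Y\<close>.\<close>
  define A where "A = {v. (d, v) \<in> R\<^sup>*}"
  have dY: "d \<in> S - Y" using d Y(2) by blast
  have AS: "v \<in> S - Y" if "v \<in> A" for v
    using that dY unfolding A_def by (auto elim: rtranclE simp: R_def)
  have "A \<inter> K = {}"
  proof (rule ccontr)
    assume "A \<inter> K \<noteq> {}"
    then obtain k0 where "k0 \<in> K" "(d, k0) \<in> R\<^sup>*" "k0 \<notin> Y" using AS unfolding A_def by blast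
    then obtain n0 where n0: "\<exists>k\<in>K - Y. (d, k) \<in> R ^^ n0" using rtrancl_imp_relpow by blast
    \<comment> \<open>A shortest walk from \<open>d\<close> to \<open>K - Y\<close> is an induced
      path.\<close>
    define n where "n = (LEAST n. \<exists>k\<in>K - Y. (d, k) \<in> R ^^ n)"
    have "\<exists>k\<in>K - Y. (d, k) \<in> R ^^ n" unfolding n_def using n0 by (rule LeastI)
    then obtain k where k: "k \<in> K - Y" "(d, k) \<in> R ^^ n" by blast
    have least: "n \<le> m" if "k \<in> K - Y" "(d, k) \<in> R ^^ m" for k m
      unfolding n_def by (rule Least_le) (use that in blast)
    obtain p where p: "p 0 = d" "p n = k" "\<And>i. i < n \<Longrightarrow> (p i, p (Suc i)) \<in> R"
      using k(2) unfolding relpow_fun_conv by blast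
    have pd: "(d, p i) \<in> R ^^ i" if "i \<le> n" for i
      unfolding relpow_fun_conv by (rule exI[of _ p]) (use p that in auto)
    have pk: "(p i, k) \<in> R ^^ (n - i)" if "i \<le> n" for i
      unfolding relpow_fun_conv by (rule exI[of _ "\<lambda>j. p (i + j)"]) (use p that in auto)
    have pS: "p i \<in> S - Y" if "i \<le> n" for i
    proof (cases i)
      case 0
      then show ?thesis using p(1) dY by simp
    next
      case (Suc j)
      then show ?thesis using p(3)[of j] that by (simp add: R_def)
    qed
    have pK: "p i \<notin> K" if "i < n" for i
      using least[of "p i" i] pd[of i] pS[of i] that by auto
    have step: "adj S (p i) (p (Suc i))" if "i < n" for i
      using p(3)[OF that] by (simp add: R_def)
    have short: "adj S (p i) (p j) \<longleftrightarrow> j = Suc i" if "i < j" "j \<le> n" for i j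
    proof
      assume "adj S (p i) (p j)"
      then have "(p i, p j) \<in> R" using pS that by (simp add: R_def)
      then have "(d, p j) \<in> R ^^ Suc i" using pd[of i] that by auto
      then have "(d, k) \<in> R ^^ (Suc i + (n - j))" using pk[OF that(2)]
        unfolding relpow_add by (rule relcompI)
      then have "n \<le> Suc i + (n - j)" by (rule least[OF k(1)])
      then show "j = Suc i" using that by linarith
    next
      assume "j = Suc i"
      then show "adj S (p i) (p j)" using step that by simp
    qed
    have "n \<noteq> 0" using p(1,2) k d by (metis DiffD1 DiffD2)
    moreover have "n \<noteq> 1"
    proof
      assume "n = 1"
      then have "adj S d k" using step[of 0] p by simp
      then show False using k by (auto simp: Y_def N_def)
    qed
    ultimately have n: "2 \<le> n" by linarith
    let ?e = "p (n - 1)"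
    have e: "?e \<in> S - K" using pS[of "n - 1"] pK[of "n - 1"] n by auto
    have ek: "adj S ?e k" using step[of "n - 1"] p(2) n by simp
    \<comment> \<open>The last vertex before \<open>K\<close> has the neighbour \<open>k\<close>
      outside \<open>Y\<close>; if it were also adjacent to all of \<open>Y\<close>, it would have
      more neighbours in \<open>K\<close> than \<open>d\<close>.\<close>
    have "\<not> Y \<subseteq> N ?e"
    proof
      assume "Y \<subseteq> N ?e"
      then have "insert k Y \<subseteq> N ?e" using ek k by (simp add: N_def)
      then have "card (insert k Y) \<le> card (N ?e)" by (rule card_mono[OF finN])
      also have "\<dots> \<le> card Y" unfolding Y_def by (rule dmax[OF e])
      finally show False using k finN[of d] by (simp add: Y_def)
    qed
    then obtain y where y: "y \<in> Y" "\<not> adj S ?e y" using Y(2) by (auto simp: N_def)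
    \<comment> \<open>The cycle starts at the last vertex adjacent to \<open>y\<close> before
      \<open>?e\<close>, which is not adjacent to \<open>y\<close>, and follows the path to
      \<open>k\<close>. It closes up because \<open>y\<close> and \<open>k\<close> both lie in
      \<open>K\<close>.\<close>
    let ?M = "{j. j \<le> n - 2 \<and> adj S y (p j)}"
    have M: "finite ?M" "0 \<in> ?M" using y(1) p(1) adj_sym by (auto simp: Y_def N_def)
    define m where "m = Max ?M"
    have m: "m \<le> n - 2" "adj S y (p m)" using Max_in[OF M(1)] M(2) unfolding m_def by blast+
    have mmax: "i \<le> m" if "i \<le> n - 2" "adj S y (p i)" for i
      unfolding m_def using Max_ge[OF M(1)] that by blast
    show False
    proof (rule no_induced_cycle[OF q S(1,2), of "n - m" "\<lambda>i. p (m + i)" y])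
      show "2 \<le> n - m" using m n by linarith
      show "adj S (p (m + i)) (p (m + j)) \<longleftrightarrow> j = Suc i" if "i < j" "j \<le> n - m" for i j
        using short[of "m + i" "m + j"] that m by auto
      show "adj S y (p (m + 0))" using m by simp
      have "adj S y k" by (rule adj_subspace[OF K]) (use y(1) Y(2) k(1) in auto)
      then show "adj S y (p (m + (n - m)))" using p(2) m by simp
      show "\<not> adj S y (p (m + i))" if i: "0 < i" "i < n - m" for i
      proof (cases "m + i = n - 1")
        case True
        then show ?thesis using y(2) adj_sym by metis
      next
        case False
        then have "m + i \<le> n - 2" using i n by linarith
        then show ?thesis using mmax[of "m + i"] i by auto
      qed
    qed
  qed
  then have "S - Y - A \<noteq> {}" using YK Y K by blast
  moreover have "\<not> adj S a b" if "a \<in> A" "b \<in> S - Y - A" for a b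
  proof
    assume "adj S a b"
    then have "(a, b) \<in> R" using AS that by (simp add: R_def)
    then have "b \<in> A" using that unfolding A_def by (auto intro: rtrancl_into_rtrancl)
    then show False using that by blast
  qed
  moreover have "d \<in> A" by (simp add: A_def)
  ultimately show thesis using that[of Y A] Y K AS by blast
qed

text \<open>The separation cuts \<open>S\<close> into \<open>A \<union> Y\<close> and
  \<open>B \<union> Y\<close>. Each is the section of \<open>S\<close> by its own span, so it
  inherits chords, and each is smaller since neither \<open>A\<close> nor \<open>B\<close> is
  empty.\<close>

theorem has_chords_decomposable:
  assumes q: "2 < CARD('f)"
  shows "conic S \<Longrightarrow> has_chords S \<Longrightarrow> finite S \<Longrightarrow> decomposable S"
proof (induction "card S" arbitrary: S rule: less_induct)
  case less
  show ?case
  proof (cases "subspace S")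
    case True
    then show ?thesis by (rule decomposable.full)
  next
    case False
    obtain Y A where YA: "subspace Y" "Y \<subseteq> S" "A \<subseteq> S - Y" "A \<noteq> {}" "S - Y - A \<noteq> {}"
      and sep: "\<And>a b. a \<in> A \<Longrightarrow> b \<in> S - Y - A \<Longrightarrow> \<not> adj S a b"
      using ex_separation[OF q less.prems False] by blast
    define B where "B = S - Y - A"
    have span: "span (A \<union> Y) \<inter> span (B \<union> Y) \<subseteq> Y"
      by (rule separated_span[OF less.prems YA(1-3) B_def]) (use sep B_def in blast)
    have SAB: "S = (A \<union> Y) \<union> (B \<union> Y)" using YA B_def by blast
    have "decomposable T" if T: "T = S \<inter> span T" "T \<subset> S" for T
    proof (rule less.hyps)
      show "card T < card S" using psubset_card_mono[OF less.prems(3) T(2)] .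
      show "conic T" using subspace_conic[OF subspace_span[of T]] less.prems(1) T(1)
        unfolding conic_def by blast
      show "has_chords T" using has_chords_Int_subspace[OF less.prems(2) subspace_span[of T]] T(1) by simp
      show "finite T" using T(2) less.prems(3) finite_subset by blast
    qed
    moreover have "A \<union> Y = S \<inter> span (A \<union> Y)"
    proof
      show "A \<union> Y \<subseteq> S \<inter> span (A \<union> Y)" using YA span_superset by blast
      show "S \<inter> span (A \<union> Y) \<subseteq> A \<union> Y" using span span_superset[of "B \<union> Y"] SAB by blast
    qed
    moreover have "B \<union> Y = S \<inter> span (B \<union> Y)"
    proof
      show "B \<union> Y \<subseteq> S \<inter> span (B \<union> Y)" using SAB span_superset by blast
      show "S \<inter> span (B \<union> Y) \<subseteq> B \<union> Y" using span span_superset[of "A \<union> Y"] SAB by blast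
    qed
    moreover have "A \<union> Y \<subset> S" "B \<union> Y \<subset> S" using YA B_def by blast+
    ultimately have "decomposable (A \<union> Y)" "decomposable (B \<union> Y)" by blast+
    then show ?thesis using decomposable.union[of "A \<union> Y" "B \<union> Y"] span SAB by auto
  qed
qed

end

section \<open>Arcs\<close>

lemma card_off_diagonal:
  assumes "finite T"
  shows "card {(a, b). a \<in> T \<and> b \<in> T \<and> a \<noteq> b} = card T * card T - card T"
proof -
  have "{(a, b). a \<in> T \<and> b \<in> T \<and> a \<noteq> b} = T \<times> T - (\<lambda>a. (a, a)) ` T" by auto
  moreover have "card ((\<lambda>a. (a, a)) ` T) = card T" by (rule card_image) (simp add: inj_on_def)
  ultimately show ?thesis using assms by (simp add: card_Diff_subset image_subset_iff)
qed

text \<open>The blocks through a point partition the remaining points into pairs, and the blocks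
  partition all ordered pairs of distinct points into classes of six.\<close>

lemma steiner_triple_system:
  assumes V: "finite V" "V \<noteq> {}" and R: "\<And>T. T \<in> R \<Longrightarrow> T \<subseteq> V \<and> card T = 3"
    and ex: "\<And>a b. a \<in> V \<Longrightarrow> b \<in> V \<Longrightarrow> a \<noteq> b \<Longrightarrow> \<exists>T\<in>R. a \<in> T \<and> b \<in> T"
    and uniq: "\<And>a b T T'. a \<noteq> b \<Longrightarrow> T \<in> R \<Longrightarrow> T' \<in> R \<Longrightarrow> {a, b} \<subseteq> T \<Longrightarrow> {a, b} \<subseteq> T' \<Longrightarrow> T = T'"
  shows "odd (card V)" and "6 dvd card V * (card V - 1)"
proof -
  have finR: "finite R" using R V(1) by (metis Pow_iff finite_Pow_iff finite_subset subsetI)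
  have finT: "finite T" if "T \<in> R" for T using R[OF that] V(1) finite_subset by blast
  obtain a where a: "a \<in> V" using V(2) by blast
  let ?C = "(\<lambda>T. T - {a}) ` {T \<in> R. a \<in> T}"
  have "2 * card ?C = card (\<Union>?C)"
  proof (rule card_partition)
    show "finite ?C" using finR by simp
    show "finite (\<Union>?C)" using finR finT by auto
    show "card c = 2" if "c \<in> ?C" for c using that R by auto
    show "c1 \<inter> c2 = {}" if c: "c1 \<in> ?C" "c2 \<in> ?C" "c1 \<noteq> c2" for c1 c2
    proof (rule ccontr)
      assume "c1 \<inter> c2 \<noteq> {}"
      then obtain b where b: "b \<in> c1" "b \<in> c2" by blast
      obtain T1 T2 where T: "T1 \<in> R" "a \<in> T1" "c1 = T1 - {a}" "T2 \<in> R" "a \<in> T2" "c2 = T2 - {a}"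
        using c by blast
      have "T1 = T2" by (rule uniq[of a b]) (use T b in auto)
      then show False using T c by blast
    qed
  qed
  moreover have "\<Union>?C = V - {a}"
  proof
    show "\<Union>?C \<subseteq> V - {a}" using R by auto
    show "V - {a} \<subseteq> \<Union>?C"
    proof
      fix b assume b: "b \<in> V - {a}"
      then obtain T where "T \<in> R" "a \<in> T" "b \<in> T" using ex[OF a, of b] by blast
      then show "b \<in> \<Union>?C" using b by blast
    qed
  qed
  moreover have "card V = Suc (card (V - {a}))" using card.remove[OF V(1) a] .
  ultimately show "odd (card V)" by (metis dvd_triv_left even_Suc)
  let ?p = "\<lambda>T. {(a, b). a \<in> T \<and> b \<in> T \<and> a \<noteq> b}"
  let ?D = "?p ` R"
  have six: "6 * card ?D = card (\<Union>?D)"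
  proof (rule card_partition)
    show "finite ?D" using finR by simp
    have "\<Union>?D \<subseteq> V \<times> V" using R by auto
    then show "finite (\<Union>?D)" using V(1) finite_subset by blast
    show "card c = 6" if c: "c \<in> ?D" for c
    proof -
      obtain T where T: "T \<in> R" "c = ?p T" using c by blast
      then show ?thesis using card_off_diagonal[OF finT[OF T(1)]] R[OF T(1)] by simp
    qed
    show "c1 \<inter> c2 = {}" if c: "c1 \<in> ?D" "c2 \<in> ?D" "c1 \<noteq> c2" for c1 c2
    proof (rule ccontr)
      assume "c1 \<inter> c2 \<noteq> {}"
      then obtain a b where ab: "(a, b) \<in> c1" "(a, b) \<in> c2" by auto
      obtain T1 T2 where T: "T1 \<in> R" "c1 = ?p T1" "T2 \<in> R" "c2 = ?p T2" using c by blast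
      have "T1 = T2" by (rule uniq[of a b]) (use T ab in auto)
      then show False using T c by blast
    qed
  qed
  have "\<Union>?D = ?p V"
  proof
    show "\<Union>?D \<subseteq> ?p V" using R by auto
    show "?p V \<subseteq> \<Union>?D"
    proof clarify
      fix a b assume "a \<in> V" "b \<in> V" "a \<noteq> b"
      then obtain T where "T \<in> R" "a \<in> T" "b \<in> T" using ex by blast
      then show "(a, b) \<in> \<Union>?D" using \<open>a \<noteq> b\<close> by blast
    qed
  qed
  then have "card V * card V - card V = 6 * card ?D" using card_off_diagonal[OF V(1)] six by simp
  then have "6 dvd card V * card V - card V" by (rule dvdI)
  then show "6 dvd card V * (card V - 1)" by (simp add: diff_mult_distrib2)
qed

context finite_field_space begin

section \<open>Sizes of spans and cones\<close>

lemma q_ge_2: "2 \<le> CARD('f)"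
proof -
  have "card {0, 1::'f} \<le> CARD('f)" by (rule card_mono) auto
  then show ?thesis by simp
qed

lemma span_finite_comb: "finite B \<Longrightarrow> v \<in> span B \<Longrightarrow> \<exists>u. v = comb B u"
  unfolding comb_def using span_finite by auto

lemma comb_span: "comb B u \<in> span B"
  unfolding comb_def by (intro span_sum span_scale span_base)

lemma comb_independent: "finite B \<Longrightarrow> independent B \<Longrightarrow> comb B u = comb B w \<Longrightarrow> v \<in> B \<Longrightarrow> u v = w v"
proof -
  assume B: "finite B" "independent B" "comb B u = comb B w" "v \<in> B"
  then have "comb B (\<lambda>v. u v - w v) = 0" by (simp add: comb_diff)
  then show ?thesis using independentD[OF B(2,1) subset_refl] B(4) unfolding comb_def by fastforce
qed

lemma card_span:
  assumes "finite B" "independent B"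
  shows "finite (span B)" and "card (span B) = CARD('f) ^ card B"
proof -
  let ?F = "B \<rightarrow>\<^sub>E (UNIV :: 'f set)"
  have img: "comb B ` ?F = span B"
  proof
    show "comb B ` ?F \<subseteq> span B" using comb_span by blast
    show "span B \<subseteq> comb B ` ?F"
    proof
      fix v assume "v \<in> span B"
      then obtain u where u: "v = comb B u" using span_finite_comb[OF assms(1)] by blast
      have "v = comb B (restrict u B)" unfolding u comb_def by (rule sum.cong) auto
      then show "v \<in> comb B ` ?F" by auto
    qed
  qed
  have inj: "inj_on (comb B) ?F"
  proof (rule inj_onI)
    fix u w assume "u \<in> ?F" "w \<in> ?F" "comb B u = comb B w"
    then show "u = w" using comb_independent[OF assms] by (intro PiE_ext) blast+
  qed
  have "finite ?F" using assms(1) by (intro finite_PiE) auto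
  then show "finite (span B)" using img by (metis finite_imageI)
  have "card (span B) = card ?F" using card_image[OF inj] img by simp
  then show "card (span B) = CARD('f) ^ card B" using assms(1) by (simp add: card_funcsetE)
qed

lemma span_eq_of_card:
  assumes "finite B" "independent B" "finite I" "independent I" "B \<subseteq> span I" "card B = card I"
  shows "span B = span I"
proof (rule card_subset_eq)
  show "finite (span I)" "card (span B) = card (span I)" using assms card_span by simp_all
  show "span B \<subseteq> span I" using assms(5) by (simp add: span_minimal)
qed

definition cone :: "'b set \<Rightarrow> 'b set" where
  "cone A = insert 0 {c *s a | c a. a \<in> A}"

lemma cone_image: "cone A = insert 0 ((\<lambda>(c, a). c *s a) ` ((UNIV - {0}) \<times> A))"
  unfolding cone_def by (auto simp: image_iff)

lemma conic_cone: "conic (cone A)"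
  unfolding conic_def cone_def by (auto intro: exI[of _ "_ * _"])

lemma cone_superset: "A \<subseteq> cone A"
  unfolding cone_def by (auto intro: exI[of _ 1])

lemma coneE:
  assumes "v \<in> cone A" "v \<noteq> 0"
  obtains c a where "a \<in> A" "c \<noteq> 0" "v = c *s a"
  using assms unfolding cone_def by auto

lemma cone_subset_span: "cone A \<subseteq> span A"
  unfolding cone_def by (auto intro: span_zero span_scale span_base)

lemma finite_cone: "finite A \<Longrightarrow> finite (cone A)"
  unfolding cone_image by simp

lemma card_cone_le: "finite A \<Longrightarrow> card (cone A) \<le> 1 + card A * (CARD('f) - 1)"
proof -
  assume A: "finite A"
  let ?f = "\<lambda>(c::'f, a). c *s a"
  have "card (?f ` ((UNIV - {0}) \<times> A)) \<le> card ((UNIV - {0 :: 'f}) \<times> A)"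
    using A by (intro card_image_le) simp
  also have "\<dots> = card A * (CARD('f) - 1)" by (simp add: card_cartesian_product card_Diff_singleton)
  finally show ?thesis unfolding cone_image using A by (simp add: card_insert_if)
qed

text \<open>Corresponds to simplicity of the matroid, for an injective representation.\<close>

definition nonparallel :: "'b set \<Rightarrow> bool" where
  "nonparallel A \<longleftrightarrow> 0 \<notin> A \<and> (\<forall>a\<in>A. \<forall>b\<in>A. \<forall>c. a = c *s b \<longrightarrow> a = b)"

lemma nonparallelD: "nonparallel A \<Longrightarrow> a \<in> A \<Longrightarrow> b \<in> A \<Longrightarrow> a = c *s b \<Longrightarrow> a = b"
  by (auto simp: nonparallel_def)

lemma nonparallel_scaled:
  assumes "nonparallel A" "a \<in> A" "b \<in> A" "c *s a = d *s b" "c \<noteq> 0"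
  shows "a = b" and "c = d"
proof -
  have "a = inverse c *s c *s a" using assms(5) by simp
  also have "\<dots> = (inverse c * d) *s b" by (simp add: assms(4))
  finally show "a = b" by (rule nonparallelD[OF assms(1-3)])
  then have "c *s b = d *s b" using assms(4) by simp
  moreover have "b \<noteq> 0" using assms(1,3) unfolding nonparallel_def by blast
  ultimately show "c = d" using scale_cancel_right by blast
qed

lemma card_cone:
  assumes "finite A" "nonparallel A"
  shows "card (cone A) = 1 + card A * (CARD('f) - 1)"
proof -
  let ?f = "\<lambda>(c::'f, a). c *s a"
  have inj: "inj_on ?f ((UNIV - {0}) \<times> A)"
  proof (rule inj_onI)
    fix u v assume uv: "u \<in> (UNIV - {0}) \<times> A" "v \<in> (UNIV - {0}) \<times> A" "?f u = ?f v"
    obtain c a d b where ca: "u = (c, a)" "v = (d, b)" by (metis surj_pair)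
    then have h: "a \<in> A" "b \<in> A" "c *s a = d *s b" "c \<noteq> 0" using uv by auto
    show "u = v" using nonparallel_scaled[OF assms(2) h] ca by simp
  qed
  have "0 \<notin> ?f ` ((UNIV - {0}) \<times> A)" using assms(2) by (auto simp: nonparallel_def)
  then have "card (cone A) = 1 + card (?f ` ((UNIV - {0}) \<times> A))"
    unfolding cone_image using assms(1) by simp
  also have "card (?f ` ((UNIV - {0}) \<times> A)) = card A * (CARD('f) - 1)"
    using card_image[OF inj] by (simp add: card_cartesian_product card_Diff_singleton)
  finally show ?thesis .
qed

text \<open>Both sides say that \<open>I\<close> is independent and that \<open>span I\<close> meets
  the kernel \<open>span B\<close> only in 0.\<close>

lemma independent_contract_iff:
  assumes f: "Vector_Spaces.linear scale scale f" and ker: "\<And>v. f v = 0 \<longleftrightarrow> v \<in> span B"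
    and B: "finite B" "independent B" and I: "finite I" "I \<inter> B = {}"
  shows "independent (I \<union> B) \<longleftrightarrow> inj_on f I \<and> independent (f ` I)"
proof
  assume ind: "independent (I \<union> B)"
  have zero: "v = 0" if v: "v \<in> span I" "f v = 0" for v
  proof -
    obtain u where u: "v = comb I u" using span_finite_comb[OF I(1) v(1)] by blast
    obtain w where w: "v = comb B w" using span_finite_comb[OF B(1)] v(2) ker by blast
    let ?g = "\<lambda>x. if x \<in> I then u x else - w x"
    have "comb (I \<union> B) ?g = comb I ?g + comb B ?g"
      unfolding comb_def by (rule sum.union_disjoint[OF I(1) B(1) I(2)])
    also have "comb I ?g = v" unfolding u comb_def by (rule sum.cong) auto
    also have "comb B ?g = - v"
      unfolding w comb_def sum_negf[symmetric] using I(2) by (intro sum.cong) auto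
    finally have "comb (I \<union> B) ?g = comb (I \<union> B) (\<lambda>_. 0)" by (simp add: comb_def)
    then have "?g x = 0" if "x \<in> I" for x
      using comb_independent[of "I \<union> B" ?g "\<lambda>_. 0" x] ind I(1) B(1) that by blast
    then show "v = 0" unfolding u comb_def by (intro sum.neutral) auto
  qed
  have "inj_on f (span I)"
  proof (rule inj_onI)
    fix x y assume "x \<in> span I" "y \<in> span I" "f x = f y"
    then have "x - y \<in> span I" "f (x - y) = 0" by (auto simp: span_diff endo.linear_diff[OF f])
    then have "x - y = 0" by (rule zero)
    then show "x = y" by simp
  qed
  moreover have "independent I" using ind independent_mono by blast
  ultimately show "inj_on f I \<and> independent (f ` I)"
    using endo.linear_independent_injective_image[OF f] inj_on_subset span_superset by blast
next
  assume A: "inj_on f I \<and> independent (f ` I)"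
  have fin: "finite (I \<union> B)" using I B by simp
  show "independent (I \<union> B)"
  proof
    assume "dependent (I \<union> B)"
    then obtain u where u: "comb (I \<union> B) u = 0" "\<exists>v\<in>I \<union> B. u v \<noteq> 0"
      using not_independent_comb[OF fin] by blast
    have split: "comb (I \<union> B) u = comb I u + comb B u"
      unfolding comb_def by (rule sum.union_disjoint[OF I(1) B(1) I(2)])
    have "f (comb B u) = 0" using ker comb_span by blast
    then have "f (comb I u) = 0"
      using u(1) split endo.linear_0[OF f] by (metis add_0_right endo.linear_add[OF f])
    moreover have "inj_on f (span I)"
      using endo.linear_inj_on_span_iff_independent_image[OF f] A by blast
    ultimately have "comb I u = 0"
      using endo.linear_0[OF f] comb_span span_zero by (metis inj_onD)
    moreover have "independent I" using independent_inj_image_imp[OF f I(1)] A by blast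
    moreover have "comb X (\<lambda>_. 0) = 0" for X by (simp add: comb_def)
    ultimately have "u v = 0" if "v \<in> I" for v
      using comb_independent[OF I(1), of u "\<lambda>_. 0"] that by simp
    moreover have "comb B u = 0" using u(1) split \<open>comb I u = 0\<close> by simp
    then have "u v = 0" if "v \<in> B" for v
      using comb_independent[OF B, of u "\<lambda>_. 0"] that \<open>\<And>X. comb X (\<lambda>_. 0) = 0\<close> by simp
    ultimately show False using u(2) by blast
  qed
qed

text \<open>The matroid of an arc is the uniform matroid \<open>U\<^bsub>r,n\<^esub>\<close> with \<open>n = card A\<close>.\<close>

definition arc :: "nat \<Rightarrow> 'b set \<Rightarrow> bool" where
  "arc r A \<longleftrightarrow> finite A \<and> r \<le> card A \<and> (\<forall>B\<subseteq>A. card B = r \<longrightarrow> independent B \<and> A \<subseteq> span B)"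

section \<open>Contraction of arcs and bounds on their size and rank\<close>

lemma arc_independent:
  assumes "arc r A" "B \<subseteq> A" "card B \<le> r"
  shows "independent B"
proof -
  obtain D where "B \<subseteq> D" "D \<subseteq> A" "card D = r"
    using exists_subset_between[of B r A] assms unfolding arc_def by blast
  then show ?thesis using assms(1) independent_mono unfolding arc_def by blast
qed

lemma arc_nonparallel:
  assumes "arc r A" "2 \<le> r"
  shows "nonparallel A"
proof -
  have "a \<noteq> 0" if "a \<in> A" for a
    using arc_independent[OF assms(1), of "{a}"] that assms(2) by simp
  moreover have "a = b" if "a \<in> A" "b \<in> A" "a = c *s b" for a b c
  proof (rule ccontr)
    assume "a \<noteq> b"
    then have "independent {b, a}" using arc_independent[OF assms(1), of "{b, a}"] that assms(2) by simp
    moreover have "a \<in> span {b}" using that(3) by (simp add: span_base span_scale)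
    ultimately show False using independent_pair_iff \<open>a \<noteq> b\<close> by metis
  qed
  ultimately show ?thesis unfolding nonparallel_def by blast
qed

text \<open>Contracting \<open>t\<close> elements of \<open>U_{r,n}\<close> gives
  \<open>U_{r-t,n-t}\<close>. The bound on \<open>card C\<close> leaves rank at least 2, so that
  distinct points do not become parallel.\<close>

lemma arc_contract:
  assumes A: "arc r A" and C: "C \<subseteq> A" "card C + 2 \<le> r"
    and f: "Vector_Spaces.linear scale scale f" and ker: "\<And>v. f v = 0 \<longleftrightarrow> v \<in> span C"
  shows "inj_on f (A - C)" and "arc (r - card C) (f ` (A - C))"
proof -
  have fin: "finite A" "finite C" using A C finite_subset unfolding arc_def by blast+
  have indC: "independent C" using arc_independent[OF A C(1)] C(2) by simp
  have iff: "independent (D \<union> C) \<longleftrightarrow> inj_on f D \<and> independent (f ` D)" if "D \<subseteq> A - C" for D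
    by (rule independent_contract_iff[OF f ker fin(2) indC]) (use that fin finite_subset in blast)+
  have card: "card (D \<union> C) = card D + card C" if "D \<subseteq> A - C" for D
    by (rule card_Un_disjoint) (use that fin finite_subset in blast)+
  show inj: "inj_on f (A - C)"
  proof (rule inj_onI, rule ccontr)
    fix a b assume ab: "a \<in> A - C" "b \<in> A - C" "f a = f b" "a \<noteq> b"
    have "card ({a, b} \<union> C) \<le> r" using card[of "{a, b}"] ab C(2) by simp
    then have "independent ({a, b} \<union> C)" using arc_independent[OF A, of "{a, b} \<union> C"] ab C(1) by blast
    then have "inj_on f {a, b}" using iff[of "{a, b}"] ab by blast
    then show False using ab by simp
  qed
  show "arc (r - card C) (f ` (A - C))" unfolding arc_def
  proof (intro conjI allI impI)
    show "finite (f ` (A - C))" using fin by simp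
    show "r - card C \<le> card (f ` (A - C))"
      using A C fin unfolding arc_def by (simp add: card_image[OF inj] card_Diff_subset diff_le_mono)
  next
    fix B assume B: "B \<subseteq> f ` (A - C)" "card B = r - card C"
    obtain D where D: "D \<subseteq> A - C" "B = f ` D" using B(1) by (metis subset_imageE)
    have injD: "inj_on f D" using inj D(1) inj_on_subset by blast
    have "card (D \<union> C) = r" using card[OF D(1)] B(2) D(2) C(2) card_image[OF injD] by simp
    then have *: "independent (D \<union> C)" "A \<subseteq> span (D \<union> C)"
      using A D(1) C(1) unfolding arc_def by (metis Diff_subset Un_least subset_trans)+
    then show "independent B" using iff[OF D(1)] D(2) by blast
    have fC: "f ` C \<subseteq> {0}" using ker span_base by blast
    have "f ` (A - C) \<subseteq> f ` span (D \<union> C)" using *(2) by blast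
    also have "\<dots> = span (f ` D \<union> f ` C)" by (simp add: endo.linear_span_image[OF f, symmetric] image_Un)
    also have "\<dots> \<subseteq> span B"
      using fC span_superset[of B] span_zero[of B] D(2) by (intro span_minimal) auto
    finally show "f ` (A - C) \<subseteq> span B" .
  qed
qed

text \<open>The span has \<open>q^2 = 1 + (q + 1) (q - 1)\<close> vectors, and each point accounts
  for \<open>q - 1\<close> nonzero ones; so \<open>q + 1\<close> points exhaust it.\<close>

lemma arc_2:
  assumes A: "arc 2 A"
  shows "card A \<le> CARD('f) + 1" and "card A = CARD('f) + 1 \<Longrightarrow> span A = cone A"
proof -
  have fin: "finite A" using A by (simp add: arc_def)
  obtain B where B: "B \<subseteq> A" "card B = 2"
    using A obtain_subset_with_card_n unfolding arc_def by metis
  have finB: "finite B" using B(1) fin finite_subset by blast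
  have indB: "independent B" "A \<subseteq> span B" using A B unfolding arc_def by blast+
  have span: "span A = span B"
    using indB(2) B(1) by (simp add: span_minimal span_mono subset_antisym)
  have cs: "card (span A) = CARD('f) * CARD('f)" "finite (span A)"
    using card_span[OF finB indB(1)] B(2) span by (simp_all add: power2_eq_square)
  have cc: "card (cone A) = 1 + card A * (CARD('f) - 1)"
    by (rule card_cone[OF fin arc_nonparallel[OF A order_refl]])
  have "card (cone A) \<le> card (span A)" by (rule card_mono[OF cs(2) cone_subset_span])
  then have *: "1 + card A * (CARD('f) - 1) \<le> CARD('f) * CARD('f)" using cs cc by simp
  obtain p where p: "CARD('f) = Suc (Suc p)" using q_ge_2 by (metis Suc_le_D numeral_2_eq_2 le_add_diff_inverse add_2_eq_Suc)
  have "CARD('f) * CARD('f) = 1 + (CARD('f) + 1) * (CARD('f) - 1)" unfolding p by simp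
  then have "card A * (CARD('f) - 1) \<le> (CARD('f) + 1) * (CARD('f) - 1)" using * by linarith
  moreover have "0 < CARD('f) - 1" unfolding p by simp
  ultimately show "card A \<le> CARD('f) + 1" using mult_le_cancel2 by blast
  assume "card A = CARD('f) + 1"
  then have "card (cone A) = card (span A)" using cs cc \<open>CARD('f) * CARD('f) = 1 + (CARD('f) + 1) * (CARD('f) - 1)\<close> by simp
  then show "span A = cone A" using card_subset_eq[OF cs(2) cone_subset_span] by simp
qed

text \<open>After contraction of \<open>r - 2\<close> points the arc lies on a projective line,
  which has \<open>q + 1\<close> points.\<close>

lemma arc_card_le:
  assumes A: "arc r A" "2 \<le> r"
  shows "card A + 1 \<le> CARD('f) + r"
proof -
  have fin: "finite A" "r \<le> card A" using A by (auto simp: arc_def)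
  obtain C where C: "C \<subseteq> A" "card C = r - 2" "finite C"
    using obtain_subset_with_card_n[OF le_trans[OF diff_le_self fin(2)]] by blast
  obtain f where f: "Vector_Spaces.linear scale scale f" "\<And>v. f v = 0 \<longleftrightarrow> v \<in> span C"
    using ex_linear_kernel[OF subspace_span] by blast
  have "card C + 2 \<le> r" using C(2) A(2) by simp
  note c = arc_contract[OF A(1) C(1) this f]
  have "arc 2 (f ` (A - C))" using c(2) C(2) A(2) by simp
  then have "card (f ` (A - C)) \<le> CARD('f) + 1" by (rule arc_2(1))
  then have "card A - card C \<le> CARD('f) + 1" using card_image[OF c(1)] C by (simp add: card_Diff_subset)
  then show ?thesis using C(2) A(2) by linarith
qed

text \<open>The quotients of the coordinates of two points of the arc with respect to a basis consisting of
  further points are distinct and nonzero.\<close>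

lemma arc_rank_le:
  assumes A: "arc r A" and n: "r + 2 \<le> card A" and r: "2 \<le> r"
  shows "r + 1 \<le> CARD('f)"
proof -
  have fin: "finite A" "r \<le> card A" using A by (auto simp: arc_def)
  obtain B where B: "B \<subseteq> A" "card B = r" "finite B" using obtain_subset_with_card_n[OF fin(2)] by blast
  have indB: "independent B" "A \<subseteq> span B" using A B unfolding arc_def by blast+
  have "2 \<le> card (A - B)" using n B fin by (simp add: card_Diff_subset)
  then obtain P where P: "P \<subseteq> A - B" "card P = 2" using obtain_subset_with_card_n by metis
  then obtain x y where xy: "x \<in> A - B" "y \<in> A - B" "x \<noteq> y" by (auto simp: card_2_iff)
  obtain u where u: "x = comb B u" using span_finite_comb[OF B(3)] indB(2) xy by blast
  obtain w where w: "y = comb B w" using span_finite_comb[OF B(3)] indB(2) xy by blast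
  \<comment> \<open>A vanishing coordinate would place \<open>z\<close> in the span of
    \<open>r - 1\<close> other points of the arc.\<close>
  have nz: "u b \<noteq> 0" if z: "z \<in> A - B" "z = comb B u" and b: "b \<in> B" for z u b
  proof
    assume "u b = 0"
    then have "z = comb (B - {b}) u"
      unfolding z(2) using B(3) by (intro comb_support) auto
    then have "z \<in> span (B - {b})" using comb_span by simp
    moreover have "z \<notin> B - {b}" using z by blast
    moreover have "independent (insert z (B - {b}))"
    proof (rule arc_independent[OF A])
      show "insert z (B - {b}) \<subseteq> A" using z B by blast
      show "card (insert z (B - {b})) \<le> r" using z b B r by simp
    qed
    ultimately show False by (simp add: independent_insert)
  qed
  let ?h = "\<lambda>b. u b / w b"
  have "inj_on ?h B"
  proof (rule inj_onI, rule ccontr)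
    fix b c assume bc: "b \<in> B" "c \<in> B" "?h b = ?h c" "b \<noteq> c"
    let ?D = "B - {b, c}"
    \<comment> \<open>Equal quotients at \<open>b\<close> and \<open>c\<close> let both coordinates
      be eliminated at once, so \<open>x\<close> lies in the span of \<open>y\<close> and the other
      \<open>r - 2\<close> basis points.\<close>
    define k where "k = (\<lambda>v. u v - ?h b * w v)"
    have wnz: "w b \<noteq> 0" "w c \<noteq> 0" using nz[OF xy(2) w] bc by blast+
    have "k b = 0" using wnz by (simp add: k_def)
    moreover have "k c = 0" unfolding k_def bc(3) using wnz by simp
    ultimately have "comb B k = comb ?D k" using B(3) by (intro comb_support) auto
    moreover have "comb B k = x - ?h b *s y" unfolding k_def comb_diff comb_scale u w ..
    ultimately have "x - ?h b *s y \<in> span ?D" using comb_span by metis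
    then have "x \<in> span (insert y ?D)" unfolding span_breakdown_eq by blast
    moreover have "x \<notin> insert y ?D" using xy by blast
    moreover have "independent (insert x (insert y ?D))"
    proof (rule arc_independent[OF A])
      show "insert x (insert y ?D) \<subseteq> A" using xy B by blast
      have "card ?D = r - 2" using B bc by (simp add: card_Diff_subset)
      then show "card (insert x (insert y ?D)) \<le> r" using xy B(3) r by simp
    qed
    ultimately show False by (simp add: independent_insert)
  qed
  moreover have "?h ` B \<subseteq> UNIV - {0}" using nz[OF xy(1) u] nz[OF xy(2) w] by auto
  ultimately have "card B \<le> card (UNIV - {0 :: 'f})" by (intro card_inj_on_le) auto
  then show ?thesis using B(2) q_ge_2 by (simp add: card_Diff_singleton)
qed

text \<open>Projection from the line \<open>ab\<close> maps the other \<open>q + 1\<close> points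
  injectively to a projective line, hence onto it. The image of \<open>w\<close> is therefore the
  image of exactly one of them.\<close>

lemma arc_4_third_point:
  assumes A: "arc 4 A" "card A = CARD('f) + 3" and w: "w \<in> span A" "w \<notin> span {a, b}"
    and ab: "a \<in> A" "b \<in> A" "a \<noteq> b"
  shows "\<exists>c\<in>A - {a, b}. w \<in> span {a, b, c}"
    and "c \<in> A - {a, b} \<Longrightarrow> c' \<in> A - {a, b} \<Longrightarrow> w \<in> span {a, b, c} \<Longrightarrow> w \<in> span {a, b, c'} \<Longrightarrow> c = c'"
proof -
  let ?C = "{a, b}"
  obtain f where f: "Vector_Spaces.linear scale scale f" and ker: "\<And>v. f v = 0 \<longleftrightarrow> v \<in> span ?C"
    using ex_linear_kernel[OF subspace_span] by blast
  have C: "?C \<subseteq> A" "card ?C = 2" using ab by auto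
  then have C4: "card ?C + 2 \<le> 4" by simp
  note c = arc_contract[OF A(1) C(1) C4 f ker]
  let ?A = "f ` (A - ?C)"
  have arc: "arc 2 ?A" using c(2) C(2) by simp
  have "finite A" using A by (simp add: arc_def)
  then have "card ?A = CARD('f) + 1" using card_image[OF c(1)] A(2) C by (simp add: card_Diff_subset)
  then have cone: "span ?A = cone ?A" by (rule arc_2(2)[OF arc])
  have f0: "f w \<noteq> 0" using w(2) ker by blast
  have lift: "w \<in> span {a, b, c} \<longleftrightarrow> (\<exists>k. f w = k *s f c)" for c
  proof -
    have "w \<in> span {a, b, c} \<longleftrightarrow> (\<exists>k. w - k *s c \<in> span {a, b})"
      using span_breakdown_eq[of w c "{a, b}"] by (simp add: insert_commute)
    then show ?thesis by (simp add: ker[symmetric] endo.linear_diff[OF f] endo.linear_scale[OF f])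
  qed
  have "f w \<in> f ` span A" using w(1) by blast
  also have "f ` span A = span (f ` A)" by (simp add: endo.linear_span_image[OF f])
  also have "f ` A \<subseteq> insert 0 ?A" using ker span_base by blast
  then have "span (f ` A) \<subseteq> span ?A" by (metis span_insert_0 span_mono)
  finally have "f w \<in> cone ?A" using cone by simp
  then obtain k e where "e \<in> A - ?C" "f w = k *s f e" using f0 by (elim coneE) auto
  then show "\<exists>c\<in>A - {a, b}. w \<in> span {a, b, c}" using lift by blast
  assume cc: "c \<in> A - {a, b}" "c' \<in> A - {a, b}" "w \<in> span {a, b, c}" "w \<in> span {a, b, c'}"
  obtain k k' where k: "f w = k *s f c" "f w = k' *s f c'" using cc lift by blast
  have "k \<noteq> 0" using k f0 by auto
  have "f c = f c'"
    by (rule nonparallel_scaled(1)[OF arc_nonparallel[OF arc order_refl], of _ _ k k'])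
      (use cc k \<open>k \<noteq> 0\<close> in auto)
  then show "c = c'" using c(1) cc by (meson inj_onD)
qed

text \<open>The blocks are the triples of \<open>V\<close> whose span contains \<open>w\<close>. The
  unique third point completing a pair lies in \<open>V\<close> by \<open>closed\<close>.\<close>

lemma arc_4_steiner:
  assumes A: "arc 4 A" "card A = CARD('f) + 3" and w: "w \<in> span A" and V: "V \<subseteq> A" "V \<noteq> {}"
    and sec: "\<And>a b. a \<in> V \<Longrightarrow> b \<in> V \<Longrightarrow> a \<noteq> b \<Longrightarrow> w \<notin> span {a, b}"
    and closed: "\<And>a b c. a \<in> V \<Longrightarrow> b \<in> V \<Longrightarrow> a \<noteq> b \<Longrightarrow> c \<in> A - V \<Longrightarrow> w \<notin> span {a, b, c}"
  shows "odd (card V)" and "6 dvd card V * (card V - 1)"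
proof -
  let ?R = "{T. T \<subseteq> V \<and> card T = 3 \<and> w \<in> span T}"
  have finV: "finite V" using A V finite_subset unfolding arc_def by blast
  have third: "\<exists>c\<in>V - {a, b}. w \<in> span {a, b, c}" if "a \<in> V" "b \<in> V" "a \<noteq> b" for a b
    using arc_4_third_point(1)[OF A w sec[OF that]] closed[OF that] that V by blast
  have ex: "\<exists>T\<in>?R. a \<in> T \<and> b \<in> T" if ab: "a \<in> V" "b \<in> V" "a \<noteq> b" for a b
  proof -
    obtain c where "c \<in> V - {a, b}" "w \<in> span {a, b, c}" using third[OF ab] by blast
    then show ?thesis using ab by (intro bexI[of _ "{a, b, c}"]) auto
  qed
  have uniq: "T = T'" if ab: "a \<noteq> b" and T: "T \<in> ?R" "T' \<in> ?R" "{a, b} \<subseteq> T" "{a, b} \<subseteq> T'" for a b T T'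
  proof -
    have split: "\<exists>c\<in>V - {a, b}. T = {a, b, c}" if "T \<in> ?R" "{a, b} \<subseteq> T" for T
    proof -
      have finT: "finite T" using that finV finite_subset by blast
      have "card (T - {a, b}) = 1" using that ab by (subst card_Diff_subset) auto
      then obtain c where c: "T - {a, b} = {c}" by (rule card_1_singletonE)
      then have "T = {a, b, c}" using \<open>{a, b} \<subseteq> T\<close> by (metis Diff_partition Un_insert_left sup_bot_left)
      moreover have "c \<in> V - {a, b}" using that(1) c by blast
      ultimately show ?thesis by blast
    qed
    obtain c where c: "c \<in> V - {a, b}" "T = {a, b, c}" using split[OF T(1,3)] by blast
    obtain c' where c': "c' \<in> V - {a, b}" "T' = {a, b, c'}" using split[OF T(2,4)] by blast
    have abV: "a \<in> V" "b \<in> V" using T by auto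
    have "c = c'"
      by (rule arc_4_third_point(2)[OF A w sec[OF abV ab]]) (use c c' T abV ab V in auto)
    then show ?thesis using c c' by simp
  qed
  show "odd (card V)"
    by (rule steiner_triple_system(1)[OF finV V(2) _ ex uniq]) auto
  show "6 dvd card V * (card V - 1)"
    by (rule steiner_triple_system(2)[OF finV V(2) _ ex uniq]) auto
qed

text \<open>Over a field of even order there are \<open>(q + 2)\<close>-arcs in the plane, but no \<open>(q + 3)\<close>-arcs in
  three-space: the planes through a point on a secant form a Steiner triple system on \<open>q + 1\<close>
  points, those through a point on no secant one on \<open>q + 3\<close> points, which forces \<open>6 dvd q\<close>.\<close>

lemma no_arc_4:
  assumes pp: "primepow CARD('f)" and q2: "2 < CARD('f)" and A: "arc 4 A" "card A = CARD('f) + 3"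
  shows False
proof -
  let ?q = "CARD('f)"
  have fin: "finite A" using A by (simp add: arc_def)
  have q5: "5 \<le> ?q" using arc_rank_le[OF A(1)] A(2) q2 by simp
  have ind: "independent D" if "D \<subseteq> A" "card D \<le> 4" for D
    using arc_independent[OF A(1) that] .
  have not_span: "d \<notin> span {a, b, c}" if d: "d \<in> A" "a \<in> A" "b \<in> A" "c \<in> A" "d \<noteq> a" "d \<noteq> b" "d \<noteq> c" for a b c d
  proof -
    have "card {d, a, b, c} \<le> 4" using card_insert_le_m1 by (simp add: card_insert_if)
    then have "independent (insert d {a, b, c})" using ind[of "{d, a, b, c}"] d by simp
    then show ?thesis using d by (subst (asm) independent_insert) auto
  qed
  obtain B where B: "B \<subseteq> A" "card B = 2"
    using obtain_subset_with_card_n[of 2 A] A(2) by auto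
  then obtain a0 b0 where ab0: "a0 \<in> A" "b0 \<in> A" "a0 \<noteq> b0" by (auto simp: card_2_iff)
  let ?w = "a0 + b0" and ?V = "A - {a0, b0}"
  have w: "?w \<in> span A" using ab0 by (intro span_add span_base)
  have cV: "card ?V = ?q + 1" using ab0 A(2) fin by (simp add: card_Diff_subset)
  \<comment> \<open>A subspace containing \<open>?w\<close> and one of \<open>a0\<close>,
    \<open>b0\<close> contains the other as well, which the independence of any four points of the
    arc excludes.\<close>
  have offV: "?w \<notin> span {a, b, c}" if "a \<in> ?V" "b \<in> ?V" "c \<in> {a0, b0}" for a b c
  proof
    assume "?w \<in> span {a, b, c}"
    moreover have "c \<in> span {a, b, c}" by (rule span_base) simp
    ultimately have "?w - c \<in> span {a, b, c}" by (rule span_diff)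
    moreover have "?w - c = (if c = a0 then b0 else a0)" using that(3) by auto
    ultimately show False
      using not_span[of b0 a b a0] not_span[of a0 a b b0] that ab0 by (auto split: if_splits)
  qed
  have sts1: "odd (card ?V)" "6 dvd card ?V * (card ?V - 1)"
  proof -
    have ne: "?V \<noteq> {}" using cV by (metis card.empty add_is_0 one_neq_zero)
    have sec: "?w \<notin> span {a, b}" if "a \<in> ?V" "b \<in> ?V" "a \<noteq> b" for a b
      using offV[OF that(1,2), of a0] span_mono[of "{a, b}" "{a, b, a0}"] by blast
    have cl: "?w \<notin> span {a, b, c}" if "a \<in> ?V" "b \<in> ?V" "a \<noteq> b" "c \<in> A - ?V" for a b c
      using offV[OF that(1,2), of c] that(4) by blast
    show "odd (card ?V)" by (rule arc_4_steiner(1)[OF A w Diff_subset ne sec cl])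
    show "6 dvd card ?V * (card ?V - 1)" by (rule arc_4_steiner(2)[OF A w Diff_subset ne sec cl])
  qed
  have even: "even ?q" using sts1(1) cV by simp
  obtain p k where pk: "prime p" "?q = p ^ k" using pp unfolding primepow_def by blast
  have "p = 2" using even pk primes_dvd_imp_eq[of 2 p] prime_dvd_power[of 2 p k] by simp
  then have q2k: "?q = 2 ^ k" using pk by simp
  have "3 \<le> k"
  proof (rule ccontr)
    assume "\<not> 3 \<le> k"
    then have "(2::nat) ^ k \<le> 2 ^ 2" by (intro power_increasing) auto
    then show False using q5 q2k by simp
  qed
  then have "(2::nat) ^ 3 \<le> 2 ^ k" by (intro power_increasing) auto
  \<comment> \<open>The inequality \<open>(q + 3) (q + 2) < 2 q^2\<close>, by which the secants
    leave a point uncovered, holds from 7 on and fails for 6.\<close>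
  then have "7 \<le> ?q" using q2k by simp
  then obtain m where m: "?q = 7 + m" using le_Suc_ex by blast
  obtain D where D: "D \<subseteq> A" "card D = 4" "finite D"
    using obtain_subset_with_card_n[of 4 A] A(2) q2 by auto
  have "A \<subseteq> span D" "independent D" using A D unfolding arc_def by blast+
  then have "span A = span D" using D(1) by (simp add: span_minimal span_mono subset_antisym)
  then have cA: "card (span A) = ?q ^ 4" "finite (span A)"
    using card_span[OF D(3) \<open>independent D\<close>] D(2) by simp_all
  let ?P = "{B. B \<subseteq> A \<and> card B = 2}"
  have finP: "finite ?P" using fin by simp
  have "card (\<Union>B\<in>?P. span B) \<le> (\<Sum>B\<in>?P. card (span B))" by (rule card_UN_le[OF finP])
  also have "\<dots> = (\<Sum>B\<in>?P. ?q ^ 2)"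
  proof (rule sum.cong)
    fix B assume "B \<in> ?P"
    then show "card (span B) = ?q ^ 2"
      using card_span(2)[of B] ind[of B] fin finite_subset[of B A] by simp
  qed simp
  also have "\<dots> = ((?q + 3) choose 2) * ?q ^ 2" using n_subsets[OF fin] A(2) by simp
  also have "\<dots> < ?q ^ 2 * ?q ^ 2"
  proof -
    have "2 * ((?q + 3) choose 2) \<le> (?q + 3) * (?q + 2)" by (simp add: choose_two)
    also have "\<dots> < 2 * (?q * ?q)" unfolding m by (simp add: algebra_simps)
    finally show ?thesis using q2 by (simp add: power2_eq_square)
  qed
  also have "\<dots> = card (span A)" using cA by (simp flip: power_add)
  finally have less: "card (\<Union>B\<in>?P. span B) < card (span A)" .
  have "finite (\<Union>B\<in>?P. span B)"
  proof (rule finite_UN_I[OF finP])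
    fix B assume "B \<in> ?P"
    then show "finite (span B)" using card_span(1)[of B] ind[of B] fin finite_subset[of B A] by simp
  qed
  then have "\<not> span A \<subseteq> (\<Union>B\<in>?P. span B)" using card_mono less by (metis leD)
  then obtain v where v: "v \<in> span A" "\<And>B. B \<in> ?P \<Longrightarrow> v \<notin> span B" by blast
  have "6 dvd card A * (card A - 1)"
  proof (rule arc_4_steiner(2)[OF A v(1) subset_refl])
    show "A \<noteq> {}" using ab0 by blast
    show "v \<notin> span {a, b}" if "a \<in> A" "b \<in> A" "a \<noteq> b" for a b
      using v(2)[of "{a, b}"] that by simp
  qed simp
  moreover have p3: "prime (3::nat)" by simp
  have d36: "3 dvd m" if "6 dvd m" for m :: nat using that by presburger
  have cA1: "card A - 1 = ?q + 2" using A(2) by simp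
  \<comment> \<open>Modulo 3, the system on \<open>q + 1\<close> points excludes the residue 1 of
    \<open>q\<close>, and the one on \<open>q + 3\<close> points the residue 2; so 3 would divide a
    power of 2.\<close>
  ultimately have "3 dvd (?q + 3) * (?q + 2)" using d36 A(2) by metis
  then have "3 dvd ?q + 3 \<or> 3 dvd ?q + 2" by (rule prime_dvd_multD[OF p3])
  moreover have "3 dvd (?q + 1) * ?q" using d36[OF sts1(2)] cV by simp
  then have "3 dvd ?q + 1 \<or> 3 dvd ?q" by (rule prime_dvd_multD[OF p3])
  ultimately have "3 dvd ?q" by presburger
  then have "3 dvd (2::nat)" using q2k prime_dvd_power[OF p3, of 2 k] by metis
  then show False by simp
qed

text \<open>Only the extremal case \<open>card A = q + r - 1\<close> needs more than the two bounds:
  for \<open>r \<ge> 4\<close>, contracting \<open>r - 4\<close> points produces the impossible arc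
  of rank 4 with \<open>q + 3\<close> points.\<close>

lemma arc_parameters:
  assumes pp: "primepow CARD('f)" and q2: "2 < CARD('f)" and A: "arc r A" "2 \<le> r" "r < card A"
    and not: "\<not> (r = 2 \<and> card A = CARD('f) + 1)"
  shows "card A = r + 1 \<or> (r = 3 \<and> card A = CARD('f) + 2) \<or>
    (\<exists>k t. 4 \<le> k \<and> k \<le> CARD('f) \<and> t \<le> CARD('f) - 3 \<and> r = 2 + t \<and> card A = k + t)"
proof (cases "card A = r + 1")
  case False
  then have n: "r + 2 \<le> card A" using A(3) by simp
  have le: "card A + 1 \<le> CARD('f) + r" "r + 1 \<le> CARD('f)"
    using arc_card_le[OF A(1,2)] arc_rank_le[OF A(1) n A(2)] by auto
  show ?thesis
  proof (cases "card A + 1 = CARD('f) + r")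
    case False
    then have "4 \<le> card A - (r - 2)" "card A - (r - 2) \<le> CARD('f)" "r - 2 \<le> CARD('f) - 3"
      "r = 2 + (r - 2)" "card A = (card A - (r - 2)) + (r - 2)"
      using le n A(2) by linarith+
    then show ?thesis by blast
  next
    case True
    have "r < 4"
    proof (rule ccontr)
      assume "\<not> r < 4"
      then have r: "4 \<le> r" by simp
      have fin: "finite A" "r \<le> card A" using A by (auto simp: arc_def)
      obtain C where C: "C \<subseteq> A" "card C = r - 4" "finite C"
        using obtain_subset_with_card_n[OF le_trans[OF diff_le_self fin(2)]] by blast
      obtain f where f: "Vector_Spaces.linear scale scale f" "\<And>v. f v = 0 \<longleftrightarrow> v \<in> span C"
        using ex_linear_kernel[OF subspace_span] by blast
      have "card C + 2 \<le> r" using C(2) A(2) r by simp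
      note c = arc_contract[OF A(1) C(1) this f]
      have "arc 4 (f ` (A - C))" using c(2) C(2) r by simp
      moreover have "card (f ` (A - C)) = CARD('f) + 3"
        using card_image[OF c(1)] C True r by (simp add: card_Diff_subset)
      ultimately show False using no_arc_4[OF pp q2] by blast
    qed
    then have "r = 2 \<or> r = 3" using A(2) by linarith
    then show ?thesis using True not by auto
  qed
qed simp

text \<open>The flat spanned by a minimal chordless circuit is not uniform, so it contains a shorter circuit and
  thus a full line. A point of this line with a vanishing coefficient in the basis \<open>I\<close> is
  parallel to an element of \<open>I\<close>, again by minimality. This puts two elements of \<open>I\<close> on the line.\<close>

theorem flats_has_chords:
  assumes A: "finite A" "nonparallel A"
    and flats: "\<And>W r. subspace W \<Longrightarrow> arc r (A \<inter> W) \<Longrightarrow> 2 \<le> r \<Longrightarrow> r < card (A \<inter> W) \<Longrightarrow>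
      r = 2 \<and> card (A \<inter> W) = CARD('f) + 1"
  shows "has_chords (cone A)"
proof -
  let ?S = "cone A"
  have "chorded ?S I" if "I \<subseteq> ?S" "finite I" "independent I" "2 \<le> card I" "\<Sum>I \<in> ?S" for I
    using that
  proof (induction "card I" arbitrary: I rule: less_induct)
    case (less I)
    note I = less.prems
    let ?z = "\<Sum>I" and ?W = "span I" and ?r = "card I"
    let ?A = "A \<inter> ?W"
    show ?case
    proof (rule ccontr)
      assume edgeless: "\<not> chorded ?S I"
      have relation: "chorded ?S J"
        if "J \<subseteq> ?S" "finite J" "independent J" "2 \<le> card J" "card J < card I"
          "\<And>j. j \<in> J \<Longrightarrow> c j \<noteq> 0" "comb J c \<in> ?S" for J c
        by (rule chorded_relation[OF conic_cone that(1-3,6)])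
          (use that less.hyps in \<open>auto simp: comb_def\<close>)
      have z: "?z = comb I (\<lambda>_. 1)" by (simp add: comb_def)
      have zW: "?z \<in> ?W" unfolding z by (rule comb_span)
      have not_mult: "?z \<noteq> c *s i" if "i \<in> I" for c i
      proof
        assume "?z = c *s i"
        then have eq: "comb I (\<lambda>_. 1) = comb I (\<lambda>v. if v = i then c else 0)"
          using z comb_single[OF I(2), of i c] that by simp
        have "card (I - {i}) \<noteq> 0" using I(2,4) that by simp
        then have "I - {i} \<noteq> {}" by (metis card.empty)
        then obtain j where "j \<in> I" "j \<noteq> i" by blast
        then show False using comb_independent[OF I(2,3) eq, of j] by simp
      qed
      have I0: "i \<noteq> 0" if "i \<in> I" for i using I(3) that dependent_zero by blast
      have par: "i = j" if "i \<in> I" "j \<in> I" "i = c *s j" for i j c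
      proof (rule ccontr)
        assume "i \<noteq> j"
        then have "i \<in> span (I - {i})" using that by (simp add: span_base span_scale)
        then show False using I(3) that(1) unfolding dependent_def by blast
      qed
      \<comment> \<open>\<open>Z\<close> is the circuit. Up to scaling its members are distinct
        elements of \<open>A\<close>, so the flat has more elements than its rank.\<close>
      define Z where "Z = insert ?z I"
      have "I \<noteq> {}" using I(4) by auto
      then obtain i0 where "i0 \<in> I" by blast
      have ZW: "Z \<subseteq> ?S" "Z \<subseteq> ?W" using I(1,5) zW span_superset[of I] by (auto simp: Z_def)
      have z0: "?z \<noteq> 0" using not_mult[OF \<open>i0 \<in> I\<close>, of 0] by simp
      then have Z0: "v \<noteq> 0" if "v \<in> Z" for v using that I0 by (auto simp: Z_def)
      have "?z \<notin> I" using not_mult[of ?z 1] by auto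
      then have cardZ: "card Z = card I + 1" using I(2) unfolding Z_def by simp
      have parZ: "v = w" if vw: "v \<in> Z" "w \<in> Z" "v = c *s w" "c \<noteq> 0" for v w c
      proof -
        have w: "w = inverse c *s v" using that by simp
        consider "v = ?z" "w = ?z" | "v = ?z" "w \<in> I" | "v \<in> I" "w = ?z" | "v \<in> I" "w \<in> I"
          using vw(1,2) unfolding Z_def by blast
        then show ?thesis
        proof cases
          case 2
          then show ?thesis using not_mult[of w c] that(3) by simp
        next
          case 3
          then show ?thesis using not_mult[of v "inverse c"] w by simp
        next
          case 4
          then show ?thesis using par[OF _ _ that(3)] by blast
        qed simp
      qed
      have "\<forall>v\<in>Z. \<exists>a. a \<in> A \<and> (\<exists>c. c \<noteq> 0 \<and> v = c *s a)" using ZW(1) Z0 by (metis coneE subsetD)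
      then obtain \<rho> where \<rho>: "\<And>v. v \<in> Z \<Longrightarrow> \<rho> v \<in> A \<and> (\<exists>c. c \<noteq> 0 \<and> v = c *s \<rho> v)" by metis
      have \<rho>W: "\<rho> v \<in> ?A" if vZ: "v \<in> Z" for v
      proof -
        obtain c where c: "c \<noteq> 0" "v = c *s \<rho> v" using \<rho>[OF vZ] by blast
        then have "\<rho> v = inverse c *s v" by (metis scale_scale left_inverse scale_one)
        then have "\<rho> v \<in> ?W" using ZW(2) vZ c span_scale by (metis subsetD)
        then show ?thesis using \<rho>[OF vZ] by blast
      qed
      have "inj_on \<rho> Z"
      proof (rule inj_onI)
        fix v w assume vw: "v \<in> Z" "w \<in> Z" "\<rho> v = \<rho> w"
        obtain c d where cd: "c \<noteq> 0" "v = c *s \<rho> v" "d \<noteq> 0" "w = d *s \<rho> w" using \<rho> vw by blast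
        have "inverse d *s w = \<rho> w" using cd by (metis scale_scale left_inverse scale_one)
        then have "v = (c * inverse d) *s w" using cd(2) vw(3) by (metis scale_scale)
        moreover have "c * inverse d \<noteq> 0" using cd by simp
        ultimately show "v = w" by (rule parZ[OF vw(1,2)])
      qed
      then have cardA: "card I + 1 \<le> card ?A"
        using card_inj_on_le[of \<rho> Z ?A] \<rho>W A(1) cardZ by auto
      \<comment> \<open>A uniform flat would be a full line by assumption and would supply a chord
        of \<open>I\<close>.\<close>
      have "\<not> arc ?r ?A"
      proof
        assume arc: "arc ?r ?A"
        then have r: "?r = 2" "card ?A = CARD('f) + 1"
          using flats[OF subspace_span arc I(4)] cardA by auto
        then have eq: "span ?A = cone ?A" using arc_2(2) arc by simp
        have "cone ?A \<subseteq> ?S" unfolding cone_def by blast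
        moreover have "I \<subseteq> span ?A"
        proof
          fix i assume "i \<in> I"
          then have "i \<in> Z" by (simp add: Z_def)
          then obtain c where "i = c *s \<rho> i" "\<rho> i \<in> ?A" using \<rho> \<rho>W by blast
          then show "i \<in> span ?A" by (metis span_base span_scale)
        qed
        ultimately have "adj ?S x y" if "x \<in> I" "y \<in> I" for x y
          using adj_subspace[OF subspace_span[of ?A], of ?S x y] that eq by auto
        moreover obtain x y where "I = {x, y}" "x \<noteq> y" using r(1) card_2_iff by metis
        ultimately show False using edgeless unfolding chorded_def by blast
      qed
      then obtain B where B: "B \<subseteq> ?A" "card B = ?r" "\<not> (independent B \<and> ?A \<subseteq> span B)"
        using A(1) cardA unfolding arc_def by auto
      have finB: "finite B" using B(1) A(1) finite_subset by blast
      have depB: "dependent B"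
      proof (rule ccontr)
        assume "independent B"
        then have "span B = ?W" using span_eq_of_card[OF finB _ I(2,3)] B by blast
        then show False using B(3) \<open>independent B\<close> by blast
      qed
      \<comment> \<open>A circuit inside the dependent set \<open>B\<close>: an element
        \<open>w\<close> and the support \<open>J\<close> of its expansion in a maximal independent
        subset. As \<open>J\<close> is smaller than \<open>I\<close>, minimality gives a full line
        through two points \<open>x\<close>, \<open>y\<close> of \<open>J\<close>.\<close>
      obtain J0 where J0: "J0 \<subseteq> B" "independent J0" "B \<subseteq> span J0"
        using maximal_independent_subset by blast
      have finJ0: "finite J0" using J0(1) finB finite_subset by blast
      have "J0 \<noteq> B" using J0(2) depB by metis
      then obtain w where w: "w \<in> B" "w \<notin> J0" using J0(1) by blast
      obtain c where c: "w = comb J0 c" using span_finite_comb[OF finJ0] J0(3) w(1) by blast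
      define J where "J = {j \<in> J0. c j \<noteq> 0}"
      have wJ: "w = comb J c" unfolding c by (rule comb_support[OF finJ0]) (auto simp: J_def)
      have finJ: "finite J" using finJ0 by (simp add: J_def)
      have JA: "J \<subseteq> ?A" using J0(1) B(1) by (auto simp: J_def)
      have w0: "w \<noteq> 0" using w(1) B(1) A(2) by (auto simp: nonparallel_def)
      have "card J \<noteq> 0" using wJ w0 finJ by (auto simp: comb_def)
      moreover have "card J \<noteq> 1"
      proof
        assume "card J = 1"
        then obtain j where j: "J = {j}" by (rule card_1_singletonE)
        then have "w = c j *s j" using wJ by (simp add: comb_def)
        then have "w = j" using nonparallelD[OF A(2)] w(1) B(1) JA j by blast
        then show False using w(2) j by (auto simp: J_def)
      qed
      ultimately have J2: "2 \<le> card J" by linarith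
      have "J \<subset> B" using w J0(1) by (auto simp: J_def)
      then have Jr: "card J < card I" using psubset_card_mono[OF finB] B(2) by metis
      have "chorded ?S J"
      proof (rule relation[OF _ finJ _ J2 Jr, of c])
        show "J \<subseteq> ?S" using JA cone_superset by blast
        show "independent J" using J0(2) by (rule independent_mono) (auto simp: J_def)
        show "comb J c \<in> ?S" using wJ w(1) B(1) cone_superset by blast
      qed (simp add: J_def)
      then obtain x y where xy: "x \<in> J" "y \<in> J" "x \<noteq> y" "adj ?S x y" unfolding chorded_def by blast
      have xyW: "x \<in> ?W" "y \<in> ?W" using xy JA by blast+
      \<comment> \<open>The support of such a vector is a proper part of \<open>I\<close>. Two or
        more elements would form a shorter circuit with a chord in \<open>I\<close>, so the vector
        is a multiple of a single \<open>l\<close> different from \<open>i\<close>.\<close>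
      have zero_coefficient: "\<exists>l\<in>I. l \<noteq> i \<and> (\<exists>k. l = k *s comb I u)"
        if u: "comb I u \<in> ?S" "comb I u \<noteq> 0" and i: "i \<in> I" "u i = 0" for u i
      proof -
        define L where "L = {j \<in> I. u j \<noteq> 0}"
        have uL: "comb I u = comb L u" by (rule comb_support[OF I(2)]) (auto simp: L_def)
        have finL: "finite L" using I(2) by (simp add: L_def)
        have LI: "L \<subset> I" using i by (auto simp: L_def)
        have "\<not> 2 \<le> card L"
        proof
          assume "2 \<le> card L"
          have "chorded ?S L"
          proof (rule relation[OF _ finL _ \<open>2 \<le> card L\<close> psubset_card_mono[OF I(2) LI], of u])
            show "L \<subseteq> ?S" using LI I(1) by blast
            show "independent L" using I(3) LI independent_mono by blast
            show "comb L u \<in> ?S" using u(1) uL by simp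
          qed (simp add: L_def)
          then show False using edgeless chorded_mono[OF _ subset_refl psubset_imp_subset[OF LI]] by blast
        qed
        moreover have "card L \<noteq> 0"
        proof
          assume "card L = 0"
          then have "L = {}" using finL by simp
          then show False using u(2) uL by (simp add: comb_def)
        qed
        ultimately have "card L = 1" by linarith
        then obtain l where l: "L = {l}" by (rule card_1_singletonE)
        then have "comb I u = u l *s l" "u l \<noteq> 0" "l \<in> I" using uL by (auto simp: comb_def L_def)
        moreover have "l \<noteq> i" using l i by (auto simp: L_def)
        ultimately show ?thesis by (intro bexI[of _ l] conjI exI[of _ "inverse (u l)"]) auto
      qed
      obtain ux where ux: "x = comb I ux" using span_finite_comb[OF I(2) xyW(1)] by blast
      obtain uy where uy: "y = comb I uy" using span_finite_comb[OF I(2) xyW(2)] by blast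
      have xyA: "x \<in> A" "y \<in> A" using xy(1,2) JA by blast+
      have xy0: "x \<noteq> 0" using xyA(1) A(2) unfolding nonparallel_def by metis
      have ny: "y \<noteq> c *s x" for c
      proof
        assume "y = c *s x"
        then have "y = x" by (rule nonparallelD[OF A(2) xyA(2,1)])
        then show False using xy(3) by simp
      qed
      have on_line: "\<exists>l\<in>I. l \<noteq> i \<and> (\<exists>a b. l = a *s x + b *s y)" if i: "i \<in> I" for i
      proof -
        \<comment> \<open>Some point of the line \<open>xy\<close> has vanishing coordinate at
          \<open>i\<close>.\<close>
        have "\<exists>a b. a * ux i + b * uy i = 0 \<and> (a \<noteq> 0 \<or> b \<noteq> 0)"
        proof (cases "ux i = 0")
          case True
          then show ?thesis by (intro exI[of _ 1] exI[of _ 0]) simp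
        next
          case False
          then show ?thesis by (intro exI[of _ "- uy i"] exI[of _ "ux i"]) simp
        qed
        then obtain a b where ab: "a * ux i + b * uy i = 0" "a \<noteq> 0 \<or> b \<noteq> 0" by blast
        define u where "u = (\<lambda>v. a * ux v + b * uy v)"
        have u: "comb I u = a *s x + b *s y" unfolding u_def comb_add comb_scale ux uy ..
        have "comb I u \<in> ?S" unfolding u using adjD[OF xy(4)] .
        moreover have "comb I u \<noteq> 0"
        proof
          assume "comb I u = 0"
          then have eq: "b *s y = - (a *s x)" unfolding u by (simp add: eq_neg_iff_add_eq_0 add.commute)
          show False
          proof (cases "b = 0")
            case True
            then show False using eq ab(2) xy0 by simp
          next
            case False
            have "y = inverse b *s b *s y" using False by simp
            also have "\<dots> = (inverse b * - a) *s x" unfolding eq by simp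
            finally show False using ny by blast
          qed
        qed
        ultimately obtain l k where l: "l \<in> I" "l \<noteq> i" "l = k *s comb I u"
          using zero_coefficient[of u i] i ab(1) by (auto simp: u_def)
        have "l = (k * a) *s x + (k * b) *s y" unfolding l(3) u by (simp add: scale_right_distrib)
        then show ?thesis using l by blast
      qed
      obtain l where l: "l \<in> I" "\<exists>a b. l = a *s x + b *s y" using on_line[OF \<open>i0 \<in> I\<close>] by blast
      \<comment> \<open>A second application, now eliminating the coordinate at \<open>l\<close>,
        gives another element of \<open>I\<close> on the same line.\<close>
      obtain l' where l': "l' \<in> I" "l' \<noteq> l" "\<exists>a b. l' = a *s x + b *s y" using on_line[OF l(1)] by blast
      have "adj ?S l l'" using l(2) l'(3) adj_comb[OF xy(4)] by blast
      then have "chorded ?S I" unfolding chorded_def using l(1) l'(1,2) by metis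
      then show False using edgeless by blast
    qed
  qed
  then show ?thesis by (simp add: has_chords_def)
qed

text \<open>A dependence expresses a combination of \<open>Q - P\<close> as a vector of both spans,
  hence of \<open>span (P \<inter> Q)\<close>, and independence of \<open>Q\<close> makes it
  trivial. This yields the rank formula for modular flats.\<close>

lemma independent_Un:
  assumes "finite P" "finite Q" "independent P" "independent Q" "span P \<inter> span Q \<subseteq> span (P \<inter> Q)"
  shows "independent (P \<union> Q)"
proof
  assume "dependent (P \<union> Q)"
  then obtain u where u: "comb (P \<union> Q) u = 0" "\<exists>v\<in>P \<union> Q. u v \<noteq> 0"
    using not_independent_comb[of "P \<union> Q"] assms(1,2) by blast
  have zero: "comb X (\<lambda>_. 0) = 0" for X by (simp add: comb_def)
  have "comb (P \<union> (Q - P)) u = comb P u + comb (Q - P) u"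
    unfolding comb_def by (rule sum.union_disjoint) (use assms(1,2) in auto)
  then have eq: "comb (Q - P) u = - comb P u"
    using u(1) by (simp add: eq_neg_iff_add_eq_0 add.commute)
  have "comb (Q - P) u \<in> span P" unfolding eq by (rule span_neg[OF comb_span])
  moreover have "comb (Q - P) u \<in> span Q" using comb_span span_mono[of "Q - P" Q] by blast
  ultimately obtain w where w: "comb (Q - P) u = comb (P \<inter> Q) w"
    using assms(5) span_finite_comb[of "P \<inter> Q"] assms(1) by blast
  let ?g = "\<lambda>v. if v \<in> P then - w v else u v"
  have "comb ((P \<inter> Q) \<union> (Q - P)) ?g = comb (P \<inter> Q) ?g + comb (Q - P) ?g"
    unfolding comb_def by (rule sum.union_disjoint) (use assms(1,2) in auto)
  moreover have "comb (P \<inter> Q) ?g = - comb (P \<inter> Q) w"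
    unfolding comb_def sum_negf[symmetric] by (intro sum.cong) auto
  moreover have "comb (Q - P) ?g = comb (Q - P) u"
    unfolding comb_def by (intro sum.cong) auto
  moreover have "(P \<inter> Q) \<union> (Q - P) = Q" by blast
  ultimately have "comb Q ?g = comb Q (\<lambda>_. 0)" using w zero by simp
  then have "?g v = 0" if "v \<in> Q" for v
    using comb_independent[OF assms(2,4)] that by blast
  then have uQ: "u v = 0" if "v \<in> Q - P" for v using that by fastforce
  then have "comb (Q - P) u = 0" unfolding comb_def by (intro sum.neutral) simp
  then have "comb P u = comb P (\<lambda>_. 0)" using eq zero by simp
  then have "u v = 0" if "v \<in> P" for v using comb_independent[OF assms(1,3)] that by blast
  then show False using u(2) uQ by blast
qed

section \<open>Spans of cones and of pairs\<close>

lemma span_cone: "span (cone A) = span A"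
  by (intro subset_antisym span_mono cone_superset span_minimal cone_subset_span subspace_span)

lemma cone_Int_span:
  assumes "F \<subseteq> A" "\<And>a. a \<in> A \<Longrightarrow> a \<in> span F \<Longrightarrow> a \<in> F"
  shows "cone F = cone A \<inter> span F"
proof
  show "cone F \<subseteq> cone A \<inter> span F" using assms(1) cone_subset_span[of F] by (auto simp: cone_def)
  show "cone A \<inter> span F \<subseteq> cone F"
  proof
    fix v assume v: "v \<in> cone A \<inter> span F"
    show "v \<in> cone F"
    proof (cases "v = 0")
      case False
      then obtain c a where a: "a \<in> A" "c \<noteq> 0" "v = c *s a" using v by (auto elim: coneE)
      have "a = inverse c *s v" using a by simp
      also have "\<dots> \<in> span F" using v by (simp add: span_scale)
      finally have "a \<in> F" by (rule assms(2)[OF a(1)])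
      then show ?thesis using a by (auto simp: cone_def)
    qed (simp add: cone_def)
  qed
qed

lemma independent_pair_coeffs:
  assumes "independent {u, v}" "u \<noteq> v" "p *s u + r *s v = p' *s u + r' *s v"
  shows "p = p'" and "r = r'"
proof -
  have eq: "comb {u, v} (\<lambda>x. if x = u then p else r) = comb {u, v} (\<lambda>x. if x = u then p' else r')"
    using assms(2,3) by (simp add: comb_def)
  show "p = p'" using comb_independent[OF _ assms(1) eq, of u] by simp
  show "r = r'" using comb_independent[OF _ assms(1) eq, of v] assms(2) by simp
qed

lemma nonparallel_independent_pair:
  assumes "nonparallel A" "a \<in> A" "b \<in> A"
  shows "independent {a, b}"
proof (cases "a = b")
  case True
  then show ?thesis using assms by (auto simp: nonparallel_def)
next
  case False
  have "b \<notin> span {a}"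
  proof
    assume "b \<in> span {a}"
    then obtain k where "b = k *s a" by (auto simp: span_singleton)
    then have "b = a" by (rule nonparallelD[OF assms(1,3,2)])
    then show False using False by simp
  qed
  moreover have "a \<noteq> 0" using assms(1,2) unfolding nonparallel_def by metis
  ultimately show ?thesis using independent_pair_iff[OF False] by blast
qed

lemma span_pair: "span {a, b} = {c *s a + d *s b |c d. True}"
proof
  show "span {a, b} \<subseteq> {c *s a + d *s b |c d. True}"
  proof
    fix x assume "x \<in> span {a, b}"
    then obtain c d where "x - c *s a = d *s b" by (auto simp: span_breakdown_eq)
    then have "x = c *s a + d *s b" by (simp add: algebra_simps)
    then show "x \<in> {c *s a + d *s b |c d. True}" by blast
  qed
  have "a \<in> span {a, b}" "b \<in> span {a, b}" by (simp_all add: span_base)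
  then show "{c *s a + d *s b |c d. True} \<subseteq> span {a, b}"
    using span_add span_scale by blast
qed

end

section \<open>Flats of matroids\<close>

context matroid begin

lemma finite_subset_ground: "X \<subseteq> ground M \<Longrightarrow> finite X"
  using finite_ground finite_subset by blast

lemma rank_ge: "X \<subseteq> ground M \<Longrightarrow> I \<subseteq> X \<Longrightarrow> indep M I \<Longrightarrow> card I \<le> rank_of M X"
  unfolding rank_of_def by (intro Max_ge) (auto dest: finite_subset_ground)

lemma rank_le:
  assumes "X \<subseteq> ground M" "\<And>I. I \<subseteq> X \<Longrightarrow> indep M I \<Longrightarrow> card I \<le> n"
  shows "rank_of M X \<le> n"
  unfolding rank_of_def
  by (rule Max.boundedI) (use assms finite_subset_ground indep_empty in auto)

lemma ex_basis_extending:
  assumes "indep M B" "B \<subseteq> X" "X \<subseteq> ground M"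
  obtains B' where "B \<subseteq> B'" "B' \<subseteq> X" "indep M B'" "card B' = rank_of M X"
proof -
  let ?P = "\<lambda>J. B \<subseteq> J \<and> J \<subseteq> X \<and> indep M J"
  have fX: "finite X" using finite_subset_ground assms(3) .
  have "?P B" using assms by blast
  moreover have "\<forall>J. ?P J \<longrightarrow> card J < Suc (card X)"
    using card_mono[OF fX] by (simp add: less_Suc_eq_le)
  ultimately have "\<exists>J. ?P J \<and> (\<forall>I. ?P I \<longrightarrow> card I \<le> card J)" by (rule ex_has_greatest_nat)
  then obtain J where J: "?P J" and Jmax: "\<And>I. ?P I \<Longrightarrow> card I \<le> card J" by blast
  have "card I \<le> card J" if I: "I \<subseteq> X" "indep M I" for I
  proof (rule ccontr)
    assume "\<not> card I \<le> card J"
    then obtain y where y: "y \<in> I - J" "indep M (insert y J)" using indep_augment[of J I] J I by auto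
    then have "?P (insert y J)" using J I by blast
    then have "card (insert y J) \<le> card J" by (rule Jmax)
    then show False using y J fX finite_subset[of J X] by simp
  qed
  then have "rank_of M X \<le> card J" by (rule rank_le[OF assms(3)])
  then have "card J = rank_of M X" using rank_ge[OF assms(3), of J] J by simp
  then show thesis using that J by blast
qed

lemma ex_basis:
  assumes "X \<subseteq> ground M"
  obtains B where "B \<subseteq> X" "indep M B" "card B = rank_of M X"
  by (rule ex_basis_extending[OF indep_empty empty_subsetI assms])

text \<open>Closure can be tested against one basis of \<open>X\<close>, which replaces rank
  computations by augmentation.\<close>

lemma in_closure_iff:
  assumes "X \<subseteq> ground M" "B \<subseteq> X" "indep M B" "card B = rank_of M X" "e \<in> ground M"
  shows "e \<in> closure_of M X \<longleftrightarrow> e \<in> B \<or> \<not> indep M (insert e B)"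
proof -
  have sub: "insert e X \<subseteq> ground M" using assms by blast
  have finB: "finite B" using finite_subset_ground assms by blast
  have ge: "rank_of M X \<le> rank_of M (insert e X)"
    using rank_ge[OF sub, of B] assms by auto
  show ?thesis
  proof
    assume "e \<in> closure_of M X"
    then have "rank_of M (insert e X) = card B" using assms by (simp add: closure_of_def)
    moreover have "insert e B \<subseteq> insert e X" using assms(2) by blast
    ultimately show "e \<in> B \<or> \<not> indep M (insert e B)"
      using rank_ge[OF sub, of "insert e B"] finB by fastforce
  next
    assume e: "e \<in> B \<or> \<not> indep M (insert e B)"
    have "rank_of M (insert e X) \<le> card B"
    proof (rule rank_le[OF sub], rule ccontr)
      fix I assume I: "I \<subseteq> insert e X" "indep M I" "\<not> card I \<le> card B"
      then obtain y where y: "y \<in> I - B" "indep M (insert y B)"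
        using indep_augment[of B I] assms by auto
      have "y \<in> X" using y e I by auto
      then have "card (insert y B) \<le> card B"
        using rank_ge[OF assms(1), of "insert y B"] y assms by auto
      then show False using y finB by simp
    qed
    then show "e \<in> closure_of M X" using ge assms by (simp add: closure_of_def)
  qed
qed

lemma closure_subset_ground: "closure_of M X \<subseteq> ground M"
  by (auto simp: closure_of_def)

lemma closure_superset: "X \<subseteq> ground M \<Longrightarrow> X \<subseteq> closure_of M X"
  by (auto simp: closure_of_def insert_absorb)

lemma flat_closure:
  assumes "X \<subseteq> ground M"
  shows "flat M (closure_of M X)"
proof -
  let ?C = "closure_of M X"
  obtain B where B: "B \<subseteq> X" "indep M B" "card B = rank_of M X" using ex_basis[OF assms] .
  note C = closure_subset_ground[of X] closure_superset[OF assms]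
  have "rank_of M ?C \<le> card B"
  proof (rule rank_le[OF C(1)], rule ccontr)
    fix I assume I: "I \<subseteq> ?C" "indep M I" "\<not> card I \<le> card B"
    then obtain y where "y \<in> I - B" "indep M (insert y B)"
      using indep_augment[of B I] B by auto
    then show False using in_closure_iff[OF assms B, of y] I C by blast
  qed
  moreover have "card B \<le> rank_of M ?C" using rank_ge[OF C(1), of B] B C by blast
  ultimately have "card B = rank_of M ?C" by simp
  then have "e \<in> closure_of M ?C \<longleftrightarrow> e \<in> ?C" if "e \<in> ground M" for e
    using in_closure_iff[OF C(1) _ B(2) _ that, of] in_closure_iff[OF assms B that] B C by blast
  then show ?thesis unfolding flat_def using C closure_subset_ground by blast
qed

lemma closure_mono:
  assumes "X \<subseteq> Y" "Y \<subseteq> ground M"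
  shows "closure_of M X \<subseteq> closure_of M Y"
proof
  fix e assume e: "e \<in> closure_of M X"
  have X: "X \<subseteq> ground M" using assms by blast
  have eg: "e \<in> ground M" using e closure_subset_ground by blast
  obtain B where B: "B \<subseteq> X" "indep M B" "card B = rank_of M X" using ex_basis[OF X] .
  obtain B' where B': "B \<subseteq> B'" "B' \<subseteq> Y" "indep M B'" "card B' = rank_of M Y"
    using ex_basis_extending[OF B(2) _ assms(2)] B(1) assms(1) by blast
  have "e \<in> B' \<or> \<not> indep M (insert e B')"
    using in_closure_iff[OF X B eg] e B'(1) indep_mono[of "insert e B'" "insert e B"] by blast
  then show "e \<in> closure_of M Y" using in_closure_iff[OF assms(2) B'(2-4) eg] by blast
qed

lemma flatD: "flat M F \<Longrightarrow> F \<subseteq> ground M" "flat M F \<Longrightarrow> closure_of M F = F"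
  by (auto simp: flat_def)

lemma flat_ground: "flat M (ground M)"
  unfolding flat_def using closure_superset closure_subset_ground by blast

text \<open>A generalized parallel connection is specified by its flats; this recovers its
  independent sets. The flat separating \<open>x\<close> from the rest of an independent
  \<open>X\<close> is the closure of \<open>X - {x}\<close>.\<close>

lemma indep_iff_flats:
  "indep M X \<longleftrightarrow> X \<subseteq> ground M \<and> (\<forall>x\<in>X. \<exists>F. flat M F \<and> X - {x} \<subseteq> F \<and> x \<notin> F)"
proof
  assume X: "indep M X"
  have g: "X \<subseteq> ground M" using indep_subset_ground[OF X] .
  have "\<exists>F. flat M F \<and> X - {x} \<subseteq> F \<and> x \<notin> F" if x: "x \<in> X" for x
  proof -
    have sub: "X - {x} \<subseteq> ground M" using g by blast
    have ind: "indep M (X - {x})" using indep_mono[OF X] by blast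
    have "card I \<le> card (X - {x})" if "I \<subseteq> X - {x}" for I
      using card_mono[OF finite_subset_ground[OF sub] that] .
    then have "card (X - {x}) = rank_of M (X - {x})"
      using rank_le[OF sub] rank_ge[OF sub subset_refl ind] by (meson le_antisym)
    from in_closure_iff[OF sub subset_refl ind this, of x]
    have "x \<notin> closure_of M (X - {x})" using X x g by (auto simp: insert_absorb)
    then show ?thesis using flat_closure[OF sub] closure_superset[OF sub] by blast
  qed
  then show "X \<subseteq> ground M \<and> (\<forall>x\<in>X. \<exists>F. flat M F \<and> X - {x} \<subseteq> F \<and> x \<notin> F)" using g by blast
next
  assume R: "X \<subseteq> ground M \<and> (\<forall>x\<in>X. \<exists>F. flat M F \<and> X - {x} \<subseteq> F \<and> x \<notin> F)"
  then have g: "X \<subseteq> ground M" by blast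
  show "indep M X"
  proof (rule ccontr)
    assume dep: "\<not> indep M X"
    obtain B where B: "B \<subseteq> X" "indep M B" "card B = rank_of M X" using ex_basis[OF g] .
    have "B \<noteq> X" using dep B(2) by blast
    then obtain x where x: "x \<in> X" "x \<notin> B" using B(1) by blast
    obtain F where F: "flat M F" "X - {x} \<subseteq> F" "x \<notin> F" using R x(1) by blast
    have Bg: "B \<subseteq> ground M" using B(1) g by blast
    have "card I \<le> card B" if "I \<subseteq> B" for I using card_mono[OF finite_subset_ground[OF Bg] that] .
    then have "card B = rank_of M B"
      using rank_le[OF Bg] rank_ge[OF Bg subset_refl B(2)] by (meson le_antisym)
    moreover have "x \<in> closure_of M X" using closure_superset[OF g] x(1) by blast
    then have "\<not> indep M (insert x B)" using in_closure_iff[OF g B] x g by blast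
    ultimately have "x \<in> closure_of M B"
      using in_closure_iff[OF Bg subset_refl B(2)] x g by blast
    also have "\<dots> \<subseteq> closure_of M F" by (rule closure_mono) (use B x F flatD in blast)+
    finally show False using F flatD by blast
  qed
qed

end

text \<open>The flats of \<open>M1\<close> are exactly the traces of flats of \<open>M\<close>, so a
  point of \<open>X\<close> can be separated from the rest of \<open>X\<close> in one matroid if and
  only if it can in the other.\<close>

lemma glued_indep_iff:
  assumes M1: "matroid M1" and M2: "matroid M2" and M: "matroid M"
    and agree: "\<And>I. I \<subseteq> ground M1 \<inter> ground M2 \<Longrightarrow> indep M1 I \<longleftrightarrow> indep M2 I"
    and ground: "ground M = ground M1 \<union> ground M2"
    and flats: "\<And>F. flat M F \<longleftrightarrow> F \<subseteq> ground M1 \<union> ground M2 \<and>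
      flat M1 (F \<inter> ground M1) \<and> flat M2 (F \<inter> ground M2)"
    and X: "X \<subseteq> ground M1"
  shows "indep M X \<longleftrightarrow> indep M1 X"
proof -
  let ?T = "ground M1 \<inter> ground M2"
  interpret M1: matroid M1 by (rule M1)
  interpret M2: matroid M2 by (rule M2)
  interpret M: matroid M by (rule M)
  have rank: "rank_of M1 Z = rank_of M2 Z" if "Z \<subseteq> ?T" for Z
  proof -
    have "{I. I \<subseteq> Z \<and> indep M1 I} = {I. I \<subseteq> Z \<and> indep M2 I}" using agree that by blast
    then show ?thesis by (simp add: rank_of_def)
  qed
  \<comment> \<open>\<open>F\<close> is enlarged by the closure of
    \<open>F \<inter> ground M2\<close> in \<open>M2\<close>. As both matroids agree on the common
    part, this adds no element of \<open>ground M1\<close>.\<close>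
  have ext: "\<exists>F'. flat M F' \<and> F' \<inter> ground M1 = F" if F: "flat M1 F" for F
  proof -
    let ?Z = "F \<inter> ground M2" and ?C = "closure_of M2 (F \<inter> ground M2)"
    have F1: "F \<subseteq> ground M1" using M1.flatD(1)[OF F] .
    have ZT: "?Z \<subseteq> ?T" using F1 by blast
    have CT: "?C \<inter> ground M1 \<subseteq> F"
    proof
      fix e assume e: "e \<in> ?C \<inter> ground M1"
      then have eT: "e \<in> ?T" "rank_of M2 (insert e ?Z) = rank_of M2 ?Z"
        by (auto simp: closure_of_def)
      then have "rank_of M1 (insert e ?Z) = rank_of M1 ?Z"
        using rank[of "insert e ?Z"] rank[OF ZT] ZT by simp
      then have "e \<in> closure_of M1 ?Z" using eT by (simp add: closure_of_def)
      also have "\<dots> \<subseteq> closure_of M1 F" by (rule M1.closure_mono[OF Int_lower1 F1])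
      finally show "e \<in> F" using M1.flatD(2)[OF F] by simp
    qed
    have Z2: "?Z \<subseteq> ground M2" by blast
    have "(F \<union> ?C) \<inter> ground M1 = F" using CT F1 by blast
    moreover have "(F \<union> ?C) \<inter> ground M2 = ?C"
      using M2.closure_subset_ground[of ?Z] M2.closure_superset[OF Z2] by blast
    ultimately show ?thesis
      using flats[of "F \<union> ?C"] F M2.flat_closure[OF Z2] F1 M2.closure_subset_ground[of ?Z] by auto
  qed
  have "(\<exists>F. flat M F \<and> X - {x} \<subseteq> F \<and> x \<notin> F) \<longleftrightarrow> (\<exists>F. flat M1 F \<and> X - {x} \<subseteq> F \<and> x \<notin> F)"
    if x: "x \<in> X" for x
  proof
    assume "\<exists>F. flat M F \<and> X - {x} \<subseteq> F \<and> x \<notin> F"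
    then obtain F where "flat M F" "X - {x} \<subseteq> F" "x \<notin> F" by blast
    then show "\<exists>F. flat M1 F \<and> X - {x} \<subseteq> F \<and> x \<notin> F"
      using flats X by (intro exI[of _ "F \<inter> ground M1"]) blast
  next
    assume "\<exists>F. flat M1 F \<and> X - {x} \<subseteq> F \<and> x \<notin> F"
    then obtain F where F: "flat M1 F" "X - {x} \<subseteq> F" "x \<notin> F" by blast
    obtain F' where "flat M F'" "F' \<inter> ground M1 = F" using ext[OF F(1)] by blast
    then show "\<exists>F. flat M F \<and> X - {x} \<subseteq> F \<and> x \<notin> F"
      using F x X by (intro exI[of _ F']) blast
  qed
  then show ?thesis using X ground by (simp add: M.indep_iff_flats[of X] M1.indep_iff_flats[of X]) blast
qed

section \<open>Representations\<close>

interpretation gf: finite_field_space seq_scale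
  by unfold_locales

text \<open>Finiteness of the ground set is part of the notion, so that the matroid axioms follow
  from it and contractions are recognized as matroids through their representation.\<close>

definition represents :: "('a \<Rightarrow> nat \<Rightarrow> 'f::{field,finite}) \<Rightarrow> 'a matroid_data \<Rightarrow> bool" where
  "represents \<phi> M \<longleftrightarrow> finite (ground M) \<and>
     (\<forall>X. indep M X \<longleftrightarrow> X \<subseteq> ground M \<and> inj_on \<phi> X \<and> seq.independent (\<phi> ` X))"

lemma representable_represents:
  fixes K :: "'f::{field,finite} itself"
  assumes "representable K M"
  obtains \<phi> :: "'a \<Rightarrow> nat \<Rightarrow> 'f" where "represents \<phi> M"
proof -
  interpret matroid M using assms by (simp add: representable_def)
  obtain \<phi> :: "'a \<Rightarrow> nat \<Rightarrow> 'f"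
    where "\<And>X. X \<subseteq> ground M \<Longrightarrow> indep M X \<longleftrightarrow> inj_on \<phi> X \<and> seq.independent (\<phi> ` X)"
    using assms unfolding representable_def by blast
  then have "represents \<phi> M"
    unfolding represents_def using finite_ground indep_subset_ground by blast
  then show thesis by (rule that)
qed

section \<open>Closure and flats through linear spans\<close>

lemma represents_insert:
  assumes "represents \<phi> M" "indep M B" "e \<in> ground M" "e \<notin> B"
  shows "indep M (insert e B) \<longleftrightarrow> \<phi> e \<notin> seq.span (\<phi> ` B)"
proof
  assume "indep M (insert e B)"
  then have "inj_on \<phi> (insert e B)" "seq.independent (insert (\<phi> e) (\<phi> ` B))"
    using assms(1) by (auto simp: represents_def)
  moreover have "\<phi> e \<notin> \<phi> ` B" using calculation(1) assms(4) by (auto simp: inj_on_def)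
  ultimately show "\<phi> e \<notin> seq.span (\<phi> ` B)" by (simp add: seq.independent_insert)
next
  assume e: "\<phi> e \<notin> seq.span (\<phi> ` B)"
  then have "\<phi> e \<notin> \<phi> ` B" using seq.span_base by blast
  moreover have "B \<subseteq> ground M" "inj_on \<phi> B" "seq.independent (\<phi> ` B)"
    using assms(1,2) by (auto simp: represents_def)
  moreover have "seq.independent (insert (\<phi> e) (\<phi> ` B))"
    using calculation(4) e by (intro seq.independent_insertI)
  ultimately show "indep M (insert e B)"
    using assms(1,3) by (auto simp: represents_def)
qed

lemma represents_matroid:
  assumes "represents \<phi> M"
  shows "matroid M"
proof
  show "finite (ground M)" "indep M {}"
    using assms seq.independent_empty by (auto simp: represents_def)
  show "X \<subseteq> ground M" if "indep M X" for X using that assms by (auto simp: represents_def)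
  show "indep M X" if "indep M Y" "X \<subseteq> Y" for X Y
    using that assms seq.independent_mono[of "\<phi> ` Y" "\<phi> ` X"] inj_on_subset[of \<phi> Y X]
    unfolding represents_def by blast
  show "\<exists>y\<in>Y - X. indep M (insert y X)" if XY: "indep M X" "indep M Y" "card X < card Y" for X Y
  proof (rule ccontr)
    assume none: "\<not> ?thesis"
    have X: "X \<subseteq> ground M" "inj_on \<phi> X" and Y: "Y \<subseteq> ground M" "inj_on \<phi> Y" "seq.independent (\<phi> ` Y)"
      using XY assms by (auto simp: represents_def)
    have "\<phi> y \<in> seq.span (\<phi> ` X)" if "y \<in> Y" for y
    proof (cases "y \<in> X")
      case True
      then show ?thesis by (simp add: seq.span_base)
    next
      case False
      then show ?thesis using none represents_insert[OF assms XY(1), of y] that Y(1) by blast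
    qed
    then have "\<phi> ` Y \<subseteq> seq.span (\<phi> ` X)" by blast
    moreover have "finite X" using X(1) assms finite_subset unfolding represents_def by blast
    ultimately have "card (\<phi> ` Y) \<le> card (\<phi> ` X)"
      using seq.independent_span_bound[of "\<phi> ` X" "\<phi> ` Y"] Y(3) by simp
    then show False using XY(3) card_image[OF X(2)] card_image[OF Y(2)] by simp
  qed
qed

lemma represents_restriction:
  assumes "represents \<phi> M" "X \<subseteq> ground M"
  shows "represents \<phi> (restriction M X)"
  using assms finite_subset unfolding represents_def restriction_def by auto

lemma represents_basis_span:
  assumes "represents \<phi> M" "X \<subseteq> ground M" "B \<subseteq> X" "indep M B" "card B = rank_of M X"
  shows "seq.span (\<phi> ` B) = seq.span (\<phi> ` X)"
proof -
  interpret matroid M using assms(1) by (rule represents_matroid)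
  have "\<phi> e \<in> seq.span (\<phi> ` B)" if e: "e \<in> X" for e
  proof (cases "e \<in> B")
    case False
    have "e \<in> closure_of M X" using closure_superset[OF assms(2)] e by blast
    then have "\<not> indep M (insert e B)" using in_closure_iff[OF assms(2-5), of e] e assms(2) False by blast
    then show ?thesis using represents_insert[OF assms(1,4) _ False] e assms(2) by blast
  qed (simp add: seq.span_base)
  then have "seq.span (\<phi> ` X) \<subseteq> seq.span (\<phi> ` B)" by (intro seq.span_minimal) auto
  then show ?thesis using seq.span_mono[of "\<phi> ` B" "\<phi> ` X"] assms(3) by blast
qed

lemma represents_closure:
  assumes "represents \<phi> M" "X \<subseteq> ground M" "e \<in> ground M"
  shows "e \<in> closure_of M X \<longleftrightarrow> \<phi> e \<in> seq.span (\<phi> ` X)"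
proof -
  interpret matroid M using assms(1) by (rule represents_matroid)
  obtain B where B: "B \<subseteq> X" "indep M B" "card B = rank_of M X" using ex_basis[OF assms(2)] .
  show ?thesis
    using in_closure_iff[OF assms(2) B assms(3)] represents_insert[OF assms(1) B(2) assms(3)]
      represents_basis_span[OF assms(1,2) B] seq.span_base[of "\<phi> e" "\<phi> ` B"] by blast
qed

lemma represents_flat:
  assumes "represents \<phi> M"
  shows "flat M F \<longleftrightarrow> F \<subseteq> ground M \<and> (\<forall>e\<in>ground M. \<phi> e \<in> seq.span (\<phi> ` F) \<longrightarrow> e \<in> F)"
proof -
  interpret matroid M using assms(1) by (rule represents_matroid)
  show ?thesis
    using represents_closure[OF assms, of F] closure_superset[of F] closure_subset_ground[of F]
    unfolding flat_def by blast
qed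

lemma flat_preimage:
  assumes "represents \<phi> M" "seq.subspace W"
  shows "flat M {e \<in> ground M. \<phi> e \<in> W}"
proof -
  have "seq.span (\<phi> ` {e \<in> ground M. \<phi> e \<in> W}) \<subseteq> W"
    by (rule seq.span_minimal[OF _ assms(2)]) blast
  then show ?thesis unfolding represents_flat[OF assms(1)] by blast
qed

lemma represents_simple:
  assumes "represents \<phi> M" "\<And>x y. x \<in> ground M \<Longrightarrow> y \<in> ground M \<Longrightarrow> indep M {x, y}"
  shows "inj_on \<phi> (ground M)" and "gf.nonparallel (\<phi> ` ground M)"
proof -
  have pair: "inj_on \<phi> {x, y}" "seq.independent {\<phi> x, \<phi> y}"
    if "x \<in> ground M" "y \<in> ground M" for x y
    using assms(2)[OF that] assms(1) unfolding represents_def by auto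
  show inj: "inj_on \<phi> (ground M)" using pair(1) by (meson inj_on_def insertI1 insertI2)
  have zero: "0 \<notin> \<phi> ` ground M" using pair(2) seq.dependent_zero by (metis imageE insertI1)
  have mult: "\<phi> x = \<phi> y" if xy: "x \<in> ground M" "y \<in> ground M" "\<phi> x = seq_scale c (\<phi> y)" for x y c
  proof (rule ccontr)
    assume "\<phi> x \<noteq> \<phi> y"
    then have "\<phi> x \<notin> seq.span {\<phi> y}"
      using pair(2)[OF xy(1,2)] by (simp add: seq.independent_insert)
    then show False using xy(3) by (simp add: seq.span_base seq.span_scale)
  qed
  show "gf.nonparallel (\<phi> ` ground M)" unfolding gf.nonparallel_def
  proof (intro conjI ballI allI impI)
    fix a b c assume "a \<in> \<phi> ` ground M" "b \<in> \<phi> ` ground M" and ab: "a = seq_scale c b"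
    then obtain x y where xy: "x \<in> ground M" "y \<in> ground M" "a = \<phi> x" "b = \<phi> y" by blast
    show "a = b" using mult[OF xy(1,2)] ab unfolding xy(3,4) .
  qed (rule zero)
qed

lemma matroid_iso_uniform_iff:
  assumes "finite (ground N)"
  shows "matroid_iso N (uniform_matroid r n) \<longleftrightarrow>
    card (ground N) = n \<and> (\<forall>X\<subseteq>ground N. indep N X \<longleftrightarrow> card X \<le> r)"
proof
  assume "matroid_iso N (uniform_matroid r n)"
  then obtain f where f: "bij_betw f (ground N) {..<n}"
    and iff: "\<And>X. X \<subseteq> ground N \<Longrightarrow> indep N X \<longleftrightarrow> f ` X \<subseteq> {..<n} \<and> card (f ` X) \<le> r"
    by (auto simp: matroid_iso_def uniform_matroid_def)
  have "card (f ` X) = card X" "f ` X \<subseteq> {..<n}" if "X \<subseteq> ground N" for X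
    using f that card_image[of f X] inj_on_subset unfolding bij_betw_def by blast+
  then show "card (ground N) = n \<and> (\<forall>X\<subseteq>ground N. indep N X \<longleftrightarrow> card X \<le> r)"
    using bij_betw_same_card[OF f] iff by simp
next
  assume R: "card (ground N) = n \<and> (\<forall>X\<subseteq>ground N. indep N X \<longleftrightarrow> card X \<le> r)"
  then obtain f where f: "bij_betw f (ground N) {..<n}"
    using ex_bij_betw_finite_nat[OF assms] by (auto simp: lessThan_atLeast0)
  have "card (f ` X) = card X" "f ` X \<subseteq> {..<n}" if "X \<subseteq> ground N" for X
    using f that card_image[of f X] inj_on_subset unfolding bij_betw_def by blast+
  then show "matroid_iso N (uniform_matroid r n)"
    unfolding matroid_iso_def uniform_matroid_def using f R by (intro exI[of _ f]) simp
qed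

text \<open>All bases \<open>B\<close> of \<open>C\<close> span the kernel of \<open>f\<close>, so
  \<open>f \<circ> \<phi>\<close> describes independence for each choice of \<open>B\<close> in
  \<open>contraction\<close>.\<close>

lemma represents_contraction:
  assumes \<phi>: "represents \<phi> N" and C: "C \<subseteq> ground N"
    and f: "Vector_Spaces.linear seq_scale seq_scale f"
    and ker: "\<And>v. f v = 0 \<longleftrightarrow> v \<in> seq.span (\<phi> ` C)"
  shows "represents (f \<circ> \<phi>) (contraction N C)"
  unfolding represents_def
proof (intro conjI allI)
  interpret matroid N using \<phi> by (rule represents_matroid)
  show "finite (ground (contraction N C))" using finite_ground by (simp add: contraction_def)
  fix I
  have iff: "indep N (I \<union> B) \<longleftrightarrow> inj_on (f \<circ> \<phi>) I \<and> seq.independent ((f \<circ> \<phi>) ` I)"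
    if I: "I \<subseteq> ground N - C" and B: "B \<subseteq> C" "indep N B" "card B = rank_of N C" for B
  proof -
    have span: "seq.span (\<phi> ` B) = seq.span (\<phi> ` C)" by (rule represents_basis_span[OF \<phi> C B])
    have B': "inj_on \<phi> B" "seq.independent (\<phi> ` B)" using B(2) \<phi> by (auto simp: represents_def)
    have fin: "finite (\<phi> ` I)" "finite (\<phi> ` B)"
      using finite_subset_ground[of I] finite_subset_ground[of B] I B C by blast+
    have key: "seq.independent (\<phi> ` I \<union> \<phi> ` B) \<longleftrightarrow> inj_on f (\<phi> ` I) \<and> seq.independent (f ` \<phi> ` I)"
      if "\<phi> ` I \<inter> \<phi> ` B = {}"
      by (rule gf.independent_contract_iff[OF f _ fin(2) B'(2) fin(1) that]) (simp add: ker span)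
    have IB: "I \<inter> B = {}" using I B by blast
    have IBg: "I \<union> B \<subseteq> ground N" using I B C by blast
    show ?thesis
    proof
      assume "indep N (I \<union> B)"
      then have *: "inj_on \<phi> (I \<union> B)" "seq.independent (\<phi> ` I \<union> \<phi> ` B)"
        using \<phi> by (auto simp: represents_def image_Un)
      then have "\<phi> ` I \<inter> \<phi> ` B = {}" using IB by (simp add: inj_on_Un) blast
      then have "inj_on f (\<phi> ` I) \<and> seq.independent (f ` \<phi> ` I)" using key *(2) by blast
      moreover have "inj_on \<phi> I" using *(1) inj_on_Un by blast
      ultimately show "inj_on (f \<circ> \<phi>) I \<and> seq.independent ((f \<circ> \<phi>) ` I)"
        by (simp add: comp_inj_on image_comp)
    next
      assume *: "inj_on (f \<circ> \<phi>) I \<and> seq.independent ((f \<circ> \<phi>) ` I)"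
      then have inj: "inj_on \<phi> I" "inj_on f (\<phi> ` I)" using inj_on_imageI inj_on_imageI2 by blast+
      have ind: "seq.independent (f ` \<phi> ` I)" using * by (simp add: image_comp)
      have dis: "\<phi> ` I \<inter> \<phi> ` B = {}"
      proof (rule ccontr)
        assume "\<phi> ` I \<inter> \<phi> ` B \<noteq> {}"
        then obtain v where v: "v \<in> \<phi> ` I" "v \<in> \<phi> ` B" by blast
        then have "v \<in> seq.span (\<phi> ` C)" using seq.span_base[of v] span by blast
        then have "f v = 0" using ker by blast
        then have "0 \<in> f ` \<phi> ` I" using imageI[OF v(1), of f] by simp
        then show False using ind seq.dependent_zero by metis
      qed
      then have "seq.independent (\<phi> ` (I \<union> B))" using key inj(2) ind by (simp add: image_Un)
      moreover have "inj_on \<phi> (I \<union> B)" unfolding inj_on_Un using inj(1) B'(1) dis by blast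
      ultimately show "indep N (I \<union> B)" using \<phi> IBg by (simp add: represents_def)
    qed
  qed
  obtain B where B: "B \<subseteq> C" "indep N B" "card B = rank_of N C" using ex_basis[OF C] .
  show "indep (contraction N C) I \<longleftrightarrow> I \<subseteq> ground (contraction N C) \<and>
      inj_on (f \<circ> \<phi>) I \<and> seq.independent ((f \<circ> \<phi>) ` I)"
    unfolding contraction_def using iff B by auto
qed

lemma represents_parallel:
  assumes "represents \<phi> M" "parallel M x y"
  obtains c where "\<phi> x = seq_scale c (\<phi> y)"
proof (cases "x = y")
  case True
  then show thesis using that[of 1] by simp
next
  case False
  then have xy: "indep M {y}" "x \<in> ground M" "\<not> indep M (insert x {y})"
    using assms(2) by (auto simp: parallel_def nonloops_def)
  then have "\<phi> x \<in> seq.span {\<phi> y}"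
    using represents_insert[OF assms(1) xy(1,2)] False by simp
  then show thesis using that by (auto simp: seq.span_singleton)
qed

lemma represents_nonloop: "represents \<phi> M \<Longrightarrow> x \<in> nonloops M \<longleftrightarrow> x \<in> ground M \<and> \<phi> x \<noteq> 0"
  by (auto simp: represents_def nonloops_def)

text \<open>The representation is existentially quantified because a contraction changes it to
  \<open>f \<circ> \<psi>\<close>. Simplification does not alter the cone, as loops go to 0 and
  parallel elements to multiples of each other.\<close>

lemma induced_minor_decomposable:
  fixes \<phi> :: "'a \<Rightarrow> nat \<Rightarrow> 'f::{field,finite}"
  assumes "induced_minor M N" "represents \<phi> M" "gf.decomposable (gf.cone (\<phi> ` ground M))"
  shows "\<exists>\<psi> :: 'a \<Rightarrow> nat \<Rightarrow> 'f. represents \<psi> N \<and> gf.decomposable (gf.cone (\<psi> ` ground N))"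
  using assms
proof (induction rule: induced_minor.induct)
  case refl
  then show ?case by blast
next
  case (contract N C N')
  then obtain \<psi> :: "'a \<Rightarrow> nat \<Rightarrow> 'f" where \<psi>: "represents \<psi> N" "gf.decomposable (gf.cone (\<psi> ` ground N))"
    by blast
  let ?S = "gf.cone (\<psi> ` ground N)" and ?N = "contraction N C"
  obtain f where f: "Vector_Spaces.linear seq_scale seq_scale f"
    and ker: "\<And>v. f v = 0 \<longleftrightarrow> v \<in> seq.span (\<psi> ` C)"
    using gf.ex_linear_kernel[OF seq.subspace_span] by blast
  have rep: "represents (f \<circ> \<psi>) ?N" by (rule represents_contraction[OF \<psi>(1) contract.hyps(2) f ker])
  obtain X where X: "X \<subseteq> nonloops ?N" "\<forall>e\<in>nonloops ?N. \<exists>!x. x \<in> X \<and> parallel ?N e x"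
    "N' = restriction ?N X"
    using contract.hyps(3) unfolding is_simplification_of_def by (elim exE conjE)
  have Xg: "X \<subseteq> ground ?N" using X(1) by (auto simp: nonloops_def)
  have rep': "represents (f \<circ> \<psi>) N'" unfolding X(3) by (rule represents_restriction[OF rep Xg])
  have "gf.decomposable (f ` ?S)"
  proof (rule gf.decomposable_linear_image[OF f \<psi>(2)])
    have "\<psi> ` C \<subseteq> {v. f v = 0} \<inter> ?S"
      using ker seq.span_base gf.cone_superset[of "\<psi> ` ground N"] contract.hyps(2) by blast
    then have "seq.span (\<psi> ` C) \<subseteq> seq.span ({v. f v = 0} \<inter> ?S)" by (rule seq.span_mono)
    then show "{v. f v = 0} \<inter> seq.span ?S \<subseteq> seq.span ({v. f v = 0} \<inter> ?S)" using ker by blast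
  qed
  moreover have "f ` ?S = gf.cone ((f \<circ> \<psi>) ` X)"
  proof
    show "f ` ?S \<subseteq> gf.cone ((f \<circ> \<psi>) ` X)"
    proof
      fix v assume "v \<in> f ` ?S"
      then obtain s where s: "s \<in> ?S" "v = f s" by blast
      show "v \<in> gf.cone ((f \<circ> \<psi>) ` X)"
      proof (cases "v = 0")
        case False
        then have "s \<noteq> 0" using s gf.endo.linear_0[OF f] by auto
        then obtain c e where e: "e \<in> ground N" "s = seq_scale c (\<psi> e)"
          using s(1) by (auto elim!: gf.coneE)
        have v: "v = seq_scale c (f (\<psi> e))" using s e by (simp add: gf.endo.linear_scale[OF f])
        then have ne: "f (\<psi> e) \<noteq> 0" using False by auto
        have "e \<notin> C" using ne ker seq.span_base[of "\<psi> e" "\<psi> ` C"] by blast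
        then have "e \<in> nonloops ?N"
          using represents_nonloop[OF rep] e ne by (simp add: contraction_def)
        then obtain x where x: "x \<in> X" "parallel ?N e x" using X(2) by (meson ex1_implies_ex)
        obtain d where "(f \<circ> \<psi>) e = seq_scale d ((f \<circ> \<psi>) x)" using represents_parallel[OF rep x(2)] .
        then have "v = seq_scale (c * d) ((f \<circ> \<psi>) x)" using v by simp
        then show ?thesis using x(1) unfolding gf.cone_def by blast
      qed (simp add: gf.cone_def)
    qed
    show "gf.cone ((f \<circ> \<psi>) ` X) \<subseteq> f ` ?S"
    proof
      fix v assume v: "v \<in> gf.cone ((f \<circ> \<psi>) ` X)"
      show "v \<in> f ` ?S"
      proof (cases "v = 0")
        case True
        then show ?thesis using gf.endo.linear_0[OF f] gf.conic_zero[OF gf.conic_cone] by (metis imageI)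
      next
        case False
        then obtain c x where x: "x \<in> X" "v = seq_scale c (f (\<psi> x))"
          using v by (auto elim!: gf.coneE)
        then have "v = f (seq_scale c (\<psi> x))" by (simp add: gf.endo.linear_scale[OF f])
        moreover have "x \<in> ground N" using x(1) Xg by (auto simp: contraction_def)
        ultimately show ?thesis by (auto simp: gf.cone_def)
      qed
    qed
  qed
  moreover have "ground N' = X" using X(3) by (simp add: restriction_def)
  ultimately show ?case using rep' by auto
next
  case (restrict N F)
  then obtain \<psi> :: "'a \<Rightarrow> nat \<Rightarrow> 'f" where \<psi>: "represents \<psi> N" "gf.decomposable (gf.cone (\<psi> ` ground N))"
    by blast
  have F: "F \<subseteq> ground N" "\<And>e. e \<in> ground N \<Longrightarrow> \<psi> e \<in> seq.span (\<psi> ` F) \<Longrightarrow> e \<in> F"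
    using restrict.hyps(2) represents_flat[OF \<psi>(1)] by blast+
  have "gf.cone (\<psi> ` F) = gf.cone (\<psi> ` ground N) \<inter> seq.span (\<psi> ` F)"
    by (rule gf.cone_Int_span) (use F in auto)
  then have "gf.decomposable (gf.cone (\<psi> ` F))"
    using gf.decomposable_Int_subspace[OF \<psi>(2) seq.subspace_span] by simp
  moreover have "represents \<psi> (restriction N F)" by (rule represents_restriction[OF \<psi>(1) F(1)])
  moreover have "ground (restriction N F) = F" by (simp add: restriction_def)
  ultimately show ?case by auto
qed

section \<open>Projective geometries and chordal matroids\<close>

lemma subspace_vectors: "seq.subspace (vectors n)"
  by (rule seq.subspaceI) (auto simp: vectors_def seq_scale_def)

lemma vector_matroid_nonloops: "v \<in> nonloops (vector_matroid n) \<longleftrightarrow> v \<in> vectors n \<and> v \<noteq> 0"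
  by (auto simp: nonloops_def vector_matroid_def)

lemma vector_matroid_parallel:
  fixes u v :: "nat \<Rightarrow> 'f::{field,finite}"
  shows "parallel (vector_matroid n) u v \<longleftrightarrow>
    u \<in> nonloops (vector_matroid n) \<and> v \<in> nonloops (vector_matroid n) \<and> (\<exists>c. u = seq_scale c v)"
proof (cases "u \<in> nonloops (vector_matroid n) \<and> v \<in> nonloops (vector_matroid n)")
  case True
  then have uv: "u \<in> vectors n" "v \<in> vectors n" "u \<noteq> 0" "v \<noteq> 0" by (auto simp: vector_matroid_nonloops)
  have "indep (vector_matroid n) {u, v} \<longleftrightarrow> u \<notin> seq.span {v}" if "u \<noteq> v"
    using gf.independent_pair_iff[of v u] that uv by (simp add: vector_matroid_def insert_commute)
  then have "(u = v \<or> \<not> indep (vector_matroid n) {u, v}) \<longleftrightarrow> u \<in> seq.span {v}"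
    using seq.span_base[of v "{v}"] by auto
  then show ?thesis using True by (simp add: parallel_def seq.span_singleton image_iff)
qed (auto simp: parallel_def)

lemma simplification_of_vectors:
  assumes "is_simplification_of P (vector_matroid n :: (nat \<Rightarrow> 'f::{field,finite}) matroid_data)"
  obtains X where "X \<subseteq> vectors n" "gf.nonparallel X" "vectors n = gf.cone X"
    "P = restriction (vector_matroid n) X"
proof -
  let ?V = "vector_matroid n :: (nat \<Rightarrow> 'f) matroid_data"
  note nl = vector_matroid_nonloops and par = vector_matroid_parallel
  obtain X where X: "X \<subseteq> nonloops ?V" "\<forall>e\<in>nonloops ?V. \<exists>!x. x \<in> X \<and> parallel ?V e x"
    "P = restriction ?V X"
    using assms unfolding is_simplification_of_def by (elim exE conjE)
  have XV: "X \<subseteq> vectors n" using X(1) nl by blast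
  moreover have "gf.nonparallel X" unfolding gf.nonparallel_def
  proof (intro conjI ballI allI impI)
    show "0 \<notin> X" using X(1) nl by blast
    fix a b c assume ab: "a \<in> X" "b \<in> X" "a = seq_scale c b"
    have "a = seq_scale 1 a" by simp
    then have "parallel ?V a a" "parallel ?V a b" using par X(1) ab by blast+
    then show "a = b" using X(2) ab X(1) by blast
  qed
  moreover have "vectors n = gf.cone X"
  proof
    show "vectors n \<subseteq> gf.cone X"
    proof
      fix v :: "nat \<Rightarrow> 'f" assume v: "v \<in> vectors n"
      show "v \<in> gf.cone X"
      proof (cases "v = 0")
        case False
        then have "v \<in> nonloops ?V" using nl v by blast
        then obtain x where "x \<in> X" "parallel ?V v x" using X(2) by (meson ex1_implies_ex)
        then show ?thesis using par unfolding gf.cone_def by blast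
      qed (simp add: gf.cone_def)
    qed
    have "gf.cone X \<subseteq> seq.span X" by (rule gf.cone_subset_span)
    also have "\<dots> \<subseteq> vectors n" by (rule seq.span_minimal[OF XV subspace_vectors])
    finally show "gf.cone X \<subseteq> vectors n" .
  qed
  ultimately show thesis using that X(3) by blast
qed

text \<open>The given representation need not be the standard one, so each line is counted: in the
  geometry its points other than \<open>y\<close> are indexed by the scalars \<open>t\<close>,
  \<open>\<phi>\<close> places them at slopes \<open>s t\<close>, and an injective map of a finite
  field is surjective.\<close>

lemma projective_cone_subspace:
  fixes K :: "'f::{field,finite} itself" and \<phi> :: "'a \<Rightarrow> nat \<Rightarrow> 'f"
  assumes "projective_geometry K M" and \<phi>: "represents \<phi> M"
  shows "seq.subspace (gf.cone (\<phi> ` ground M))"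
proof -
  obtain n and P :: "(nat \<Rightarrow> 'f) matroid_data"
    where P: "is_simplification_of P (vector_matroid n)" "matroid_iso M P"
    using assms(1) unfolding projective_geometry_def by blast
  obtain X where X: "X \<subseteq> vectors n" "gf.nonparallel X" "vectors n = gf.cone X"
    "P = restriction (vector_matroid n) X"
    using simplification_of_vectors[OF P(1)] .
  let ?E = "ground M" and ?S = "gf.cone (\<phi> ` ground M)"
  obtain f where f: "bij_betw f ?E X"
    and iff: "\<And>Z. Z \<subseteq> ?E \<Longrightarrow> indep M Z \<longleftrightarrow> f ` Z \<subseteq> X \<and> f ` Z \<subseteq> vectors n \<and> seq.independent (f ` Z)"
    using P(2) unfolding matroid_iso_def X(4) by (auto simp: restriction_def vector_matroid_def)
  have fX: "f x \<in> X" if "x \<in> ?E" for x using f that bij_betwE by blast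
  have finj: "x = y" if "x \<in> ?E" "y \<in> ?E" "f x = f y" for x y
    using f that unfolding bij_betw_def inj_on_def by blast
  have pairX: "seq.independent {f x, f y}" if "x \<in> ?E" "y \<in> ?E" for x y
    by (rule gf.nonparallel_independent_pair[OF X(2)]) (use fX that in auto)
  have pairs: "indep M {x, y}" if "x \<in> ?E" "y \<in> ?E" for x y
    using iff[of "{x, y}"] pairX[OF that] fX that X(1) by auto
  have inj: "inj_on \<phi> ?E" and np: "gf.nonparallel (\<phi> ` ?E)"
    using represents_simple[OF \<phi>] pairs by blast+
  have line: "seq_scale a (\<phi> x) + seq_scale b (\<phi> y) \<in> ?S" if xy: "x \<in> ?E" "y \<in> ?E" "x \<noteq> y" for x y a b
  proof -
    have fxy: "f x \<noteq> f y" using finj xy by blast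
    note ind = gf.independent_pair_coeffs[OF pairX[OF xy(1,2)] fxy]
    \<comment> \<open>The geometry has a point \<open>z\<close> in the direction of
      \<open>f x + seq_scale t (f y)\<close>. Its image lies on the line of \<open>\<phi> x\<close>
      and \<open>\<phi> y\<close>, and \<open>\<alpha> \<noteq> 0\<close> because
      \<open>z \<noteq> y\<close>.\<close>
    have "\<exists>z\<in>?E. \<exists>\<alpha> s c. \<alpha> \<noteq> 0 \<and> \<phi> z = seq_scale \<alpha> (\<phi> x + seq_scale s (\<phi> y)) \<and>
        c \<noteq> 0 \<and> f z = seq_scale c (f x + seq_scale t (f y))" for t
    proof -
      let ?v = "f x + seq_scale t (f y)"
      have v0: "?v \<noteq> 0"
      proof
        assume "?v = 0"
        then have "seq_scale 1 (f x) + seq_scale t (f y) = seq_scale 0 (f x) + seq_scale 0 (f y)" by simp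
        from ind(1)[OF this] show False by simp
      qed
      have "?v \<in> gf.cone X"
        using fX xy X(1,3) subspace_vectors
        by (metis subsetD seq.subspace_add seq.subspace_scale)
      then obtain k g where kg: "g \<in> X" "k \<noteq> 0" "?v = seq_scale k g" using v0 by (rule gf.coneE)
      obtain z where z: "z \<in> ?E" "f z = g" using f kg(1) unfolding bij_betw_def by blast
      have fz: "f z = seq_scale (inverse k) ?v" using kg z by simp
      then have fz': "f z = seq_scale (inverse k) (f x) + seq_scale (inverse k * t) (f y)"
        by (simp add: seq.scale_right_distrib)
      have zy: "z \<noteq> y"
      proof
        assume "z = y"
        then have "seq_scale (inverse k) (f x) + seq_scale (inverse k * t) (f y)
            = seq_scale 0 (f x) + seq_scale 1 (f y)" using fz' by simp
        from ind(1)[OF this] show False using kg(2) by simp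
      qed
      have "\<phi> z \<in> seq.span {\<phi> x, \<phi> y}"
      proof (cases "z = x")
        case True
        then show ?thesis by (simp add: seq.span_base)
      next
        case False
        have "f z \<in> seq.span {f x, f y}" unfolding fz'
          by (intro seq.span_add seq.span_scale seq.span_base) auto
        moreover have "f z \<notin> {f x, f y}" using finj z xy zy False by blast
        ultimately have "\<not> seq.independent (insert (f z) {f x, f y})"
          by (simp add: seq.independent_insert)
        then have "\<not> indep M (insert z {x, y})" using iff[of "insert z {x, y}"] z xy by auto
        then show ?thesis
          using represents_insert[OF \<phi> pairs[OF xy(1,2)] z(1)] zy False by auto
      qed
      then obtain \<alpha> \<beta> where ab: "\<phi> z = seq_scale \<alpha> (\<phi> x) + seq_scale \<beta> (\<phi> y)"
        unfolding gf.span_pair by blast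
      have "\<alpha> \<noteq> 0"
      proof
        assume "\<alpha> = 0"
        then have "\<phi> z = seq_scale \<beta> (\<phi> y)" using ab by simp
        then have "\<phi> z = \<phi> y" using gf.nonparallelD[OF np] z(1) xy(2) by blast
        then show False using inj z(1) xy(2) zy by (meson inj_onD)
      qed
      moreover have "\<phi> z = seq_scale \<alpha> (\<phi> x + seq_scale (\<beta> / \<alpha>) (\<phi> y))"
        using ab \<open>\<alpha> \<noteq> 0\<close> by (simp add: seq.scale_right_distrib)
      ultimately show ?thesis using z(1) fz kg(2) by (metis nonzero_imp_inverse_nonzero)
    qed
    then obtain z \<alpha> s c where zs: "\<And>t. z t \<in> ?E" "\<And>t. \<alpha> t \<noteq> 0"
        "\<And>t. \<phi> (z t) = seq_scale (\<alpha> t) (\<phi> x + seq_scale (s t) (\<phi> y))"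
        "\<And>t. c t \<noteq> 0" "\<And>t. f (z t) = seq_scale (c t) (f x + seq_scale t (f y))"
      by metis
    have "inj s"
    proof (rule injI)
      fix t t' assume st: "s t = s t'"
      have "seq_scale (inverse (\<alpha> t)) (\<phi> (z t)) = \<phi> x + seq_scale (s t) (\<phi> y)"
        using zs(2)[of t] by (simp add: zs(3)[of t])
      also have "\<dots> = seq_scale (inverse (\<alpha> t')) (\<phi> (z t'))"
        using zs(2)[of t'] st by (simp add: zs(3)[of t'])
      finally have eq: "seq_scale (inverse (\<alpha> t)) (\<phi> (z t)) = seq_scale (inverse (\<alpha> t')) (\<phi> (z t'))" .
      have "inverse (\<alpha> t) \<noteq> 0" by (rule nonzero_imp_inverse_nonzero[OF zs(2)])
      then have "\<phi> (z t) = \<phi> (z t')"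
        by (rule gf.nonparallel_scaled(1)[OF np imageI[OF zs(1)] imageI[OF zs(1)] eq])
      then have "z t = z t'" using inj zs(1) by (meson inj_onD)
      then have "seq_scale (c t) (f x + seq_scale t (f y)) = seq_scale (c t') (f x + seq_scale t' (f y))"
        using zs(5) by metis
      then have eq: "seq_scale (c t) (f x) + seq_scale (c t * t) (f y)
          = seq_scale (c t') (f x) + seq_scale (c t' * t') (f y)"
        by (simp add: seq.scale_right_distrib)
      from ind[OF this] show "t = t'" using zs(4)[of t] by simp
    qed
    then have "surj s" by (rule finite_UNIV_inj_surj[OF finite])
    show ?thesis
    \<comment> \<open>The case \<open>a = 0\<close> is the point \<open>y\<close>, which has no
      slope.\<close>
    proof (cases "a = 0")
      case True
      then show ?thesis using xy(2) by (auto simp: gf.cone_def)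
    next
      case False
      obtain t where t: "b / a = s t" using \<open>surj s\<close> by (metis surjD)
      have "\<phi> x + seq_scale (b / a) (\<phi> y) = seq_scale (inverse (\<alpha> t)) (\<phi> (z t))"
        using zs(2)[of t] t by (simp add: zs(3)[of t])
      then have "seq_scale a (\<phi> x + seq_scale (b / a) (\<phi> y)) = seq_scale (a * inverse (\<alpha> t)) (\<phi> (z t))"
        by simp
      moreover have "seq_scale a (\<phi> x + seq_scale (b / a) (\<phi> y)) = seq_scale a (\<phi> x) + seq_scale b (\<phi> y)"
        using False by (simp add: seq.scale_right_distrib)
      ultimately show ?thesis using zs(1)[of t] unfolding gf.cone_def by auto
    qed
  qed
  show ?thesis
  proof (rule seq.subspaceI)
    show "0 \<in> ?S" by (rule gf.conic_zero[OF gf.conic_cone])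
    show "seq_scale c v \<in> ?S" if "v \<in> ?S" for c v using gf.conic_scale[OF gf.conic_cone that] .
    show "v + w \<in> ?S" if vw: "v \<in> ?S" "w \<in> ?S" for v w
    proof (cases "v = 0 \<or> w = 0")
      case True
      then show ?thesis using vw by auto
    next
      case False
      obtain a x where x: "x \<in> ?E" "v = seq_scale a (\<phi> x)" using gf.coneE[OF vw(1)] False by blast
      obtain b y where y: "y \<in> ?E" "w = seq_scale b (\<phi> y)" using gf.coneE[OF vw(2)] False by blast
      show ?thesis
      proof (cases "x = y")
        case True
        then have "v + w = seq_scale (a + b) (\<phi> x)" using x y by (simp add: seq.scale_left_distrib)
        then show ?thesis using x(1) unfolding gf.cone_def by blast
      next
        case False
        then show ?thesis using line x y by simp
      qed
    qed
  qed
qed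

section \<open>Coordinates and recognition of projective geometries\<close>

definition unit_vector :: "nat \<Rightarrow> nat \<Rightarrow> 'f::field" where
  "unit_vector i = (\<lambda>j. if j = i then 1 else 0)"

lemma sum_unit_vectors: "(\<Sum>i<n. seq_scale (u i) (unit_vector i)) = (\<lambda>j. if j < n then u j else 0)"
  by (induction n) (auto simp: fun_eq_iff unit_vector_def seq_scale_def less_Suc_eq)

lemma unit_vectors_basis:
  "inj (unit_vector :: nat \<Rightarrow> nat \<Rightarrow> 'f::field)"
  "seq.independent ((unit_vector :: nat \<Rightarrow> nat \<Rightarrow> 'f) ` {..<n})"
  "seq.span ((unit_vector :: nat \<Rightarrow> nat \<Rightarrow> 'f) ` {..<n}) = vectors n"
proof -
  let ?e = "unit_vector :: nat \<Rightarrow> nat \<Rightarrow> 'f"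
  show inj: "inj ?e" by (rule injI) (metis unit_vector_def zero_neq_one)
  have injn: "inj_on ?e {..<n}" using inj inj_on_subset by blast
  show "seq.independent (?e ` {..<n})"
  proof (rule seq.independent_if_scalars_zero)
    fix u x assume s: "(\<Sum>x\<in>?e ` {..<n}. seq_scale (u x) x) = 0" and x: "x \<in> ?e ` {..<n}"
    obtain i where i: "i < n" "x = ?e i" using x by blast
    have "(\<Sum>i<n. seq_scale (u (?e i)) (?e i)) = 0" using s by (simp add: sum.reindex[OF injn])
    then have "(\<lambda>j. if j < n then u (?e j) else 0) = 0" unfolding sum_unit_vectors[of "\<lambda>i. u (?e i)" n] .
    from fun_cong[OF this, of i] show "u x = 0" using i by simp
  qed simp
  show "seq.span (?e ` {..<n}) = vectors n"
  proof
    have "?e ` {..<n} \<subseteq> vectors n" by (auto simp: unit_vector_def vectors_def)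
    then show "seq.span (?e ` {..<n}) \<subseteq> vectors n" by (rule seq.span_minimal[OF _ subspace_vectors])
    show "vectors n \<subseteq> seq.span (?e ` {..<n})"
    proof
      fix v :: "nat \<Rightarrow> 'f" assume "v \<in> vectors n"
      then have "v = (\<lambda>j. if j < n then v j else 0)" by (auto simp: vectors_def fun_eq_iff)
      also have "\<dots> = (\<Sum>i<n. seq_scale (v i) (?e i))" by (rule sum_unit_vectors[symmetric])
      also have "\<dots> \<in> seq.span (?e ` {..<n})" by (intro seq.span_sum seq.span_scale seq.span_base) simp
      finally show "v \<in> seq.span (?e ` {..<n})" .
    qed
  qed
qed

text \<open>A linear isomorphism from the cone onto \<open>vectors n\<close> carries the elements of
  \<open>M\<close> to one representative of each parallel class of nonzero vectors.\<close>

lemma subspace_cone_projective: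
  fixes K :: "'f::{field,finite} itself" and \<phi> :: "'a \<Rightarrow> nat \<Rightarrow> 'f"
  assumes \<phi>: "represents \<phi> M" and inj: "inj_on \<phi> (ground M)" and np: "gf.nonparallel (\<phi> ` ground M)"
    and S: "seq.subspace (gf.cone (\<phi> ` ground M))"
  shows "projective_geometry K M"
proof -
  let ?E = "ground M" and ?S = "gf.cone (\<phi> ` ground M)"
  let ?e = "unit_vector :: nat \<Rightarrow> nat \<Rightarrow> 'f"
  have finS: "finite ?S" using \<phi> gf.finite_cone by (auto simp: represents_def)
  obtain B where B: "B \<subseteq> ?S" "seq.independent B" "?S \<subseteq> seq.span B"
    using seq.maximal_independent_subset by blast
  have finB: "finite B" using finite_subset[OF B(1) finS] .
  define n where "n = card B"
  let ?V = "vector_matroid n :: (nat \<Rightarrow> 'f) matroid_data" and ?C = "?e ` {..<n}"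
  have cardC: "card ?C = n" using card_image[of ?e "{..<n}"] unit_vectors_basis(1) inj_on_subset by (metis card_lessThan subset_UNIV)
  have CV: "?C \<subseteq> vectors n" "vectors n \<subseteq> seq.span ?C"
    using unit_vectors_basis(3)[of n, where 'f='f] seq.span_superset[of ?C] by auto
  have dimS: "card B = seq.dim ?S" by (rule seq.basis_card_eq_dim[OF B(1,3,2)])
  have dimV: "card ?C = seq.dim (vectors n :: (nat \<Rightarrow> 'f) set)"
    by (rule seq.basis_card_eq_dim[OF CV unit_vectors_basis(2)])
  have "seq.dim ?S = seq.dim (vectors n :: (nat \<Rightarrow> 'f) set)" using dimS dimV cardC n_def by simp
  then have "\<exists>g. Vector_Spaces.linear seq_scale seq_scale g \<and> g ` B = ?C \<and> g ` ?S = vectors n \<and> inj_on g ?S"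
    by (rule gf.endo.finite_basis_to_basis_subspace_isomorphism[OF S subspace_vectors])
      (use finB B dimS CV unit_vectors_basis(2)[of n, where 'f='f] dimV in auto)
  then obtain g where g: "Vector_Spaces.linear seq_scale seq_scale g" "g ` ?S = vectors n" "inj_on g ?S"
    by blast
  have ES: "\<phi> ` ?E \<subseteq> ?S" by (rule gf.cone_superset)
  define X where "X = g ` \<phi> ` ?E"
  have XV: "X \<subseteq> vectors n" using ES g(2) unfolding X_def by blast
  have g0: "g 0 = 0" by (rule gf.endo.linear_0[OF g(1)])
  have gz: "s = 0" if "s \<in> ?S" "g s = 0" for s
    using g(3) that gf.conic_zero[OF gf.conic_cone] g0 by (metis inj_onD)
  note nl = vector_matroid_nonloops and par = vector_matroid_parallel
  have E0: "\<phi> x \<noteq> 0" if "x \<in> ?E" for x using np that unfolding gf.nonparallel_def by (metis imageI)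
  have Xnl: "X \<subseteq> nonloops ?V"
  proof
    fix v assume v: "v \<in> X"
    then obtain x where x: "x \<in> ?E" "v = g (\<phi> x)" unfolding X_def by blast
    have "\<phi> x \<in> ?S" using ES x(1) by blast
    then have "v \<noteq> 0" using gz E0[OF x(1)] x(2) by metis
    then show "v \<in> nonloops ?V" using nl v XV by (meson subsetD)
  qed
  have "is_simplification_of (restriction ?V X) ?V" unfolding is_simplification_of_def
  proof (intro exI[of _ X] conjI ballI)
    fix u assume u: "u \<in> nonloops ?V"
    then obtain s where s: "s \<in> ?S" "u = g s" using nl g(2) by blast
    have "s \<noteq> 0" using u s nl g0 by auto
    then obtain c x where x: "x \<in> ?E" "c \<noteq> 0" "s = seq_scale c (\<phi> x)"
      using s(1) by (auto elim!: gf.coneE)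
    have ux: "u = seq_scale c (g (\<phi> x))" using s x by (simp add: gf.endo.linear_scale[OF g(1)])
    have gx: "g (\<phi> x) \<in> X" using x(1) by (simp add: X_def)
    show "\<exists>!v. v \<in> X \<and> parallel ?V u v"
    proof (rule ex1I[of _ "g (\<phi> x)"])
      show "g (\<phi> x) \<in> X \<and> parallel ?V u (g (\<phi> x))"
        using gx u Xnl par ux by blast
      fix v assume v: "v \<in> X \<and> parallel ?V u v"
      then obtain d where d: "u = seq_scale d v" using par by blast
      obtain y where y: "y \<in> ?E" "v = g (\<phi> y)" using v unfolding X_def by blast
      have "g (seq_scale c (\<phi> x)) = g (seq_scale d (\<phi> y))"
        using ux d y by (simp add: gf.endo.linear_scale[OF g(1)])
      then have "seq_scale c (\<phi> x) = seq_scale d (\<phi> y)"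
        using g(3) ES x(1) y(1) gf.conic_scale[OF gf.conic_cone]
        by (meson imageI inj_onD subsetD)
      then have "\<phi> x = \<phi> y"
        using gf.nonparallel_scaled(1)[OF np] x(1,2) y(1) by blast
      then show "v = g (\<phi> x)" using y by simp
    qed
  qed (use Xnl in auto)
  moreover have "matroid_iso M (restriction ?V X)" unfolding matroid_iso_def
  proof (intro exI[of _ "g \<circ> \<phi>"] conjI allI impI)
    have "inj_on (g \<circ> \<phi>) ?E" using inj g(3) ES by (meson comp_inj_on inj_on_subset)
    then show "bij_betw (g \<circ> \<phi>) ?E (ground (restriction ?V X))"
      by (simp add: bij_betw_def restriction_def X_def image_comp)
    fix Z assume Z: "Z \<subseteq> ?E"
    have injZ: "inj_on \<phi> Z" using inj Z inj_on_subset by blast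
    have ZS: "\<phi> ` Z \<subseteq> ?S" using Z ES by blast
    have spanZ: "seq.span (\<phi> ` Z) \<subseteq> ?S" by (rule seq.span_minimal[OF ZS S])
    have finZ: "finite (\<phi> ` Z)" using finite_subset[OF ZS finS] .
    have "seq.independent (\<phi> ` Z) \<longleftrightarrow> seq.independent (g ` \<phi> ` Z)"
    proof
      assume "seq.independent (\<phi> ` Z)"
      then show "seq.independent (g ` \<phi> ` Z)"
        by (rule gf.endo.linear_independent_injective_image[OF g(1)]) (rule inj_on_subset[OF g(3) spanZ])
    next
      assume "seq.independent (g ` \<phi> ` Z)"
      then show "seq.independent (\<phi> ` Z)"
        by (rule gf.independent_inj_image_imp[OF g(1) finZ inj_on_subset[OF g(3) ZS]])
    qed
    moreover have "(g \<circ> \<phi>) ` Z \<subseteq> X" using Z by (auto simp: X_def)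
    ultimately show "indep M Z \<longleftrightarrow> indep (restriction ?V X) ((g \<circ> \<phi>) ` Z)"
      using \<phi> Z injZ XV by (auto simp: represents_def restriction_def vector_matroid_def image_comp)
  qed
  ultimately show ?thesis
    unfolding projective_geometry_def using represents_matroid[OF \<phi>] by blast
qed

section \<open>From chordal matroids to decomposable sets\<close>

lemma cone_Un: "gf.cone (A \<union> B) = gf.cone A \<union> gf.cone B"
  by (auto simp: gf.cone_def)

text \<open>The claim is made for every representation, so that one and the same
  \<open>\<phi>\<close> can be restricted to both parts of a gluing. The flats of the connection
  then determine how the two spans meet.\<close>

lemma chordal_decomposable:
  fixes K :: "'f::{field,finite} itself"
  assumes "chordal K M"
  shows "represents (\<phi> :: 'a \<Rightarrow> nat \<Rightarrow> 'f) M \<Longrightarrow> gf.decomposable (gf.cone (\<phi> ` ground M))"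
  using assms
proof (induction arbitrary: \<phi> rule: chordal.induct)
  case (projective M)
  then show ?case by (intro gf.decomposable.full projective_cone_subspace)
next
  case (glue M1 M2 N M)
  note \<phi> = \<open>represents \<phi> M\<close>
  let ?E1 = "ground M1" and ?E2 = "ground M2" and ?T = "ground M1 \<inter> ground M2"
  have G: "matroid M1" "matroid M2" "matroid M" "ground N = ?T"
    "restriction M1 (ground N) = N" "restriction M2 (ground N) = N"
    "ground M = ?E1 \<union> ?E2"
    and flats: "\<And>F. flat M F \<longleftrightarrow> F \<subseteq> ?E1 \<union> ?E2 \<and> flat M1 (F \<inter> ?E1) \<and> flat M2 (F \<inter> ?E2)"
    using \<open>generalized_parallel_connection N M1 M2 M\<close>
    unfolding generalized_parallel_connection_def by blast+
  interpret M1: matroid M1 by (rule G)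
  interpret M2: matroid M2 by (rule G)
  have N1: "indep N I \<longleftrightarrow> I \<subseteq> ?T \<and> indep M1 I" for I
    using arg_cong[OF G(5), of "\<lambda>N. indep N I"] G(4) by (simp add: restriction_def)
  have N2: "indep N I \<longleftrightarrow> I \<subseteq> ?T \<and> indep M2 I" for I
    using arg_cong[OF G(6), of "\<lambda>N. indep N I"] G(4) by (simp add: restriction_def)
  have i1: "indep M X \<longleftrightarrow> indep M1 X" if "X \<subseteq> ?E1" for X
    by (rule glued_indep_iff[OF G(1-3) _ G(7) flats that]) (use N1 N2 in blast)
  have i2: "indep M X \<longleftrightarrow> indep M2 X" if "X \<subseteq> ?E2" for X
  proof (rule glued_indep_iff[OF G(2,1,3) _ _ _ that])
    show "indep M2 I \<longleftrightarrow> indep M1 I" if "I \<subseteq> ?E2 \<inter> ?E1" for I using N1 N2 that by blast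
    show "ground M = ?E2 \<union> ?E1" using G(7) by blast
    show "flat M F \<longleftrightarrow> F \<subseteq> ?E2 \<union> ?E1 \<and> flat M2 (F \<inter> ?E2) \<and> flat M1 (F \<inter> ?E1)" for F
      using flats[of F] by blast
  qed
  have rep: "represents \<phi> L"
    if L: "matroid L" "ground L \<subseteq> ground M" "\<And>X. X \<subseteq> ground L \<Longrightarrow> indep M X \<longleftrightarrow> indep L X" for L
  proof -
    interpret L: matroid L by (rule L(1))
    have "indep L X \<longleftrightarrow> X \<subseteq> ground L \<and> indep M X" for X
      using L(3)[of X] L.indep_subset_ground[of X] by metis
    then have "indep L X \<longleftrightarrow> X \<subseteq> ground L \<and> inj_on \<phi> X \<and> seq.independent (\<phi> ` X)" for X
      using \<phi> L(2) unfolding represents_def by (metis subset_trans)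
    then show ?thesis using L.finite_ground unfolding represents_def by blast
  qed
  have r1: "represents \<phi> M1" by (rule rep[OF G(1) _ i1]) (use G(7) in auto)
  have r2: "represents \<phi> M2" by (rule rep[OF G(2) _ i2]) (use G(7) in auto)
  have rN: "represents \<phi> N"
    using represents_restriction[OF r1, of "ground N"] G(4,5) by simp
  let ?S1 = "gf.cone (\<phi> ` ?E1)" and ?S2 = "gf.cone (\<phi> ` ?E2)"
  have sub: "seq.subspace (gf.cone (\<phi> ` ?T))"
    using projective_cone_subspace[OF \<open>projective_geometry K N\<close> rN] G(4) by simp
  have spanT: "seq.span (\<phi> ` ?T) \<subseteq> gf.cone (\<phi> ` ?T)"
    by (rule seq.span_minimal[OF gf.cone_superset sub])
  \<comment> \<open>Otherwise \<open>w\<close> involves an element \<open>b\<close> of a basis of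
    \<open>M1\<close> beyond a basis of \<open>?T\<close>. The hyperplane \<open>?C\<close> spanned
    by the other basis elements contains \<open>?T\<close>, so \<open>?C \<union> ?E2\<close> is a
    flat of \<open>M\<close>; its span contains \<open>w\<close>, which forces \<open>b\<close> into
    it.\<close>
  have cap: "w \<in> seq.span (\<phi> ` ?T)" if w: "w \<in> seq.span (\<phi> ` ?E1)" "w \<in> seq.span (\<phi> ` ?E2)" for w
  proof (rule ccontr)
    assume wT: "w \<notin> seq.span (\<phi> ` ?T)"
    obtain BT where BT: "BT \<subseteq> ?T" "indep M1 BT" "card BT = rank_of M1 ?T"
      using M1.ex_basis[of ?T] by blast
    have "BT \<subseteq> ?E1" using BT(1) by blast
    then obtain B1 where B1: "BT \<subseteq> B1" "B1 \<subseteq> ?E1" "indep M1 B1" "card B1 = rank_of M1 ?E1"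
      using M1.ex_basis_extending[OF BT(2) _ subset_refl] by blast
    have sT: "seq.span (\<phi> ` BT) = seq.span (\<phi> ` ?T)"
      by (rule represents_basis_span[OF r1 _ BT]) blast
    have s1: "seq.span (\<phi> ` B1) = seq.span (\<phi> ` ?E1)"
      by (rule represents_basis_span[OF r1 subset_refl B1(2-4)])
    have finB: "finite (\<phi> ` B1)" using M1.finite_subset_ground[OF B1(2)] by simp
    obtain u where u: "w = gf.comb (\<phi> ` B1) u" using gf.span_finite_comb[OF finB] w(1) s1 by blast
    have "\<exists>b\<in>B1 - BT. u (\<phi> b) \<noteq> 0"
    proof (rule ccontr)
      assume none: "\<not> ?thesis"
      have "w = gf.comb (\<phi> ` BT) u" unfolding u
        by (rule gf.comb_support[OF finB]) (use B1(1) none in auto)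
      then show False using wT gf.comb_span[of "\<phi> ` BT" u] sT by simp
    qed
    then obtain b where b: "b \<in> B1" "b \<notin> BT" "u (\<phi> b) \<noteq> 0" by blast
    have ind: "indep M1 (B1 - {b})" using M1.indep_mono[OF B1(3)] by blast
    have bspan: "\<phi> b \<notin> seq.span (\<phi> ` (B1 - {b}))"
      using represents_insert[OF r1 ind, of b] b(1) B1(2,3) by (auto simp: insert_absorb)
    let ?C = "closure_of M1 (B1 - {b})"
    have Bg: "B1 - {b} \<subseteq> ?E1" using B1(2) by blast
    have inC: "e \<in> ?C \<longleftrightarrow> \<phi> e \<in> seq.span (\<phi> ` (B1 - {b}))" if "e \<in> ?E1" for e
      by (rule represents_closure[OF r1 Bg that])
    have BTb: "\<phi> ` BT \<subseteq> \<phi> ` (B1 - {b})" using B1(1) b(2) by blast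
    have TC: "?T \<subseteq> ?C"
    proof
      fix e assume e: "e \<in> ?T"
      then have "\<phi> e \<in> seq.span (\<phi> ` BT)" using sT seq.span_base[of "\<phi> e" "\<phi> ` ?T"] by blast
      then have "\<phi> e \<in> seq.span (\<phi> ` (B1 - {b}))" using seq.span_mono[OF BTb] by blast
      then show "e \<in> ?C" using inC e by blast
    qed
    let ?F = "?C \<union> ?E2"
    have CE: "?C \<subseteq> ?E1" by (rule M1.closure_subset_ground)
    have "?F \<inter> ?E1 = ?C" "?F \<inter> ?E2 = ?E2" using TC CE by blast+
    then have F: "flat M ?F"
      using flats[of ?F] M1.flat_closure[OF Bg] M2.flat_ground CE by auto
    have BF: "B1 - {b} \<subseteq> ?F" using M1.closure_superset[OF Bg] by blast
    have finb: "finite (\<phi> ` (B1 - {b}))" by (rule finite_subset[OF _ finB]) blast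
    have "gf.comb (\<phi> ` B1) u = seq_scale (u (\<phi> b)) (\<phi> b) + gf.comb (\<phi> ` B1 - {\<phi> b}) u"
      unfolding gf.comb_def using b(1) by (intro sum.remove[OF finB]) simp
    moreover have "gf.comb (\<phi> ` B1 - {\<phi> b}) u \<in> seq.span (\<phi> ` ?F)"
    proof -
      have "\<phi> ` B1 - {\<phi> b} \<subseteq> \<phi> ` ?F" using BF by blast
      then show ?thesis using gf.comb_span seq.span_mono by blast
    qed
    moreover have "w \<in> seq.span (\<phi> ` ?F)" using w(2) seq.span_mono[of "\<phi> ` ?E2" "\<phi> ` ?F"] by blast
    ultimately have "seq_scale (u (\<phi> b)) (\<phi> b) \<in> seq.span (\<phi> ` ?F)"
      unfolding u by (metis add_diff_cancel_right' seq.span_diff)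
    then have "seq_scale (inverse (u (\<phi> b))) (seq_scale (u (\<phi> b)) (\<phi> b)) \<in> seq.span (\<phi> ` ?F)"
      by (rule seq.span_scale)
    then have "\<phi> b \<in> seq.span (\<phi> ` ?F)" using b(3) by simp
    then have "b \<in> ?F" using F represents_flat[OF \<phi>] b(1) B1(2) G(7) by blast
    then have "b \<in> ?C" using TC b(1) B1(2) by blast
    then show False using inC[of b] bspan b(1) B1(2) by blast
  qed
  have "seq.span ?S1 \<inter> seq.span ?S2 \<subseteq> ?S1 \<inter> ?S2"
  proof
    fix w assume "w \<in> seq.span ?S1 \<inter> seq.span ?S2"
    then have "w \<in> gf.cone (\<phi> ` ?T)" using cap[of w] spanT by (auto simp: gf.span_cone)
    then show "w \<in> ?S1 \<inter> ?S2" by (auto simp: gf.cone_def)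
  qed
  then have "gf.decomposable (?S1 \<union> ?S2)"
    using gf.decomposable.union glue.IH(1)[OF r1] glue.IH(2)[OF r2] by blast
  then show ?case by (simp add: G(7) image_Un cone_Un)
qed

section \<open>From decomposable sets to chordal matroids\<close>

lemma span_Int_full:
  fixes \<phi> :: "'a \<Rightarrow> nat \<Rightarrow> 'f::{field,finite}"
  assumes \<phi>: "represents \<phi> M" and T: "T \<subseteq> ground M" "seq.subspace (gf.cone (\<phi> ` T))" and F: "flat M F"
  shows "seq.span (\<phi> ` T) \<inter> seq.span (\<phi> ` F) \<subseteq> seq.span (\<phi> ` (T \<inter> F))"
proof
  fix v assume v: "v \<in> seq.span (\<phi> ` T) \<inter> seq.span (\<phi> ` F)"
  show "v \<in> seq.span (\<phi> ` (T \<inter> F))"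
  proof (cases "v = 0")
    case True
    then show ?thesis by (simp add: seq.span_zero)
  next
    case False
    have "v \<in> gf.cone (\<phi> ` T)" using v seq.span_minimal[OF gf.cone_superset T(2)] by blast
    then obtain c t where t: "t \<in> T" "c \<noteq> 0" "v = seq_scale c (\<phi> t)"
      using False by (auto elim!: gf.coneE)
    have "\<phi> t = seq_scale (inverse c) v" using t by simp
    also have "\<dots> \<in> seq.span (\<phi> ` F)" using v by (simp add: seq.span_scale)
    finally have "t \<in> F" using F represents_flat[OF \<phi>] t(1) T(1) by blast
    then show ?thesis using t by (simp add: seq.span_base seq.span_scale)
  qed
qed

text \<open>A basis of \<open>T \<inter> F\<close> is extended to bases of \<open>T\<close> and of
  \<open>F\<close>. As a full \<open>T\<close> meets the span of \<open>F\<close> only in the span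
  of \<open>T \<inter> F\<close>, their union is independent and the rank formula is a
  count.\<close>

lemma full_flat_modular:
  fixes \<phi> :: "'a \<Rightarrow> nat \<Rightarrow> 'f::{field,finite}"
  assumes \<phi>: "represents \<phi> M" and inj: "inj_on \<phi> (ground M)"
    and T: "flat M T" "seq.subspace (gf.cone (\<phi> ` T))"
  shows "modular_flat M T"
  unfolding modular_flat_def
proof (intro conjI allI impI T(1))
  interpret matroid M using \<phi> by (rule represents_matroid)
  fix F assume F: "flat M F"
  have g: "T \<subseteq> ground M" "F \<subseteq> ground M" "T \<inter> F \<subseteq> ground M" "T \<union> F \<subseteq> ground M"
    using T(1) F flatD by blast+
  obtain B0 where B0: "B0 \<subseteq> T \<inter> F" "indep M B0" "card B0 = rank_of M (T \<inter> F)"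
    using ex_basis[OF g(3)] .
  have B0': "B0 \<subseteq> T" "B0 \<subseteq> F" using B0(1) by blast+
  obtain P where P: "B0 \<subseteq> P" "P \<subseteq> T" "indep M P" "card P = rank_of M T"
    using ex_basis_extending[OF B0(2) B0'(1) g(1)] .
  obtain Q where Q: "B0 \<subseteq> Q" "Q \<subseteq> F" "indep M Q" "card Q = rank_of M F"
    using ex_basis_extending[OF B0(2) B0'(2) g(2)] .
  have PQ: "P \<inter> Q = B0"
  proof
    show "B0 \<subseteq> P \<inter> Q" using P Q by blast
    show "P \<inter> Q \<subseteq> B0"
    proof (rule subsetI, rule ccontr)
      fix e assume e: "e \<in> P \<inter> Q" "e \<notin> B0"
      have eg: "e \<in> ground M" "e \<in> T \<inter> F" using e P Q g by blast+
      have "indep M (insert e B0)" using indep_mono[OF P(3)] P(1) e by blast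
      moreover have "e \<in> closure_of M (T \<inter> F)" using closure_superset[OF g(3)] eg by blast
      ultimately show False using in_closure_iff[OF g(3) B0 eg(1)] e(2) by blast
    qed
  qed
  have s: "seq.span (\<phi> ` P) = seq.span (\<phi> ` T)" "seq.span (\<phi> ` Q) = seq.span (\<phi> ` F)"
    "seq.span (\<phi> ` B0) = seq.span (\<phi> ` (T \<inter> F))"
    using represents_basis_span[OF \<phi> g(1) P(2-4)] represents_basis_span[OF \<phi> g(2) Q(2-4)]
      represents_basis_span[OF \<phi> g(3) B0] by blast+
  have Pg: "P \<subseteq> ground M" "Q \<subseteq> ground M" using P Q g by blast+
  have fin: "finite P" "finite Q" using Pg finite_subset_ground by blast+
  have im: "\<phi> ` P \<inter> \<phi> ` Q = \<phi> ` B0" using inj_on_image_Int[OF inj Pg] PQ by simp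
  have "seq.independent (\<phi> ` P \<union> \<phi> ` Q)"
  proof (rule gf.independent_Un)
    show "seq.span (\<phi> ` P) \<inter> seq.span (\<phi> ` Q) \<subseteq> seq.span (\<phi> ` P \<inter> \<phi> ` Q)"
      unfolding im s by (rule span_Int_full[OF \<phi> g(1) T(2) F])
  qed (use fin P(3) Q(3) \<phi> in \<open>auto simp: represents_def\<close>)
  moreover have "inj_on \<phi> (P \<union> Q)" using inj Pg by (meson Un_least inj_on_subset)
  ultimately have ind: "indep M (P \<union> Q)" using \<phi> Pg by (simp add: represents_def image_Un)
  have "rank_of M (T \<union> F) \<le> card (P \<union> Q)"
  proof (rule rank_le[OF g(4)])
    fix I assume I: "I \<subseteq> T \<union> F" "indep M I"
    have "seq.span (\<phi> ` P) \<subseteq> seq.span (\<phi> ` (P \<union> Q))" "seq.span (\<phi> ` Q) \<subseteq> seq.span (\<phi> ` (P \<union> Q))"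
      by (rule seq.span_mono[OF image_mono], blast)+
    then have "\<phi> ` T \<subseteq> seq.span (\<phi> ` (P \<union> Q))" "\<phi> ` F \<subseteq> seq.span (\<phi> ` (P \<union> Q))"
      using s seq.span_superset[of "\<phi> ` T"] seq.span_superset[of "\<phi> ` F"] by blast+
    then have "\<phi> ` I \<subseteq> seq.span (\<phi> ` (P \<union> Q))" using I(1) by blast
    moreover have "inj_on \<phi> I" "seq.independent (\<phi> ` I)" using I(2) \<phi> by (auto simp: represents_def)
    ultimately have "card I \<le> card (\<phi> ` (P \<union> Q))"
      using seq.independent_span_bound[of "\<phi> ` (P \<union> Q)" "\<phi> ` I"] fin by (simp add: card_image)
    also have "\<dots> \<le> card (P \<union> Q)" using fin by (intro card_image_le) simp
    finally show "card I \<le> card (P \<union> Q)" .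
  qed
  moreover have "P \<union> Q \<subseteq> T \<union> F" using P Q by blast
  ultimately have "rank_of M (T \<union> F) = card (P \<union> Q)" using rank_ge[OF g(4) _ ind] by simp
  then show "rank_of M T + rank_of M F = rank_of M (T \<union> F) + rank_of M (T \<inter> F)"
    using card_Un_Int[OF fin] PQ P(4) Q(4) B0(3) by simp
qed

text \<open>The parts of the gluing are the elements represented in \<open>S1\<close> and in
  \<open>S2\<close>. Their common part is a projective geometry, since \<open>S1 \<inter> S2\<close>
  equals the intersection of the two spans and is therefore a subspace.\<close>

lemma decomposable_chordal:
  fixes K :: "'f::{field,finite} itself" and \<phi> :: "'a \<Rightarrow> nat \<Rightarrow> 'f"
  assumes "gf.decomposable S"
  shows "represents \<phi> M \<Longrightarrow> inj_on \<phi> (ground M) \<Longrightarrow> gf.nonparallel (\<phi> ` ground M) \<Longrightarrow>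
    S = gf.cone (\<phi> ` ground M) \<Longrightarrow> chordal K M"
  using assms
proof (induction arbitrary: M rule: gf.decomposable.induct)
  case (full S)
  then show ?case by (intro chordal.projective subspace_cone_projective) auto
next
  case (union S1 S2)
  note \<phi> = union.prems(1) and inj = union.prems(2) and np = union.prems(3) and S = union.prems(4)
  let ?E = "ground M"
  let ?E1 = "{e \<in> ?E. \<phi> e \<in> S1}" and ?E2 = "{e \<in> ?E. \<phi> e \<in> S2}"
  define T where "T = ?E1 \<inter> ?E2"
  have conic: "gf.conic S1" "gf.conic S2" using union.hyps gf.decomposable_conic by blast+
  have cone: "gf.cone (\<phi> ` {e \<in> ?E. \<phi> e \<in> U}) = U" if U: "gf.conic U" "U \<subseteq> S1 \<union> S2" for U
  proof
    show "gf.cone (\<phi> ` {e \<in> ?E. \<phi> e \<in> U}) \<subseteq> U"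
      using U(1) gf.conic_zero gf.conic_scale by (auto simp: gf.cone_def)
    show "U \<subseteq> gf.cone (\<phi> ` {e \<in> ?E. \<phi> e \<in> U})"
    proof
      fix v assume v: "v \<in> U"
      show "v \<in> gf.cone (\<phi> ` {e \<in> ?E. \<phi> e \<in> U})"
      proof (cases "v = 0")
        case False
        moreover have "v \<in> gf.cone (\<phi> ` ?E)" using v U(2) S by blast
        ultimately obtain c e where e: "e \<in> ?E" "c \<noteq> 0" "v = seq_scale c (\<phi> e)"
          by (auto elim!: gf.coneE)
        then have "\<phi> e \<in> U" using gf.conic_scale_iff[OF U(1) e(2)] v by blast
        then show ?thesis using e unfolding gf.cone_def by blast
      qed (simp add: gf.cone_def)
    qed
  qed
  have c1: "gf.cone (\<phi> ` ?E1) = S1" and c2: "gf.cone (\<phi> ` ?E2) = S2"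
    using cone conic by blast+
  have T_eq: "T = {e \<in> ?E. \<phi> e \<in> S1 \<inter> S2}" unfolding T_def by blast
  have cS: "gf.conic (S1 \<inter> S2)" using conic by (auto simp: gf.conic_def)
  have cT: "gf.cone (\<phi> ` T) = S1 \<inter> S2" unfolding T_eq by (rule cone[OF cS]) blast
  have cap: "S1 \<inter> S2 = seq.span S1 \<inter> seq.span S2"
    using union.hyps seq.span_superset[of S1] seq.span_superset[of S2] by blast
  have subT: "seq.subspace (gf.cone (\<phi> ` T))"
    unfolding cT cap by (intro seq.subspace_inter seq.subspace_span)
  have sub: "?E1 \<subseteq> ?E" "?E2 \<subseteq> ?E" "T \<subseteq> ?E" "T \<subseteq> ?E1" "T \<subseteq> ?E2" unfolding T_def by blast+
  let ?M1 = "restriction M ?E1" and ?M2 = "restriction M ?E2" and ?N = "restriction M T"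
  have g[simp]: "ground (restriction M X) = X" for X by (simp add: restriction_def)
  have r1: "represents \<phi> ?M1" and r2: "represents \<phi> ?M2" and rN: "represents \<phi> ?N"
    using represents_restriction[OF \<phi>] sub by blast+
  have inj': "inj_on \<phi> X" if "X \<subseteq> ?E" for X using inj_on_subset[OF inj that] .
  have np': "gf.nonparallel (\<phi> ` X)" if "X \<subseteq> ?E" for X
    using np that unfolding gf.nonparallel_def by (meson image_mono subsetD)
  have ch1: "chordal K ?M1"
    by (rule union.IH(1)[OF r1]) (use inj' np' sub c1 in simp_all)
  have ch2: "chordal K ?M2"
    by (rule union.IH(2)[OF r2]) (use inj' np' sub c2 in simp_all)
  have pN: "projective_geometry K ?N"
    by (rule subspace_cone_projective[OF rN]) (use inj' np' sub subT in simp_all)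
  have spans: "seq.span (\<phi> ` ?E1) = seq.span S1" "seq.span (\<phi> ` ?E2) = seq.span S2"
    using gf.span_cone[of "\<phi> ` ?E1"] gf.span_cone[of "\<phi> ` ?E2"] c1 c2 by auto
  have capT: "seq.span (\<phi> ` ?E1) \<inter> seq.span (\<phi> ` ?E2) = gf.cone (\<phi> ` T)"
    unfolding spans cT cap ..
  have E12: "?E = ?E1 \<union> ?E2" using S gf.cone_superset[of "\<phi> ` ?E"] by blast
  have flat_restr: "flat (restriction M X) F \<longleftrightarrow> F \<subseteq> X \<and> (\<forall>e\<in>X. \<phi> e \<in> seq.span (\<phi> ` F) \<longrightarrow> e \<in> F)"
    if "X \<subseteq> ?E" for X F
    using represents_flat[OF represents_restriction[OF \<phi> that], of F] by simp
  have flatT: "flat ?M1 T"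
  proof -
    have "seq.span (\<phi> ` T) \<subseteq> S1 \<inter> S2" using seq.span_minimal[OF gf.cone_superset subT] cT by simp
    then show ?thesis unfolding flat_restr[OF sub(1)] T_eq by blast
  qed
  have flats: "flat M F \<longleftrightarrow> F \<subseteq> ?E1 \<union> ?E2 \<and> flat ?M1 (F \<inter> ?E1) \<and> flat ?M2 (F \<inter> ?E2)" for F
  proof
    assume F: "flat M F"
    have mono: "seq.span (\<phi> ` (F \<inter> X)) \<subseteq> seq.span (\<phi> ` F)" for X by (rule seq.span_mono) blast
    show "F \<subseteq> ?E1 \<union> ?E2 \<and> flat ?M1 (F \<inter> ?E1) \<and> flat ?M2 (F \<inter> ?E2)"
      using F mono E12 unfolding represents_flat[OF \<phi>] flat_restr[OF sub(1)] flat_restr[OF sub(2)]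
      by blast
  next
    assume R: "F \<subseteq> ?E1 \<union> ?E2 \<and> flat ?M1 (F \<inter> ?E1) \<and> flat ?M2 (F \<inter> ?E2)"
    then have F: "F \<subseteq> ?E1 \<union> ?E2"
      and F1: "\<And>e. e \<in> ?E1 \<Longrightarrow> \<phi> e \<in> seq.span (\<phi> ` (F \<inter> ?E1)) \<Longrightarrow> e \<in> F"
      and F2: "\<And>e. e \<in> ?E2 \<Longrightarrow> \<phi> e \<in> seq.span (\<phi> ` (F \<inter> ?E2)) \<Longrightarrow> e \<in> F"
      unfolding flat_restr[OF sub(1)] flat_restr[OF sub(2)] by blast+
    let ?W1 = "seq.span (\<phi> ` (F \<inter> ?E1))" and ?W2 = "seq.span (\<phi> ` (F \<inter> ?E2))"
    have W: "?W1 \<subseteq> seq.span (\<phi> ` ?E1)" "?W2 \<subseteq> seq.span (\<phi> ` ?E2)" by (rule seq.span_mono, blast)+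
    \<comment> \<open>A nonzero vector of the common part that lies in one of the two spans is a
      multiple of an element \<open>t\<close> of \<open>F\<close>, by flatness in that part, and
      then lies in the other span as well.\<close>
    have common: "v \<in> ?W1 \<and> v \<in> ?W2" if v: "v \<in> gf.cone (\<phi> ` T)" "v \<in> ?W1 \<or> v \<in> ?W2" for v
    proof (cases "v = 0")
      case True
      then show ?thesis by (simp add: seq.span_zero)
    next
      case False
      then obtain c t where t: "t \<in> T" "c \<noteq> 0" "v = seq_scale c (\<phi> t)"
        using v(1) by (auto elim!: gf.coneE)
      have t': "\<phi> t = seq_scale (inverse c) v" using t by simp
      have tE: "t \<in> ?E1" "t \<in> ?E2" using t(1) sub by blast+
      have "t \<in> F"
        using v(2)
      proof
        assume "v \<in> ?W1"
        then have "\<phi> t \<in> ?W1" unfolding t' by (rule seq.span_scale)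
        then show ?thesis by (rule F1[OF tE(1)])
      next
        assume "v \<in> ?W2"
        then have "\<phi> t \<in> ?W2" unfolding t' by (rule seq.span_scale)
        then show ?thesis by (rule F2[OF tE(2)])
      qed
      then have "\<phi> t \<in> ?W1" "\<phi> t \<in> ?W2" using tE by (auto intro: seq.span_base)
      then show ?thesis by (simp add: t(3) seq.span_scale)
    qed
    have "e \<in> F" if e: "e \<in> ?E" "\<phi> e \<in> seq.span (\<phi> ` F)" for e
    proof -
      have "\<phi> ` F = \<phi> ` (F \<inter> ?E1) \<union> \<phi> ` (F \<inter> ?E2)" using F by blast
      then have "seq.span (\<phi> ` F) = {x + y |x y. x \<in> ?W1 \<and> y \<in> ?W2}" by (simp only: seq.span_Un)
      \<comment> \<open>For \<open>e\<close> in the first part, \<open>w2\<close> is a difference of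
        vectors in the span of that part and hence common to both; so \<open>\<phi> e\<close> is
        already spanned by \<open>F \<inter> ?E1\<close>.\<close>
      then obtain w1 w2 where w: "w1 \<in> ?W1" "w2 \<in> ?W2" "\<phi> e = w1 + w2" using e(2) by blast
      consider "e \<in> ?E1" | "e \<in> ?E2" using e(1) E12 by blast
      then show "e \<in> F"
      proof cases
        case 1
        have "\<phi> e - w1 \<in> seq.span (\<phi> ` ?E1)"
          by (rule seq.span_diff[OF seq.span_base[OF imageI[OF 1]] subsetD[OF W(1) w(1)]])
        then have "w2 \<in> seq.span (\<phi> ` ?E1)" using w(3) by simp
        then have "w2 \<in> gf.cone (\<phi> ` T)" using capT w(2) W(2) by blast
        then have "w2 \<in> ?W1" using common w(2) by blast
        then have "\<phi> e \<in> ?W1" unfolding w(3) by (rule seq.span_add[OF w(1)])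
        then show ?thesis using F1 1 by blast
      next
        case 2
        have "\<phi> e - w2 \<in> seq.span (\<phi> ` ?E2)"
          by (rule seq.span_diff[OF seq.span_base[OF imageI[OF 2]] subsetD[OF W(2) w(2)]])
        then have "w1 \<in> seq.span (\<phi> ` ?E2)" using w(3) by simp
        then have "w1 \<in> gf.cone (\<phi> ` T)" using capT w(1) W(1) by blast
        then have "w1 \<in> ?W2" using common w(1) by blast
        then have "\<phi> e \<in> ?W2" unfolding w(3) by (rule seq.span_add[OF _ w(2)])
        then show ?thesis using F2 2 by blast
      qed
    qed
    then show "flat M F" unfolding represents_flat[OF \<phi>] using F E12 by blast
  qed
  have "generalized_parallel_connection ?N ?M1 ?M2 M"
    unfolding generalized_parallel_connection_def g
  proof (intro conjI allI)
    show "matroid ?M1" "matroid ?M2" "matroid M" using r1 r2 \<phi> represents_matroid by blast+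
    show "T = ?E1 \<inter> ?E2" by (rule T_def)
    show "restriction ?M1 T = ?N" "restriction ?M2 T = ?N"
      using sub(4,5) by (auto simp: restriction_def fun_eq_iff)
    show "modular_flat ?M1 T"
      by (rule full_flat_modular[OF r1 _ flatT subT]) (use inj' sub(1) in simp)
    show "ground M = ?E1 \<union> ?E2" by (rule E12)
    show "flat M F \<longleftrightarrow> F \<subseteq> ?E1 \<union> ?E2 \<and> flat ?M1 (F \<inter> ?E1) \<and> flat ?M2 (F \<inter> ?E2)" for F by (rule flats)
  qed
  then show ?case by (rule chordal.glue[OF ch1 ch2 pN])
qed

section \<open>Uniform matroids\<close>

text \<open>Three points make the line full, with \<open>q^2\<close> vectors, whereas
  \<open>k \<le> q\<close> points together with 0 have at most \<open>1 + q (q - 1)\<close>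
  multiples.\<close>

lemma decomposable_not_line:
  fixes \<psi> :: "'a \<Rightarrow> nat \<Rightarrow> 'f::{field,finite}"
  assumes \<psi>: "represents \<psi> N" and dec: "gf.decomposable (gf.cone (\<psi> ` ground N))"
    and k: "2 < k" "k \<le> CARD('f)"
  shows "\<not> matroid_iso N (uniform_matroid 2 k)"
proof
  assume iso: "matroid_iso N (uniform_matroid 2 k)"
  let ?E = "ground N" and ?S = "gf.cone (\<psi> ` ground N)"
  have fin: "finite ?E" using \<psi> by (simp add: represents_def)
  have U: "card ?E = k" "\<And>X. X \<subseteq> ?E \<Longrightarrow> indep N X \<longleftrightarrow> card X \<le> 2"
    using iso matroid_iso_uniform_iff[OF fin] by blast+
  have pair: "indep N {x, y}" if "x \<in> ?E" "y \<in> ?E" for x y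
    using U(2)[of "{x, y}"] that card_insert_if[of "{y}" x] by simp
  have inj: "inj_on \<psi> ?E" and np: "gf.nonparallel (\<psi> ` ?E)"
    using represents_simple[OF \<psi>] pair by blast+
  have "3 \<le> card ?E" using U(1) k(1) by simp
  then obtain B where B: "B \<subseteq> ?E" "card B = 3" using obtain_subset_with_card_n by metis
  then obtain x y z where xyz: "x \<in> ?E" "y \<in> ?E" "z \<in> ?E" "x \<noteq> y" "x \<noteq> z" "y \<noteq> z"
    unfolding card_3_iff by blast
  have ne: "\<psi> x \<noteq> \<psi> y" "\<psi> z \<noteq> \<psi> x" "\<psi> z \<noteq> \<psi> y" using inj xyz by (metis inj_onD)+
  have "\<not> indep N (insert z {x, y})" using U(2)[of "insert z {x, y}"] xyz by simp
  then have "\<psi> z \<in> seq.span {\<psi> x, \<psi> y}"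
    using represents_insert[OF \<psi> pair[OF xyz(1,2)] xyz(3)] xyz by simp
  then obtain \<alpha> \<beta> where z: "\<psi> z = seq_scale \<alpha> (\<psi> x) + seq_scale \<beta> (\<psi> y)"
    unfolding gf.span_pair by blast
  have par: "\<psi> u = \<psi> v" if "u \<in> ?E" "v \<in> ?E" "\<psi> u = seq_scale c (\<psi> v)" for u v c
    by (rule gf.nonparallelD[OF np imageI imageI that(3)]) (use that in auto)
  have "\<alpha> \<noteq> 0" using par[of z y \<beta>] z xyz ne by auto
  moreover have "\<beta> \<noteq> 0" using par[of z x \<alpha>] z xyz ne by auto
  moreover have S: "\<psi> x \<in> ?S" "\<psi> y \<in> ?S" "\<psi> z \<in> ?S" using gf.cone_superset xyz by blast+
  ultimately have adj: "gf.adj ?S (\<psi> x) (\<psi> y)"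
    using gf.has_chords_adj[OF gf.conic_cone gf.decomposable_has_chords[OF dec]] z by metis
  have sub: "seq.span {\<psi> x, \<psi> y} \<subseteq> ?S" unfolding gf.span_pair using gf.adjD[OF adj] by blast
  have "seq.independent {\<psi> x, \<psi> y}"
    by (rule gf.nonparallel_independent_pair[OF np]) (use xyz in auto)
  then have "CARD('f) ^ 2 = card (seq.span {\<psi> x, \<psi> y})"
    using gf.card_span(2)[of "{\<psi> x, \<psi> y}"] ne(1) by (simp add: power2_eq_square)
  also have "\<dots> \<le> card ?S" using fin gf.finite_cone by (intro card_mono[OF _ sub]) auto
  also have "\<dots> \<le> 1 + card (\<psi> ` ?E) * (CARD('f) - 1)" using fin by (intro gf.card_cone_le) simp
  also have "\<dots> \<le> 1 + CARD('f) * (CARD('f) - 1)"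
    using card_image[OF inj] U(1) k(2) by simp
  finally have "CARD('f) * CARD('f) \<le> 1 + CARD('f) * (CARD('f) - 1)" by (simp add: power2_eq_square)
  moreover obtain m where "CARD('f) = Suc m" using k by (cases "CARD('f)") auto
  ultimately show False using k by simp
qed

text \<open>Four points of the plane are dependent, so two of them are adjacent. Their full line
  contains a third element of the matroid, although any three elements are independent.\<close>

lemma decomposable_not_plane_arc:
  fixes \<psi> :: "'a \<Rightarrow> nat \<Rightarrow> 'f::{field,finite}"
  assumes \<psi>: "represents \<psi> N" and dec: "gf.decomposable (gf.cone (\<psi> ` ground N))" and n: "4 \<le> n"
  shows "\<not> matroid_iso N (uniform_matroid 3 n)"
proof
  assume iso: "matroid_iso N (uniform_matroid 3 n)"
  let ?E = "ground N" and ?S = "gf.cone (\<psi> ` ground N)"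
  have fin: "finite ?E" using \<psi> by (simp add: represents_def)
  have U: "card ?E = n" "\<And>X. X \<subseteq> ?E \<Longrightarrow> indep N X \<longleftrightarrow> card X \<le> 3"
    using iso matroid_iso_uniform_iff[OF fin] by blast+
  have pair: "indep N {x, y}" if "x \<in> ?E" "y \<in> ?E" for x y
    using U(2)[of "{x, y}"] that card_insert_if[of "{y}" x] by simp
  have inj: "inj_on \<psi> ?E" and np: "gf.nonparallel (\<psi> ` ?E)"
    using represents_simple[OF \<psi>] pair by blast+
  have par: "u = v" if "u \<in> ?E" "v \<in> ?E" "\<psi> u = seq_scale c (\<psi> v)" for u v c
    using gf.nonparallelD[OF np imageI imageI that(3)] that(1,2) inj by (meson inj_onD)
  obtain D where D: "D \<subseteq> ?E" "card D = 4" using obtain_subset_with_card_n U(1) n by metis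
  then have "D \<noteq> {}" by auto
  then obtain w where w: "w \<in> D" by blast
  define B where "B = D - {w}"
  have B: "B \<subseteq> ?E" "card B = 3" "w \<in> ?E" "w \<notin> B" "insert w B = D"
    using D w finite_subset[OF D(1) fin] by (auto simp: B_def)
  have indB: "indep N B" using U(2)[OF B(1)] B(2) by simp
  have finB: "finite (\<psi> ` B)" using finite_subset[OF B(1) fin] by simp
  have "\<not> indep N (insert w B)" using U(2)[OF D(1)] D(2) B(5) by simp
  then have "\<psi> w \<in> seq.span (\<psi> ` B)" using represents_insert[OF \<psi> indB B(3,4)] by blast
  then obtain u where u: "\<psi> w = gf.comb (\<psi> ` B) u" using gf.span_finite_comb[OF finB] by blast
  define J where "J = {v \<in> \<psi> ` B. u v \<noteq> 0}"
  have uJ: "\<psi> w = gf.comb J u" unfolding u by (rule gf.comb_support[OF finB]) (auto simp: J_def)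
  have finJ: "finite J" using finB by (simp add: J_def)
  have "card J \<noteq> 0"
  proof
    assume "card J = 0"
    then have "\<psi> w = 0" using uJ finJ by (simp add: gf.comb_def)
    then show False using np B(3) unfolding gf.nonparallel_def by (metis imageI)
  qed
  moreover have "card J \<noteq> 1"
  proof
    assume "card J = 1"
    then obtain v where v: "J = {v}" by (rule card_1_singletonE)
    then obtain b where b: "b \<in> B" "v = \<psi> b" unfolding J_def by blast
    have "\<psi> w = seq_scale (u v) (\<psi> b)" using uJ v b by (simp add: gf.comb_def)
    then have "w = b" using par B(1,3) b(1) by blast
    then show False using b(1) B(4) by blast
  qed
  ultimately have J2: "2 \<le> card J" by linarith
  have ES: "\<psi> ` ?E \<subseteq> ?S" by (rule gf.cone_superset)
  have "gf.chorded ?S J"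
  proof (rule gf.chorded_relation[OF gf.conic_cone _ finJ, of _ u])
    show "J \<subseteq> ?S" using B(1) ES by (auto simp: J_def)
    have "seq.independent (\<psi> ` B)" using indB \<psi> by (simp add: represents_def)
    then show "seq.independent J" by (rule seq.independent_mono) (auto simp: J_def)
    have "\<psi> w \<in> ?S" using ES B(3) by blast
    then show "(\<Sum>j\<in>J. seq_scale (u j) j) \<in> ?S" using uJ by (simp add: gf.comb_def)
    show "gf.chorded ?S I"
      if "I \<subseteq> ?S" "finite I" "seq.independent I" "card I = card J" "\<Sum>I \<in> ?S" for I
      using gf.has_chordsD[OF gf.decomposable_has_chords[OF dec]] that J2 by simp
  qed (simp add: J_def)
  then obtain a b where ab: "a \<in> J" "b \<in> J" "a \<noteq> b" "gf.adj ?S a b" unfolding gf.chorded_def by blast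
  obtain x where x: "x \<in> B" "a = \<psi> x" using ab(1) unfolding J_def by blast
  obtain y where y: "y \<in> B" "b = \<psi> y" using ab(2) unfolding J_def by blast
  have xy: "x \<in> ?E" "y \<in> ?E" "x \<noteq> y" using x y B(1) ab(3) by auto
  have sumS: "\<psi> x + \<psi> y \<in> ?S" using gf.adj_add[OF ab(4)] x y by simp
  have "\<psi> x + \<psi> y \<noteq> 0"
  proof
    assume "\<psi> x + \<psi> y = 0"
    then have "\<psi> x = seq_scale (- 1) (\<psi> y)" by (simp add: eq_neg_iff_add_eq_0)
    then show False using par xy by blast
  qed
  then obtain c v where v: "v \<in> ?E" "c \<noteq> 0" "\<psi> x + \<psi> y = seq_scale c (\<psi> v)"
    using sumS by (auto elim!: gf.coneE)
  have "v \<noteq> x"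
  proof
    assume "v = x"
    then have "\<psi> y = seq_scale (c - 1) (\<psi> x)" using v(3) by (simp add: seq.scale_left_diff_distrib algebra_simps)
    then show False using par[of y x] xy by blast
  qed
  moreover have "v \<noteq> y"
  proof
    assume "v = y"
    then have "\<psi> x = seq_scale (c - 1) (\<psi> y)" using v(3) by (simp add: seq.scale_left_diff_distrib algebra_simps)
    then show False using par[of x y] xy by blast
  qed
  ultimately have "card {v, x, y} = 3" "v \<notin> {x, y}" using xy(3) by auto
  then have "indep N (insert v {x, y})" using U(2)[of "{v, x, y}"] v(1) xy by simp
  then have "\<psi> v \<notin> seq.span (\<psi> ` {x, y})"
    using represents_insert[OF \<psi> pair[OF xy(1,2)] v(1) \<open>v \<notin> {x, y}\<close>] by blast
  moreover have "\<psi> v = seq_scale (inverse c) (\<psi> x + \<psi> y)" using v(2,3) by simp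
  then have "\<psi> v \<in> seq.span (\<psi> ` {x, y})"
    by (simp add: seq.span_add seq.span_base seq.span_scale)
  ultimately show False by blast
qed

text \<open>Contract any \<open>t\<close> elements of the flat. The result is already simple, hence
  its own simplification.\<close>

lemma uniform_restriction_minor:
  assumes M: "matroid M" and F: "flat M F"
    and iso: "matroid_iso (restriction M F) (uniform_matroid (2 + t) (k + t))"
  shows "\<exists>N. induced_minor M N \<and> matroid_iso N (uniform_matroid 2 k)"
proof -
  interpret matroid M by (rule M)
  let ?R = "restriction M F"
  have Fg: "F \<subseteq> ground M" using flatD(1)[OF F] .
  have finF: "finite F" using finite_subset_ground[OF Fg] .
  have gR: "ground ?R = F" by (simp add: restriction_def)
  have U: "card F = k + t" "\<And>X. X \<subseteq> F \<Longrightarrow> indep ?R X \<longleftrightarrow> card X \<le> 2 + t"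
    using iso matroid_iso_uniform_iff[of ?R "2 + t" "k + t"] finF gR by auto
  obtain C where C: "C \<subseteq> F" "card C = t" "finite C"
    using obtain_subset_with_card_n[of t F] U(1) by auto
  have rank: "rank_of ?R C = t"
  proof -
    have "indep ?R I" if "I \<subseteq> C" for I
      using U(2)[of I] that C card_mono[OF C(3) that] by simp
    then have "{I. I \<subseteq> C \<and> indep ?R I} = Pow C" by blast
    moreover have "Max (card ` Pow C) = card C"
      by (rule Max_eqI) (use C(3) card_mono in auto)
    ultimately show ?thesis by (simp add: rank_of_def C(2))
  qed
  let ?K = "contraction ?R C"
  have gK: "ground ?K = F - C" by (simp add: contraction_def gR)
  have ind: "indep ?K I \<longleftrightarrow> card I \<le> 2" if I: "I \<subseteq> F - C" for I
  proof -
    have finI: "finite I" using I finF finite_subset by blast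
    have *: "card (I \<union> C) = card I + t"
      using card_Un_disjoint[OF finI C(3)] I C(2) by (simp add: disjoint_iff subset_iff)
    have full: "B = C" if "B \<subseteq> C" "card B = t" for B using card_subset_eq[OF C(3) that(1)] that(2) C(2) by simp
    have iC: "indep ?R C" using U(2)[OF C(1)] C(2) by simp
    have "indep ?K I \<longleftrightarrow> indep ?R (I \<union> C)"
      unfolding contraction_def gR rank using I full iC C(2) by auto
    also have "\<dots> \<longleftrightarrow> card (I \<union> C) \<le> 2 + t" by (rule U(2)) (use I C(1) in blast)
    finally show ?thesis using * by simp
  qed
  have nl: "nonloops ?K = F - C" unfolding nonloops_def gK using ind by auto
  have par: "parallel ?K x y \<longleftrightarrow> x \<in> F - C \<and> y = x" if "y \<in> F - C" for x y
  proof -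
    have "card {x, y} \<le> 2" by (cases "x = y") auto
    then show ?thesis using ind[of "{x, y}"] that nl unfolding parallel_def by auto
  qed
  let ?N = "restriction ?K (F - C)"
  have "is_simplification_of ?N ?K"
    unfolding is_simplification_of_def nl
    by (rule exI[of _ "F - C"]) (use par in auto)
  moreover have "induced_minor M ?R" by (rule induced_minor.restrict[OF induced_minor.refl F])
  ultimately have "induced_minor M ?N" using induced_minor.contract C(1) gR by blast
  moreover have "matroid_iso ?N (uniform_matroid 2 k)"
  proof -
    have g: "ground ?N = F - C" by (simp add: restriction_def)
    have "card (F - C) = k" using U(1) C by (simp add: card_Diff_subset)
    moreover have "indep ?N X \<longleftrightarrow> card X \<le> 2" if "X \<subseteq> F - C" for X
      using ind[OF that] that by (simp add: restriction_def)
    ultimately show ?thesis using matroid_iso_uniform_iff[of ?N] g finF by simp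
  qed
  ultimately show ?thesis by blast
qed

text \<open>An arc cut out by a subspace \<open>W\<close> is a uniform flat of \<open>M\<close>, and
  the excluded parameters leave only the full line in \<open>arc_parameters\<close>.\<close>

lemma no_uniform_restriction_has_chords:
  fixes \<phi> :: "'a \<Rightarrow> nat \<Rightarrow> 'f::{field,finite}"
  assumes pp: "primepow CARD('f)" and q2: "2 < CARD('f)"
    and \<phi>: "represents \<phi> M" and inj: "inj_on \<phi> (ground M)" and np: "gf.nonparallel (\<phi> ` ground M)"
    and no: "\<And>F r n. flat M F \<Longrightarrow> matroid_iso (restriction M F) (uniform_matroid r n) \<Longrightarrow>
      \<not> (2 \<le> r \<and> n = r + 1 \<or> r = 3 \<and> n = CARD('f) + 2 \<or>
        (\<exists>k t. 4 \<le> k \<and> k \<le> CARD('f) \<and> t \<le> CARD('f) - 3 \<and> r = 2 + t \<and> n = k + t))"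
  shows "gf.has_chords (gf.cone (\<phi> ` ground M))"
proof (rule gf.flats_has_chords[OF _ np])
  let ?A = "\<phi> ` ground M"
  show "finite ?A" using \<phi> by (simp add: represents_def)
  fix W r assume W: "seq.subspace W" and arc: "gf.arc r (?A \<inter> W)" and r: "2 \<le> r" "r < card (?A \<inter> W)"
  let ?F = "{e \<in> ground M. \<phi> e \<in> W}"
  have F: "flat M ?F" by (rule flat_preimage[OF \<phi> W])
  have img: "\<phi> ` ?F = ?A \<inter> W" by blast
  have injF: "inj_on \<phi> X" if "X \<subseteq> ?F" for X by (rule inj_on_subset[OF inj]) (use that in blast)
  have finF: "finite ?F" using \<phi> by (simp add: represents_def)
  have card: "card ?F = card (?A \<inter> W)" using card_image[OF injF[OF subset_refl]] img by simp
  have ind: "indep M X \<longleftrightarrow> card X \<le> r" if X: "X \<subseteq> ?F" for X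
  proof -
    have XA: "\<phi> ` X \<subseteq> ?A \<inter> W" using X by blast
    have cX: "card (\<phi> ` X) = card X" by (rule card_image[OF injF[OF X]])
    have "indep M X \<longleftrightarrow> seq.independent (\<phi> ` X)" using \<phi> X injF[OF X] by (auto simp: represents_def)
    also have "\<dots> \<longleftrightarrow> card X \<le> r"
    proof
      assume i: "seq.independent (\<phi> ` X)"
      obtain B where B: "B \<subseteq> ?A \<inter> W" "card B = r" "finite B"
        using obtain_subset_with_card_n[OF less_imp_le[OF r(2)]] .
      have "?A \<inter> W \<subseteq> seq.span B" using arc B(1,2) unfolding gf.arc_def by metis
      then have "\<phi> ` X \<subseteq> seq.span B" using XA by (rule subset_trans[rotated])
      then have "card (\<phi> ` X) \<le> card B" using seq.independent_span_bound[OF B(3) i] by blast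
      then show "card X \<le> r" using B cX by simp
    next
      assume "card X \<le> r"
      then show "seq.independent (\<phi> ` X)" using gf.arc_independent[OF arc XA] cX by simp
    qed
    finally show ?thesis .
  qed
  have "matroid_iso (restriction M ?F) (uniform_matroid r (card (?A \<inter> W)))"
    using matroid_iso_uniform_iff[of "restriction M ?F"] ind finF card by (auto simp: restriction_def)
  from no[OF F this] show "r = 2 \<and> card (?A \<inter> W) = CARD('f) + 1"
    using gf.arc_parameters[OF pp q2 arc r] r(1) by blast
qed

theorem theorem3p5:
  fixes q :: nat and GF :: "'f::{field,finite} itself" and M :: "'a matroid_data"
  assumes "primepow q" and "q > 2"
    and "CARD('f) = q"
    and "simple_matroid M" and "representable GF M"
  shows
    "(chordal GF M
        \<longleftrightarrow>
      \<not> (\<exists>N. induced_minor M N \<and>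
          (\<exists>U \<in> {uniform_matroid 2 k | k. 2 < k \<and> k \<le> q} \<union> {uniform_matroid 3 (q + 2)}.
             matroid_iso N U)))
     \<and>
     (chordal GF M
        \<longleftrightarrow>
      \<not> (\<exists>N. induced_restriction M N \<and>
          (\<exists>U \<in> {uniform_matroid n (n + 1) | n. n \<ge> 2}
               \<union> {uniform_matroid (2 + t) (k + t) | k t. 4 \<le> k \<and> k \<le> q \<and> 0 \<le> t \<and> t \<le> q - 3}
               \<union> {uniform_matroid 3 (q + 2)}.
             matroid_iso N U)))"
    (is "(?i \<longleftrightarrow> \<not> ?minor) \<and> (?i \<longleftrightarrow> \<not> ?restriction)")
proof -
  have q: "primepow CARD('f)" "2 < CARD('f)" using assms(1-3) by simp_all
  interpret matroid M using assms(4) by (simp add: simple_matroid_def)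
  obtain \<phi> :: "'a \<Rightarrow> nat \<Rightarrow> 'f" where \<phi>: "represents \<phi> M"
    using representable_represents[OF assms(5)] .
  have inj: "inj_on \<phi> (ground M)" and np: "gf.nonparallel (\<phi> ` ground M)"
    using represents_simple[OF \<phi>] assms(4) unfolding simple_matroid_def by blast+
  let ?S = "gf.cone (\<phi> ` ground M)"
  have chordal_minor: "\<not> ?minor" if "?i"
  proof
    have dec: "gf.decomposable ?S" by (rule chordal_decomposable[OF that \<phi>])
    assume ?minor
    then obtain N U where N: "induced_minor M N" "matroid_iso N U"
      "U \<in> {uniform_matroid 2 k | k. 2 < k \<and> k \<le> q} \<union> {uniform_matroid 3 (q + 2)}" by blast
    obtain \<psi> :: "'a \<Rightarrow> nat \<Rightarrow> 'f" where \<psi>: "represents \<psi> N" "gf.decomposable (gf.cone (\<psi> ` ground N))"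
      using induced_minor_decomposable[OF N(1) \<phi> dec] by blast
    from N(3) show False
    proof
      assume "U \<in> {uniform_matroid 2 k | k. 2 < k \<and> k \<le> q}"
      then obtain k where "U = uniform_matroid 2 k" "2 < k" "k \<le> CARD('f)" using assms(3) by blast
      then show False using decomposable_not_line[OF \<psi>] N(2) by blast
    next
      assume "U \<in> {uniform_matroid 3 (q + 2)}"
      then show False using decomposable_not_plane_arc[OF \<psi>, of "q + 2"] N(2) assms(2) by simp
    qed
  qed
  have minor_restriction: "?minor" if restr: ?restriction
  proof -
    obtain N U where N: "induced_restriction M N" "matroid_iso N U"
      and U: "U \<in> {uniform_matroid n (n + 1) | n. n \<ge> 2}
               \<union> {uniform_matroid (2 + t) (k + t) | k t. 4 \<le> k \<and> k \<le> q \<and> 0 \<le> t \<and> t \<le> q - 3}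
               \<union> {uniform_matroid 3 (q + 2)}"
      using restr by (elim exE conjE bexE)
    obtain F where F: "flat M F" "matroid_iso (restriction M F) U"
      using N unfolding induced_restriction_def by auto
    \<comment> \<open>Serves two families of (iii): \<open>k = 3\<close>, allowed by
      \<open>q > 2\<close>, gives \<open>U_{n,n+1}\<close>, and \<open>k \<ge> 4\<close> gives the
      second family. The remaining \<open>U_{3,q+2}\<close> is itself listed in (ii).\<close>
    have line: ?minor if k: "U = uniform_matroid (2 + t) (k + t)" "2 < k" "k \<le> q" for k t
    proof -
      obtain N where N: "induced_minor M N" "matroid_iso N (uniform_matroid 2 k)"
        using uniform_restriction_minor[OF matroid_axioms F(1), of t k] F(2) k(1) by auto
      have "uniform_matroid 2 k \<in> {uniform_matroid 2 k | k. 2 < k \<and> k \<le> q} \<union> {uniform_matroid 3 (q + 2)}"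
        using k(2,3) by blast
      then show ?thesis using N by blast
    qed
    consider n where "U = uniform_matroid n (n + 1)" "2 \<le> n"
      | k t where "U = uniform_matroid (2 + t) (k + t)" "4 \<le> k" "k \<le> q"
      | "U = uniform_matroid 3 (q + 2)" using U by blast
    then show ?minor
    proof cases
      case (1 n)
      then obtain t where "n = 2 + t" using le_Suc_ex by blast
      then show ?thesis using line[of t 3] 1(1) assms(2) by (simp add: numeral_3_eq_3)
    next
      case (2 k t)
      then show ?thesis using line[of t k] by simp
    next
      case 3
      then show ?thesis using induced_minor.restrict[OF induced_minor.refl F(1)] F(2) by blast
    qed
  qed
  have restriction_chordal: "?i" if none: "\<not> ?restriction"
  proof -
    have "\<not> (2 \<le> r \<and> n = r + 1 \<or> r = 3 \<and> n = CARD('f) + 2 \<or>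
        (\<exists>k t. 4 \<le> k \<and> k \<le> CARD('f) \<and> t \<le> CARD('f) - 3 \<and> r = 2 + t \<and> n = k + t))"
      if F: "flat M F" "matroid_iso (restriction M F) (uniform_matroid r n)" for F r n
    proof
      assume R: "2 \<le> r \<and> n = r + 1 \<or> r = 3 \<and> n = CARD('f) + 2 \<or>
        (\<exists>k t. 4 \<le> k \<and> k \<le> CARD('f) \<and> t \<le> CARD('f) - 3 \<and> r = 2 + t \<and> n = k + t)"
      have "uniform_matroid r n \<in> {uniform_matroid n (n + 1) | n. n \<ge> 2}
               \<union> {uniform_matroid (2 + t) (k + t) | k t. 4 \<le> k \<and> k \<le> q \<and> 0 \<le> t \<and> t \<le> q - 3}
               \<union> {uniform_matroid 3 (q + 2)}"
        using R
      proof (elim disjE exE conjE)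
        assume "2 \<le> r" "n = r + 1"
        then show ?thesis by (intro UnI1 CollectI exI[of _ r]) simp
      next
        assume "r = 3" "n = CARD('f) + 2"
        then show ?thesis using assms(3) by (intro UnI2) simp
      next
        fix k t assume "4 \<le> k" "k \<le> CARD('f)" "t \<le> CARD('f) - 3" "r = 2 + t" "n = k + t"
        then show ?thesis
          using assms(3) by (intro UnI1[OF UnI2] CollectI exI[of _ k] exI[of _ t]) simp
      qed
      moreover have "induced_restriction M (restriction M F)" using F(1) unfolding induced_restriction_def by blast
      ultimately have ?restriction using F(2) by (intro exI conjI bexI)
      then show False using none by contradiction
    qed
    then have "gf.has_chords ?S" by (rule no_uniform_restriction_has_chords[OF q \<phi> inj np])
    moreover have "finite ?S" using finite_ground gf.finite_cone by blast
    ultimately have "gf.decomposable ?S"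
      using gf.has_chords_decomposable[OF q(2) gf.conic_cone] by blast
    then show ?i by (rule decomposable_chordal[OF _ \<phi> inj np HOL.refl])
  qed
  have chordal_restriction: "\<not> ?restriction" if "?i"
    using chordal_minor[OF that] by (rule contrapos_nn) (rule minor_restriction)
  have minor_chordal: "?i" if none: "\<not> ?minor"
    by (rule restriction_chordal, rule contrapos_nn[OF none]) (rule minor_restriction)
  show ?thesis
  proof (intro conjI)
    show "?i \<longleftrightarrow> \<not> ?minor" by (rule iffI[OF chordal_minor minor_chordal])
    show "?i \<longleftrightarrow> \<not> ?restriction" by (rule iffI[OF chordal_restriction restriction_chordal])
  qed
qed

end
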